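(* Let $G$ be a linear algebraic group over $\mathbb{R}$ with $G(\mathbb{R})$ compact, and let $V$ be an affine $G$-variety over $\mathbb{R}$ with quotient morphism $\pi\colon V\to W=V/\!/G$. Let $K$ be a $G$-invariant basic closed set in $V(\mathbb{R})$, let $N$ be a quadratic module in $\mathbb{R}[V]^G=\mathbb{R}[W]$, and let $M$ be the quadratic module in $\mathbb{R}[V]$ generated by $N$. Consider the following properties of $N$: (IMP$_K$) $N$ solves the invariant $K$-moment problem; (AMP$_K$) $M$ solves the averaged $K$-moment problem; (SMP$_K$) $M$ solves the (ordinary) $K$-moment problem in $V$. Then (SMP$_K$) $\Rightarrow$ (AMP$_K$) and (IMP$_K$) $\Rightarrow$ (AMP$_K$). On the other hand, neither (IMP$_K$) nor (AMP$_K$) implies (SMP$_K$) in general: there exist a linear algebraic group $G$ over $\mathbb{R}$ with $G(\mathbb{R})$ compact, an affine $G$-variety $V$ over $\mathbb{R}$, a $G$-invariant basic closed set $K$ in $V(\mathbb{R})$ and a quadratic module $N$ in $\mathbb{R}[V]^G$ such that, with $M$ the quadratic module in $\mathbb{R}[V]$ generated by $N$, (IMP$_K$) holds and (SMP$_K$) fails; and there exist a linear algebraic group $G$ over $\mathbb{R}$ with $G(\mathbb{R})$ compact, an affine $G$-variety $V$ over $\mathbb{R}$, a $G$-invariant basic closed set $K$ in $V(\mathbb{R})$ and a quadratic module $N$ in $\mathbb{R}[V]^G$ such that, with $M$ the quadratic module in $\mathbb{R}[V]$ generated by $N$, (AMP$_K$) holds and (SMP$_K$) fails.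
   Context: An affine $\mathbb{R}$-variety is a reduced affine scheme of finite type over $\mathbb{R}$. Standing assumption: $G(\mathbb{R})$ is Zariski dense in $G$; $G$ is reductive since $G(\mathbb{R})$ is compact. An affine $G$-variety is an affine $\mathbb{R}$-variety $V$ with an action $G\times V\to V$ by a morphism; $G(\mathbb{R})$ acts on $\mathbb{R}[V]$ by $f^g(x)=f(gx)$; $V/\!/G$ is the affine variety with coordinate ring $\mathbb{R}[V]^G$. $G$-invariant subsets are those stable under $G(\mathbb{R})$. A linear functional $L\colon\mathbb{R}[V]\to\mathbb{R}$ is $G$-invariant if $L(f^g)=L(f)$ for all $f\in\mathbb{R}[V]$, $g\in G(\mathbb{R})$. A set in $V(\mathbb{R})$ is basic closed if it is of the form $\{f_1\ge0,\dots,f_r\ge0\}$ with $f_i\in\mathbb{R}[V]$. A quadratic module in a ring $A$ is a subset $M$ with $1\in M$, $M+M\subset M$, $a^2M\subset M$ for all $a\in A$. "Measure" means (positive) Borel measure for which all functions in $\mathbb{R}[V]$ are integrable. For a $G$-invariant linear functional $L\colon\mathbb{R}[V]\to\mathbb{R}$ let (E) be the condition: there exists a $G$-invariant measure $\mu$ on $K$ with $L(f)=\int_Kf\,d\mu$ for all $f\in\mathbb{R}[V]$. (For such $L$ this is equivalent to the existence of a measure $\mu$ on $K$ with $L(f)=\int_Kf\,d\mu$ for all $f\in\mathbb{R}[V]^G$.) A quadratic module $N\subset\mathbb{R}[W]$ solves the invariant $K$-moment problem if for every $G$-invariant $L$: (E) holds iff $L\ge0$ on $N$. A quadratic module $M\subset\mathbb{R}[V]$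 solves the averaged $K$-moment problem if for every $G$-invariant $L$: (E) holds iff $L\ge0$ on $M$. A quadratic module $M\subset\mathbb{R}[V]$ solves the (ordinary) $K$-moment problem if the linear functionals $L\colon\mathbb{R}[V]\to\mathbb{R}$ (not necessarily $G$-invariant) with $L|_M\ge0$ are precisely those of the form $L(f)=\int_Kf\,d\mu$ with $\mu$ a Borel measure on $K$. *)

theory Defs
  imports "HOL-Analysis.Analysis" "HOL-Algebra.Group_Action" "HOL-Algebra.Module"
begin

text \<open>
  Reduced affine schemes of finite type over the reals are encoded by their complex points: such a
  scheme is a set \<open>V\<close> of points of complex affine space cut out by polynomials with real
  coefficients, and by the Nullstellensatz its coordinate ring is the ring of restrictions to
  \<open>V\<close> of polynomial functions with real coefficients.  The real points need not be dense in
  \<open>V\<close> (they may even be empty), so coordinate functions are functions on \<open>V\<close> and not on its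
  real points.  A point of affine \<open>n\<close>-space is a function on \<open>nat\<close> that vanishes from index
  \<open>n\<close> on; on these the product topology of the function type is the Euclidean topology.
\<close>

definition affine_space :: "nat \<Rightarrow> (nat \<Rightarrow> complex) set" where
  "affine_space n = {x. \<forall>i\<ge>n. x i = 0}"

definition real_points :: "(nat \<Rightarrow> complex) set \<Rightarrow> (nat \<Rightarrow> complex) set" where
  "real_points X = {x \<in> X. \<forall>i. x i \<in> \<real>}"

inductive_set real_subalgebra :: "('p \<Rightarrow> complex) set \<Rightarrow> ('p \<Rightarrow> complex) set"
  for S :: "('p \<Rightarrow> complex) set" where
  gen: "f \<in> S \<Longrightarrow> f \<in> real_subalgebra S"
| const: "(\<lambda>_. complex_of_real c) \<in> real_subalgebra S"
| add: "f \<in> real_subalgebra S \<Longrightarrow> g \<in> real_subalgebra S \<Longrightarrow> (\<lambda>x. f x + g x) \<in> real_subalgebra S"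
| mult: "f \<in> real_subalgebra S \<Longrightarrow> g \<in> real_subalgebra S \<Longrightarrow> (\<lambda>x. f x * g x) \<in> real_subalgebra S"

definition real_polys :: "nat \<Rightarrow> ((nat \<Rightarrow> complex) \<Rightarrow> complex) set" where
  "real_polys n = real_subalgebra {(\<lambda>x. x i) | i. i < n}"

definition real_polys2 ::
  "nat \<Rightarrow> nat \<Rightarrow> ((nat \<Rightarrow> complex) \<times> (nat \<Rightarrow> complex) \<Rightarrow> complex) set" where
  "real_polys2 m n =
     real_subalgebra ({(\<lambda>(y, x). y i) | i. i < m} \<union> {(\<lambda>(y, x). x j) | j. j < n})"

definition affine_variety :: "nat \<Rightarrow> (nat \<Rightarrow> complex) set \<Rightarrow> bool" where
  "affine_variety n V \<longleftrightarrow>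
     (\<exists>S \<subseteq> real_polys n. V = {x \<in> affine_space n. \<forall>p\<in>S. p x = 0})"

definition coord_algebra ::
  "nat \<Rightarrow> (nat \<Rightarrow> complex) set \<Rightarrow> (real, (nat \<Rightarrow> complex) \<Rightarrow> complex) module" where
  "coord_algebra n V =
    \<lparr>carrier = (\<lambda>p. restrict p V) ` real_polys n,
     monoid.mult = (\<lambda>f g. \<lambda>x\<in>V. f x * g x),
     one = (\<lambda>x\<in>V. 1),
     zero = (\<lambda>x\<in>V. 0),
     add = (\<lambda>f g. \<lambda>x\<in>V. f x + g x),
     smult = (\<lambda>c f. \<lambda>x\<in>V. complex_of_real c * f x)\<rparr>"

text \<open>A product of varieties is not embedded into a larger affine space: its regular functions are
  polynomial functions of a pair of points.\<close>

definition regular_map ::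
  "nat \<Rightarrow> (nat \<Rightarrow> complex) set \<Rightarrow> nat \<Rightarrow> (nat \<Rightarrow> complex) set \<Rightarrow>
   ((nat \<Rightarrow> complex) \<Rightarrow> (nat \<Rightarrow> complex)) \<Rightarrow> bool" where
  "regular_map m X n Y h \<longleftrightarrow>
     (\<forall>x\<in>X. h x \<in> Y) \<and> (\<forall>i<n. \<exists>p\<in>real_polys m. \<forall>x\<in>X. h x i = p x)"

definition regular_map2 ::
  "nat \<Rightarrow> (nat \<Rightarrow> complex) set \<Rightarrow> nat \<Rightarrow> (nat \<Rightarrow> complex) set \<Rightarrow> nat \<Rightarrow> (nat \<Rightarrow> complex) set \<Rightarrow>
   ((nat \<Rightarrow> complex) \<Rightarrow> (nat \<Rightarrow> complex) \<Rightarrow> (nat \<Rightarrow> complex)) \<Rightarrow> bool" where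
  "regular_map2 m X n Y k Z h \<longleftrightarrow>
     (\<forall>x\<in>X. \<forall>y\<in>Y. h x y \<in> Z) \<and>
     (\<forall>i<k. \<exists>p\<in>real_polys2 m n. \<forall>x\<in>X. \<forall>y\<in>Y. h x y i = p (x, y))"

text \<open>``Linear algebraic group'' is taken in the sense of affine algebraic group: a group object in
  affine varieties over the reals.  The carrier of \<open>G\<close> is the set of complex points, and reducedness
  is no restriction in characteristic zero.\<close>

definition linear_algebraic_group :: "nat \<Rightarrow> (nat \<Rightarrow> complex) monoid \<Rightarrow> bool" where
  "linear_algebraic_group m G \<longleftrightarrow>
     affine_variety m (carrier G) \<and> group G \<and>
     regular_map2 m (carrier G) m (carrier G) m (carrier G) (\<lambda>g h. g \<otimes>\<^bsub>G\<^esub> h) \<and>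
     regular_map m (carrier G) m (carrier G) (\<lambda>g. inv\<^bsub>G\<^esub> g) \<and>
     \<one>\<^bsub>G\<^esub> \<in> real_points (carrier G)"

definition real_points_dense :: "nat \<Rightarrow> (nat \<Rightarrow> complex) set \<Rightarrow> bool" where
  "real_points_dense n X \<longleftrightarrow>
     (\<forall>p\<in>real_polys n. (\<forall>x\<in>real_points X. p x = 0) \<longrightarrow> (\<forall>x\<in>X. p x = 0))"

definition affine_G_variety ::
  "nat \<Rightarrow> (nat \<Rightarrow> complex) monoid \<Rightarrow> nat \<Rightarrow> (nat \<Rightarrow> complex) set \<Rightarrow>
   ((nat \<Rightarrow> complex) \<Rightarrow> (nat \<Rightarrow> complex) \<Rightarrow> (nat \<Rightarrow> complex)) \<Rightarrow> bool" where
  "affine_G_variety m G n V \<phi> \<longleftrightarrow>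
     affine_variety n V \<and> group_action G V \<phi> \<and> regular_map2 m (carrier G) n V n V \<phi>"

text \<open>The translate \<open>f\<^sup>g\<close> of a coordinate function is \<open>compose V f (\<phi> g)\<close>.  The algebra of
  invariants below is the coordinate ring of the quotient \<open>V // G\<close>; the quotient morphism is dual to
  its inclusion.  It suffices to use the real points of \<open>G\<close>, as they are Zariski dense.\<close>

definition invariant_algebra ::
  "(nat \<Rightarrow> complex) monoid \<Rightarrow> nat \<Rightarrow> (nat \<Rightarrow> complex) set \<Rightarrow>
   ((nat \<Rightarrow> complex) \<Rightarrow> (nat \<Rightarrow> complex) \<Rightarrow> (nat \<Rightarrow> complex)) \<Rightarrow>
   (real, (nat \<Rightarrow> complex) \<Rightarrow> complex) module" where
  "invariant_algebra G n V \<phi> = (coord_algebra n V)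
     \<lparr>carrier := {f \<in> carrier (coord_algebra n V).
                    \<forall>g\<in>real_points (carrier G). compose V f (\<phi> g) = f}\<rparr>"

definition basic_closed :: "nat \<Rightarrow> (nat \<Rightarrow> complex) set \<Rightarrow> (nat \<Rightarrow> complex) set \<Rightarrow> bool" where
  "basic_closed n V K \<longleftrightarrow>
     (\<exists>F. finite F \<and> F \<subseteq> carrier (coord_algebra n V) \<and>
          K = {x \<in> real_points V. \<forall>f\<in>F. Re (f x) \<ge> 0})"

definition invariant_set ::
  "(nat \<Rightarrow> complex) monoid \<Rightarrow>
   ((nat \<Rightarrow> complex) \<Rightarrow> (nat \<Rightarrow> complex) \<Rightarrow> (nat \<Rightarrow> complex)) \<Rightarrow> (nat \<Rightarrow> complex) set \<Rightarrow> bool" where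
  "invariant_set G \<phi> K \<longleftrightarrow> (\<forall>g\<in>real_points (carrier G). \<phi> g ` K \<subseteq> K)"

definition quadratic_module :: "('a, 'b) ring_scheme \<Rightarrow> 'a set \<Rightarrow> bool" where
  "quadratic_module A M \<longleftrightarrow>
     M \<subseteq> carrier A \<and> \<one>\<^bsub>A\<^esub> \<in> M \<and>
     (\<forall>p\<in>M. \<forall>q\<in>M. p \<oplus>\<^bsub>A\<^esub> q \<in> M) \<and>
     (\<forall>a\<in>carrier A. \<forall>p\<in>M. (a \<otimes>\<^bsub>A\<^esub> a) \<otimes>\<^bsub>A\<^esub> p \<in> M)"

definition quadratic_module_generated :: "('a, 'b) ring_scheme \<Rightarrow> 'a set \<Rightarrow> 'a set" where
  "quadratic_module_generated A S = \<Inter>{M. quadratic_module A M \<and> S \<subseteq> M}"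

definition linear_functional :: "(real, 'a) module \<Rightarrow> ('a \<Rightarrow> real) \<Rightarrow> bool" where
  "linear_functional A L \<longleftrightarrow>
     (\<forall>f\<in>carrier A. \<forall>g\<in>carrier A. L (f \<oplus>\<^bsub>A\<^esub> g) = L f + L g) \<and>
     (\<forall>c. \<forall>f\<in>carrier A. L (c \<odot>\<^bsub>A\<^esub> f) = c * L f)"

definition invariant_functional ::
  "(nat \<Rightarrow> complex) monoid \<Rightarrow> nat \<Rightarrow> (nat \<Rightarrow> complex) set \<Rightarrow>
   ((nat \<Rightarrow> complex) \<Rightarrow> (nat \<Rightarrow> complex) \<Rightarrow> (nat \<Rightarrow> complex)) \<Rightarrow>
   (((nat \<Rightarrow> complex) \<Rightarrow> complex) \<Rightarrow> real) \<Rightarrow> bool" where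
  "invariant_functional G n V \<phi> L \<longleftrightarrow>
     linear_functional (coord_algebra n V) L \<and>
     (\<forall>f\<in>carrier (coord_algebra n V). \<forall>g\<in>real_points (carrier G). L (compose V f (\<phi> g)) = L f)"

text \<open>Coordinate functions take real values at real points, so taking the real part in the integrals
  (and in the inequalities above) is only a change of type.\<close>

definition measure_on ::
  "nat \<Rightarrow> (nat \<Rightarrow> complex) set \<Rightarrow> (nat \<Rightarrow> complex) set \<Rightarrow> (nat \<Rightarrow> complex) measure \<Rightarrow> bool" where
  "measure_on n V K \<mu> \<longleftrightarrow>
     space \<mu> = K \<and> sets \<mu> = sets (restrict_space borel K) \<and>
     (\<forall>f\<in>carrier (coord_algebra n V). integrable \<mu> (\<lambda>x. Re (f x)))"

definition represents ::
  "nat \<Rightarrow> (nat \<Rightarrow> complex) set \<Rightarrow> (nat \<Rightarrow> complex) measure \<Rightarrow>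
   (((nat \<Rightarrow> complex) \<Rightarrow> complex) \<Rightarrow> real) \<Rightarrow> bool" where
  "represents n V \<mu> L \<longleftrightarrow> (\<forall>f\<in>carrier (coord_algebra n V). L f = (\<integral>x. Re (f x) \<partial>\<mu>))"

definition invariant_measure ::
  "(nat \<Rightarrow> complex) monoid \<Rightarrow>
   ((nat \<Rightarrow> complex) \<Rightarrow> (nat \<Rightarrow> complex) \<Rightarrow> (nat \<Rightarrow> complex)) \<Rightarrow> (nat \<Rightarrow> complex) measure \<Rightarrow> bool" where
  "invariant_measure G \<phi> \<mu> \<longleftrightarrow> (\<forall>g\<in>real_points (carrier G). distr \<mu> \<mu> (\<phi> g) = \<mu>)"

definition has_invariant_measure ::
  "(nat \<Rightarrow> complex) monoid \<Rightarrow> nat \<Rightarrow> (nat \<Rightarrow> complex) set \<Rightarrow>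
   ((nat \<Rightarrow> complex) \<Rightarrow> (nat \<Rightarrow> complex) \<Rightarrow> (nat \<Rightarrow> complex)) \<Rightarrow> (nat \<Rightarrow> complex) set \<Rightarrow>
   (((nat \<Rightarrow> complex) \<Rightarrow> complex) \<Rightarrow> real) \<Rightarrow> bool" where
  "has_invariant_measure G n V \<phi> K L \<longleftrightarrow>
     (\<exists>\<mu>. measure_on n V K \<mu> \<and> invariant_measure G \<phi> \<mu> \<and> represents n V \<mu> L)"

definition solves_invariant_moment_problem ::
  "(nat \<Rightarrow> complex) monoid \<Rightarrow> nat \<Rightarrow> (nat \<Rightarrow> complex) set \<Rightarrow>
   ((nat \<Rightarrow> complex) \<Rightarrow> (nat \<Rightarrow> complex) \<Rightarrow> (nat \<Rightarrow> complex)) \<Rightarrow> (nat \<Rightarrow> complex) set \<Rightarrow>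
   ((nat \<Rightarrow> complex) \<Rightarrow> complex) set \<Rightarrow> bool" where
  "solves_invariant_moment_problem G n V \<phi> K N \<longleftrightarrow>
     quadratic_module (invariant_algebra G n V \<phi>) N \<and>
     (\<forall>L. invariant_functional G n V \<phi> L \<longrightarrow>
        (has_invariant_measure G n V \<phi> K L \<longleftrightarrow> (\<forall>f\<in>N. L f \<ge> 0)))"

definition solves_averaged_moment_problem ::
  "(nat \<Rightarrow> complex) monoid \<Rightarrow> nat \<Rightarrow> (nat \<Rightarrow> complex) set \<Rightarrow>
   ((nat \<Rightarrow> complex) \<Rightarrow> (nat \<Rightarrow> complex) \<Rightarrow> (nat \<Rightarrow> complex)) \<Rightarrow> (nat \<Rightarrow> complex) set \<Rightarrow>
   ((nat \<Rightarrow> complex) \<Rightarrow> complex) set \<Rightarrow> bool" where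
  "solves_averaged_moment_problem G n V \<phi> K M \<longleftrightarrow>
     quadratic_module (coord_algebra n V) M \<and>
     (\<forall>L. invariant_functional G n V \<phi> L \<longrightarrow>
        (has_invariant_measure G n V \<phi> K L \<longleftrightarrow> (\<forall>f\<in>M. L f \<ge> 0)))"

definition solves_moment_problem ::
  "nat \<Rightarrow> (nat \<Rightarrow> complex) set \<Rightarrow> (nat \<Rightarrow> complex) set \<Rightarrow>
   ((nat \<Rightarrow> complex) \<Rightarrow> complex) set \<Rightarrow> bool" where
  "solves_moment_problem n V K M \<longleftrightarrow>
     quadratic_module (coord_algebra n V) M \<and>
     (\<forall>L. linear_functional (coord_algebra n V) L \<longrightarrow>
        ((\<forall>f\<in>M. L f \<ge> 0) \<longleftrightarrow> (\<exists>\<mu>. measure_on n V K \<mu> \<and> represents n V \<mu> L)))"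

definition moment_setting ::
  "nat \<Rightarrow> (nat \<Rightarrow> complex) monoid \<Rightarrow> nat \<Rightarrow> (nat \<Rightarrow> complex) set \<Rightarrow>
   ((nat \<Rightarrow> complex) \<Rightarrow> (nat \<Rightarrow> complex) \<Rightarrow> (nat \<Rightarrow> complex)) \<Rightarrow> (nat \<Rightarrow> complex) set \<Rightarrow>
   ((nat \<Rightarrow> complex) \<Rightarrow> complex) set \<Rightarrow> bool" where
  "moment_setting m G n V \<phi> K N \<longleftrightarrow>
     linear_algebraic_group m G \<and> compact (real_points (carrier G)) \<and>
     real_points_dense m (carrier G) \<and>
     affine_G_variety m G n V \<phi> \<and>
     basic_closed n V K \<and> invariant_set G \<phi> K \<and>
     quadratic_module (invariant_algebra G n V \<phi>) N"

end

theory Submission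
  imports Defs "HOL-Computational_Algebra.Fundamental_Theorem_Algebra"
begin

text \<open>
  The implications need a way to make a representing measure invariant, and the counterexamples a way to
  produce a representing measure from positivity alone.  Haar measure (\<open>compact_group.ex_haar_measure\<close>)
  does the first, Haviland's theorem (\<open>haviland\<close>) the second.

  If the ordinary moment problem is solved by \<open>M\<close>, an invariant functional \<open>L \<ge> 0\<close> on \<open>M\<close> has some
  representing measure \<open>\<mu>\<close>.  Pushing \<open>\<nu> \<times> \<mu>\<close> forward along the action, where \<open>\<nu>\<close> is Haar measure of the
  compact group \<open>G(\<real>)\<close>, gives an invariant measure; Fubini's theorem and the invariance of \<open>L\<close> show that
  it still represents \<open>L\<close> 
  (\<open>compact_algebraic_action.ex_invariant_representing_measure\<close>).  Integrability on the product holds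
  because a regular function of a pair \<open>(g, x)\<close> with \<open>g\<close> in a compact set is dominated by a regular
  function of \<open>x\<close>.

  If the invariant moment problem is solved by \<open>N\<close>, only one thing is to be shown: a functional with an
  invariant representing measure \<open>\<mu>\<close> is nonnegative on the quadratic module generated by \<open>N\<close>.  For
  \<open>f \<in> N\<close> the restriction of \<open>\<mu>\<close> to the invariant set \<open>{f < 0}\<close> is again invariant, so its integral of
  \<open>f\<close> is nonnegative, and therefore \<open>\<mu>{f < 0} = 0\<close>
  (\<open>compact_algebraic_action.AE_nonneg_if_invariant_moments\<close>).  The functions that are nonnegative \<open>\<mu>\<close>-almost
  everywhere form a quadratic module, so it contains the one generated by \<open>N\<close>.

  Since the invariant property implies the averaged one, one example refutes both converses.  Let the
  group of order two act on the curve \<open>y\<^sup>2 = x\<^sup>4\<close> by \<open>y \<mapsto> -y\<close>, let \<open>K\<close> be the set of all real points, and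
  let \<open>N\<close> be the set of invariants that are nonnegative on \<open>K\<close>.  A functional that is invariant and
  nonnegative on \<open>N\<close> is nonnegative on every nonnegative function, because \<open>f\<close> and its average have the
  same value; Haviland's theorem and averaging then give the invariant measure.  The invariants are the
  polynomials in \<open>x\<close>, and those in \<open>N\<close> are nonnegative on the line, hence sums of squares, so
  \<open>M\<close> consists of sums of squares.  But \<open>x\<^sup>2 + y\<close> vanishes on one of the two parabolas and equals \<open>2x\<^sup>2\<close> on the
  other, and it is not even in the closure of the sums of squares: a function on the curve is
  \<open>u(x) + v(x) y\<close>, and \<open>u + v y \<mapsto> A(u) - 64 v(0)\<close> is nonnegative on all squares but negative at
  \<open>x\<^sup>2 + y\<close>, when \<open>A\<close> has the moments \<open>2\<^bsup>n\<^sup>2\<^esup>\<close> for even \<open>n\<close> and \<open>0\<close> for odd \<open>n\<close>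
  (\<open>curve_functional_square\<close>).

  Haar measure and Haviland's theorem both come from a subadditive set function that is additive on
  separated sets, by turning it into a Borel measure through covers by open sets.  For Haar measure the
  set function is a cluster point of quotients of covering numbers by translates of small
  neighbourhoods of the unit.  For Haviland's theorem it is the value at indicator functions of a
  positive extension of the given functional, which exists by a Hahn-Banach argument.
\<close>

section \<open>Borel measures from contents on metric spaces\<close>

text \<open>Additivity is asked for only on pairs of sets at positive distance.  This is all that Caratheodory's
criterion for metric outer measures needs, and all that covering numbers give in the limit.\<close>

locale metric_content =
  fixes K :: "'a::metric_space set" and c :: "'a set \<Rightarrow> ennreal"
  assumes mono: "A \<subseteq> B \<Longrightarrow> B \<subseteq> K \<Longrightarrow> c A \<le> c B"
    and subadditive: "A \<subseteq> K \<Longrightarrow> B \<subseteq> K \<Longrightarrow> c (A \<union> B) \<le> c A + c B"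
    and separated: "A \<subseteq> K \<Longrightarrow> B \<subseteq> K \<Longrightarrow> 0 < \<delta> \<Longrightarrow> (\<And>a b. a \<in> A \<Longrightarrow> b \<in> B \<Longrightarrow> \<delta> \<le> dist a b)
           \<Longrightarrow> c A + c B \<le> c (A \<union> B)"
    and finite_total: "c K < \<infinity>"
begin

definition open_covers :: "'a set \<Rightarrow> (nat \<Rightarrow> 'a set) set" where
  "open_covers E = {A. (\<forall>i. openin (top_of_set K) (A i)) \<and> E \<subseteq> (\<Union>i. A i)}"

definition outer :: "'a set \<Rightarrow> ennreal" where
  "outer E = (INF A\<in>open_covers E. \<Sum>i. c (A i))"

lemma content_empty: "c {} = 0"
proof -
  have "c {} + c {} \<le> c ({} \<union> {})"
    by (rule separated[where \<delta> = 1]) auto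
  moreover have "c {} < \<infinity>"
    using mono[of "{}" K] finite_total by (auto intro: le_less_trans)
  ultimately show ?thesis
    by (cases "c {}") (auto simp: ennreal_plus[symmetric] simp del: ennreal_plus)
qed

lemma openin_sub: "openin (top_of_set K) A \<Longrightarrow> A \<subseteq> K"
  by (simp add: openin_imp_subset)

lemma outer_mono: "A \<subseteq> B \<Longrightarrow> outer A \<le> outer B"
  unfolding outer_def by (rule INF_superset_mono) (auto simp: open_covers_def)

lemma outer_open_le:
  assumes "openin (top_of_set K) U"
  shows "outer U \<le> c U"
proof -
  have "outer U \<le> (\<Sum>i. c ((\<lambda>i::nat. if i = 0 then U else {}) i))"
    unfolding outer_def using assms
    by (intro INF_lower) (auto simp: open_covers_def split: if_splits)
  also have "\<dots> = c U"
    by (subst suminf_finite[of "{0}"]) (auto simp: content_empty)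
  finally show ?thesis .
qed

lemma outer_empty: "outer {} = 0"
  using outer_open_le[of "{}"] by (simp add: content_empty)

lemma outer_finite: "E \<subseteq> K \<Longrightarrow> outer E < \<infinity>"
  using outer_mono[of E K] outer_open_le[of K] finite_total
  by (auto intro: le_less_trans)

lemma outer_close:
  assumes "outer E < x"
  obtains A where "A \<in> open_covers E" "(\<Sum>i. c (A i)) < x"
  using assms unfolding outer_def by (auto simp: INF_less_iff)

lemma countably_subadditive_outer: "outer (\<Union>n. A n) \<le> (\<Sum>n. outer (A n))"
proof (rule ennreal_le_epsilon)
  fix e :: real assume e: "0 < e" and fin: "(\<Sum>n. outer (A n)) < Orderings.top"
  have *: "outer (A n) < outer (A n) + e * (1/2)^Suc n" for n
    using e fin by (auto simp: less_top dest!: ennreal_suminf_lessD)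
  have "\<exists>B. B \<in> open_covers (A n) \<and> (\<Sum>i. c (B i)) \<le> outer (A n) + e * (1/2)^Suc n" for n
    by (rule outer_close[OF *]) (auto intro: less_imp_le)
  then obtain B where B: "\<And>n. B n \<in> open_covers (A n)"
    and le: "\<And>n. (\<Sum>i. c (B n i)) \<le> outer (A n) + e * (1/2)^Suc n"
    by metis
  define C where "C = case_prod B \<circ> prod_decode"
  have Cnm: "C (prod_encode (n, i)) = B n i" for n i
    by (simp add: C_def)
  have "C \<in> open_covers (\<Union>n. A n)"
  proof -
    have "openin (top_of_set K) (C i)" for i
      using B by (auto simp: C_def open_covers_def split_beta)
    moreover have "(\<Union>n. A n) \<subseteq> (\<Union>i. C i)"
    proof clarify
      fix x n assume "x \<in> A n"
      with B[of n] obtain i where "x \<in> B n i" by (auto simp: open_covers_def)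
      then show "x \<in> (\<Union>i. C i)" using Cnm by (metis UNIV_I UN_I)
    qed
    ultimately show ?thesis by (simp add: open_covers_def)
  qed
  then have "outer (\<Union>n. A n) \<le> (\<Sum>i. c (C i))"
    unfolding outer_def by (rule INF_lower)
  also have "\<dots> = (\<Sum>n. \<Sum>i. c (B n i))"
    using suminf_ennreal_2dimen[where f = "\<lambda>(n, i). c (B n i)" and g = "\<lambda>n. \<Sum>i. c (B n i)"]
    by (simp add: C_def o_def split_beta)
  also have "\<dots> \<le> (\<Sum>n. outer (A n) + e * (1/2)^Suc n)"
    using le by (intro suminf_le) auto
  also have "\<dots> = (\<Sum>n. outer (A n)) + (\<Sum>n. ennreal e * ennreal ((1/2) ^ Suc n))"
    using e by (subst suminf_add[symmetric]) (auto simp del: ennreal_suminf_cmult simp add: ennreal_mult[symmetric])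
  also have "(\<Sum>n. ennreal e * ennreal ((1/2) ^ Suc n)) = ennreal e * (\<Sum>n. ennreal ((1/2) ^ Suc n))"
    by (rule ennreal_suminf_cmult)
  also have "(\<Sum>n. ennreal ((1/2) ^ Suc n)) = ennreal 1"
    using power_half_series by (intro suminf_ennreal_eq) auto
  finally show "outer (\<Union>n. A n) \<le> (\<Sum>n. outer (A n)) + e" by simp
qed

lemma outer_Un: "outer (A \<union> B) \<le> outer A + outer B"
proof -
  have "outer (A \<union> B) = outer (\<Union>n. (\<lambda>n::nat. if n = 0 then A else if n = 1 then B else {}) n)"
    by (rule arg_cong[where f = outer]) (auto split: if_splits)
  also have "\<dots> \<le> (\<Sum>n. outer ((\<lambda>n::nat. if n = 0 then A else if n = 1 then B else {}) n))"
    by (rule countably_subadditive_outer)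
  also have "\<dots> = outer A + outer B"
    by (subst suminf_finite[of "{0,1}"]) (auto simp: outer_empty)
  finally show ?thesis .
qed

text \<open>A cover of the union of two sets at distance \<open>\<delta>\<close> can be split: intersecting its members with the
\<open>\<delta>/3\<close>-neighbourhoods of the two sets gives covers of each, and these two families are themselves
at distance \<open>\<delta>/3\<close>, where the content is additive.\<close>

lemma outer_separated:
  assumes "A \<subseteq> K" "B \<subseteq> K" "0 < \<delta>" and dist: "\<And>a b. a \<in> A \<Longrightarrow> b \<in> B \<Longrightarrow> \<delta> \<le> dist a b"
  shows "outer A + outer B \<le> outer (A \<union> B)"
  unfolding outer_def[of "A \<union> B"]
proof (rule INF_greatest)
  fix C assume C: "C \<in> open_covers (A \<union> B)"
  define U where "U S = K \<inter> (\<Union>a\<in>S. ball a (\<delta>/3))" for S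
  have U: "openin (top_of_set K) (U S)" for S
    unfolding U_def by (auto intro!: openin_open_Int)
  have SU: "S \<subseteq> K \<Longrightarrow> S \<subseteq> U S" for S
    using \<open>0 < \<delta>\<close> by (force simp: U_def)
  have o: "outer S \<le> (\<Sum>i. c (C i \<inter> U S))" if "S \<subseteq> A \<union> B" for S
    unfolding outer_def
  proof (rule INF_lower)
    have "S \<subseteq> (\<Union>i. C i)" using C that by (auto simp: open_covers_def)
    moreover have "S \<subseteq> U S" using that assms by (intro SU) auto
    ultimately show "(\<lambda>i. C i \<inter> U S) \<in> open_covers S"
      using C U by (auto simp: open_covers_def intro!: openin_Int)
  qed
  have "c (C i \<inter> U A) + c (C i \<inter> U B) \<le> c (C i)" for i
  proof -
    have Ci: "C i \<subseteq> K" using C by (auto simp: open_covers_def dest: openin_sub)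
    have "c (C i \<inter> U A) + c (C i \<inter> U B) \<le> c (C i \<inter> U A \<union> C i \<inter> U B)"
    proof (rule separated[where \<delta> = "\<delta>/3"])
      fix a b assume "a \<in> C i \<inter> U A" "b \<in> C i \<inter> U B"
      then obtain a' b' where "a' \<in> A" "dist a' a < \<delta>/3" "b' \<in> B" "dist b' b < \<delta>/3"
        by (auto simp: U_def)
      moreover have "dist a' b' \<le> dist a' a + dist a b + dist b b'"
        by (metis add.commute add_left_mono dist_triangle dist_triangle_le order_trans)
      moreover have "\<delta> \<le> dist a' b'" using dist calculation by auto
      ultimately show "\<delta>/3 \<le> dist a b" by (simp add: dist_commute)
    qed (use Ci \<open>0 < \<delta>\<close> in auto)
    also have "\<dots> \<le> c (C i)" by (rule mono) (use Ci in auto)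
    finally show ?thesis .
  qed
  then have "(\<Sum>i. c (C i \<inter> U A)) + (\<Sum>i. c (C i \<inter> U B)) \<le> (\<Sum>i. c (C i))"
    by (subst suminf_add) (auto intro!: suminf_le)
  then show "outer A + outer B \<le> (\<Sum>i. c (C i))"
    using o[of A] o[of B] by (meson add_mono order_trans sup_ge1 sup_ge2)
qed

text \<open>Caratheodory's criterion: a metric outer measure splits along closed sets.  The set \<open>E - F\<close> is
exhausted by the parts \<open>D n\<close> at distance at least \<open>1/(n+1)\<close> from \<open>F\<close>, on which splitting is clear.  The
shells \<open>D (n+1) - D n\<close> of the same parity are separated from each other, so the sum of the
outer measures of all shells is at most twice that of \<open>E\<close>, and its tails, which bound what \<open>D n\<close> omits, tend to zero.\<close>

lemma outer_Int_Diff_closed: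
  assumes E: "E \<subseteq> K" and F: "closedin (top_of_set K) F"
  shows "outer (E \<inter> F) + outer (E - F) \<le> outer E"
proof (cases "F = {}")
  case True
  then show ?thesis by (simp add: outer_empty)
next
  case False
  define D where "D n = {x \<in> E - F. inverse (real (Suc n)) \<le> infdist x F}" for n
  define R where "R n = D (Suc n) - D n" for n
  have Dmono: "D m \<subseteq> D n" if "m \<le> n" for m n
    using that by (auto simp: D_def intro: order_trans[rotated] le_imp_inverse_le)
  have DE: "D n \<subseteq> E" for n by (auto simp: D_def)
  have RE: "R n \<subseteq> E" for n using DE by (auto simp: R_def)
  \<comment> \<open>points two shells apart have a positive distance depending only on the shells\<close>
  have gap: "outer A + outer B \<le> outer (A \<union> B)"
    if "A \<subseteq> D n" "B \<subseteq> E - D (Suc n)" for A B n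
  proof (rule outer_separated)
    show "A \<subseteq> K" "B \<subseteq> K" using that DE[of n] E by blast+
    show "0 < inverse (real (Suc n)) - inverse (real (Suc (Suc n)))"
      using less_imp_inverse_less[of "real (Suc n)" "real (Suc (Suc n))"] by simp
    fix a b assume "a \<in> A" "b \<in> B"
    then have a: "inverse (real (Suc n)) \<le> infdist a F" using that by (auto simp: D_def)
    have b: "infdist b F \<le> inverse (real (Suc (Suc n)))"
    proof (cases "b \<in> F")
      case True then show ?thesis by simp
    next
      case False then show ?thesis using \<open>b \<in> B\<close> that by (force simp: D_def)
    qed
    have "infdist a F \<le> infdist b F + dist a b" by (rule infdist_triangle)
    then show "inverse (real (Suc n)) - inverse (real (Suc (Suc n))) \<le> dist a b"
      using a b by linarith
  qed
  have sum_le: "(\<Sum>k<N. outer (R (2 * k + s))) \<le> outer (\<Union>k<N. R (2 * k + s))" for N s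
  proof (induction N)
    case (Suc N)
    have "(\<Union>k<N. R (2 * k + s)) \<subseteq> D (2 * N + s - 1)"
    proof clarify
      fix x k assume "k < N" "x \<in> R (2 * k + s)"
      then have "x \<in> D (Suc (2 * k + s))" by (simp add: R_def)
      moreover have "Suc (2 * k + s) \<le> 2 * N + s - 1" using \<open>k < N\<close> by simp
      ultimately show "x \<in> D (2 * N + s - 1)" using Dmono by blast
    qed
    moreover have "R (2 * N + s) \<subseteq> E - D (Suc (2 * N + s - 1)) \<or> N = 0"
      using RE by (cases N) (auto simp: R_def)
    ultimately have "outer (\<Union>k<N. R (2 * k + s)) + outer (R (2 * N + s))
        \<le> outer ((\<Union>k<N. R (2 * k + s)) \<union> R (2 * N + s))"
      using gap by (cases "N = 0") (auto simp: outer_empty)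
    moreover have "(\<Union>k<N. R (2 * k + s)) \<union> R (2 * N + s) = (\<Union>k<Suc N. R (2 * k + s))"
      by (auto simp: lessThan_Suc)
    ultimately show ?case using Suc by (auto intro: order_trans add_right_mono)
  qed (simp add: outer_empty)
  have sum_le': "(\<Sum>k<N. outer (R (2 * k + s))) \<le> outer E" for N s
    using sum_le[where N = N and s = s] outer_mono[of "\<Union>k<N. R (2 * k + s)" E] RE by (meson UN_least order_trans)
  define r where "r n = enn2real (outer (R n))" for n
  have r: "outer (R n) = ennreal (r n)" and r0: "0 \<le> r n" for n
    using outer_finite[OF order_trans[OF RE[of n] E]] by (simp_all add: r_def less_top)
  obtain e where e: "outer E = ennreal e" "0 \<le> e"
    using outer_finite[OF E] by (metis ennreal_cases infinity_ennreal_def less_irrefl)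
  have half: "(\<Sum>k<N. r (2 * k + s)) \<le> e" for N s
  proof -
    have "ennreal (\<Sum>k<N. r (2 * k + s)) \<le> ennreal e"
      using sum_le'[where N = N and s = s] r0 unfolding r e(1) by (subst (asm) sum_ennreal) auto
    then show ?thesis using e(2) by (simp only: ennreal_le_iff)
  qed
  have "summable r"
  proof (rule bounded_imp_summable)
    show "0 \<le> r n" for n by (rule r0)
    fix n
    have "sum r {..n} \<le> sum r {..<2 * (Suc n)}"
      by (rule sum_mono2) (auto simp: r0)
    also have "\<dots> = (\<Sum>k<Suc n. r (2 * k)) + (\<Sum>k<Suc n. r (2 * k + 1))"
      by (induction n) (simp_all add: numeral_2_eq_2)
    also have "\<dots> \<le> 2 * e" using add_mono[OF half[where s=0 and N="Suc n"] half[where s=1 and N="Suc n"]]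
      by (simp only: add_0_right mult_2)
    finally show "sum r {..n} \<le> 2 * e" .
  qed
  have tail: "outer (E \<inter> F) + outer (E - F) \<le> ennreal (e + (\<Sum>k. r (k + n)))" for n
  proof -
    have "E - F \<subseteq> D n \<union> (\<Union>k. R (k + n))"
    proof
      fix x assume x: "x \<in> E - F"
      have "infdist x F \<noteq> 0"
      proof
        assume "infdist x F = 0"
        then have "x \<in> closure F" using in_closure_iff_infdist_zero[OF False] by simp
        moreover obtain S where "closed S" "F = K \<inter> S" using F by (auto simp: closedin_closed)
        ultimately have "x \<in> S" using closure_minimal[of F S] by auto
        then show False using x E \<open>F = K \<inter> S\<close> by auto
      qed
      then have "0 < infdist x F" using infdist_nonneg[of x F] by linarith
      then obtain m where "inverse (real (Suc m)) < infdist x F"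
        using reals_Archimedean by blast
      then have xm: "x \<in> D m" using x by (auto simp: D_def)
      show "x \<in> D n \<union> (\<Union>k. R (k + n))"
      proof (cases "x \<in> D n")
        case False
        obtain l where l: "x \<in> D l" "\<And>k. k < l \<Longrightarrow> x \<notin> D k"
          using xm exists_least_iff[of "\<lambda>l. x \<in> D l"] by blast
        have "n < l" using False Dmono l(1) by (meson not_less subsetD)
        then have "x \<in> R (l - 1)" using l by (simp add: R_def)
        moreover have "l - 1 = (l - 1 - n) + n" using \<open>n < l\<close> by simp
        ultimately show ?thesis by (metis (no_types) UNIV_I UN_I UnI2)
      qed simp
    qed
    then have "outer (E - F) \<le> outer (D n \<union> (\<Union>k. R (k + n)))" by (rule outer_mono)
    also have "\<dots> \<le> outer (D n) + (\<Sum>k. outer (R (k + n)))"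
      using outer_Un[of "D n" "\<Union>k. R (k + n)"] countably_subadditive_outer[of "\<lambda>k. R (k + n)"]
      by (meson add_left_mono order_trans)
    also have "(\<Sum>k. outer (R (k + n))) = ennreal (\<Sum>k. r (k + n))"
      unfolding r using \<open>summable r\<close> r0 by (intro suminf_ennreal2 summable_ignore_initial_segment)
    finally have 1: "outer (E - F) \<le> outer (D n) + ennreal (\<Sum>k. r (k + n))" .
    have "outer (D n) + outer (E \<inter> F) \<le> outer (D n \<union> (E \<inter> F))"
      by (rule gap[where n = n]) (auto simp: D_def)
    also have "\<dots> \<le> outer E" by (rule outer_mono) (auto simp: D_def)
    finally have 2: "outer (D n) + outer (E \<inter> F) \<le> ennreal e" unfolding e(1) .
    have "outer (E \<inter> F) + outer (E - F) \<le> (outer (D n) + outer (E \<inter> F)) + ennreal (\<Sum>k. r (k + n))"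
      using add_left_mono[OF 1, of "outer (E \<inter> F)"] by (simp only: ac_simps)
    also have "\<dots> \<le> ennreal e + ennreal (\<Sum>k. r (k + n))" by (rule add_right_mono[OF 2])
    also have "\<dots> = ennreal (e + (\<Sum>k. r (k + n)))"
      using \<open>summable r\<close> r0 e by (intro ennreal_plus[symmetric] suminf_nonneg summable_ignore_initial_segment)
    finally show ?thesis .
  qed
  have "(\<lambda>n. ennreal (e + (\<Sum>k. r (k + n)))) \<longlonglongrightarrow> ennreal (e + 0)"
    by (rule tendsto_ennrealI[OF tendsto_add[OF tendsto_const suminf_exist_split2[OF \<open>summable r\<close>]]])
  then have "outer (E \<inter> F) + outer (E - F) \<le> ennreal (e + 0)"
    by (rule LIMSEQ_le_const) (intro exI allI impI tail)
  then show ?thesis by (simp only: e(1) add_0_right)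
qed

definition content_measure :: "'a measure" where
  "content_measure = measure_of K (sets (restrict_space borel K)) outer"

lemma sets_content_measure: "sets content_measure = sets (restrict_space borel K)"
  and space_content_measure: "space content_measure = K"
  and emeasure_content_measure:
    "A \<in> sets (restrict_space borel K) \<Longrightarrow> emeasure content_measure A = outer A"
proof -
  interpret P: sigma_algebra K "Pow K" by (rule sigma_algebra_Pow)
  have oms: "outer_measure_space (Pow K) outer"
    unfolding outer_measure_space_def positive_def increasing_def countably_subadditive_def
    using outer_empty outer_mono countably_subadditive_outer by auto
  define L where "L = lambda_system K (Pow K) outer"
  have ms: "measure_space K L outer" unfolding L_def by (rule P.caratheodory_lemma[OF oms])
  then interpret L: sigma_algebra K L by (simp add: measure_space_def)
  have closed: "K \<inter> F \<in> L" if "closed F" for F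
  proof -
    have "outer (E \<inter> (K \<inter> F)) + outer (E - K \<inter> F) = outer E" if "E \<subseteq> K" for E
    proof (rule antisym)
      show "outer (E \<inter> (K \<inter> F)) + outer (E - K \<inter> F) \<le> outer E"
        using that \<open>closed F\<close> by (intro outer_Int_Diff_closed) (auto intro: closedin_closed_Int)
      have "outer E = outer (E \<inter> (K \<inter> F) \<union> (E - K \<inter> F))" by (rule arg_cong[where f = outer]) auto
      then show "outer E \<le> outer (E \<inter> (K \<inter> F)) + outer (E - K \<inter> F)" by (simp add: outer_Un)
    qed
    then show ?thesis unfolding L_def P.lambda_system_eq by auto
  qed
  have "K \<inter> A \<in> L" if "A \<in> sets borel" for A
  proof -
    have "A \<in> sigma_sets UNIV {S. closed S}" using that by (simp add: borel_eq_closed)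
    then show ?thesis
    proof (induction rule: sigma_sets.induct)
      case (Compl a)
      have "K \<inter> (UNIV - a) = K - K \<inter> a" by auto
      then show ?case using Compl by (auto intro: L.compl_sets)
    next
      case (Union a)
      have "K \<inter> (\<Union>i. a i) = (\<Union>i. K \<inter> a i)" by auto
      moreover have "range (\<lambda>i. K \<inter> a i) \<subseteq> L" using Union by auto
      ultimately show ?case by (metis L.countable_UN)
    qed (use closed in auto)
  qed
  then have sub: "sets (restrict_space borel K) \<subseteq> L" by (auto simp: sets_restrict_space)
  have sp: "sets (restrict_space borel K) \<subseteq> Pow K" by (auto simp: sets_restrict_space)
  have sa: "sigma_algebra K (sets (restrict_space borel K))"
    using sets.sigma_algebra_axioms[of "restrict_space borel K"] by (simp add: space_restrict_space)
  then have ss: "sigma_sets K (sets (restrict_space borel K)) = sets (restrict_space borel K)"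
    by (rule sigma_algebra.sigma_sets_eq)
  show S: "sets content_measure = sets (restrict_space borel K)"
    unfolding content_measure_def using sp ss by simp
  show "space content_measure = K" unfolding content_measure_def using sp by (simp add: space_measure_of)
  have "measure_space K (sets (restrict_space borel K)) outer"
    unfolding measure_space_def
  proof (intro conjI)
    show "countably_additive (sets (restrict_space borel K)) outer"
      unfolding countably_additive_def
    proof (intro allI impI)
      fix A :: "nat \<Rightarrow> 'a set"
      assume "range A \<subseteq> sets (restrict_space borel K)" "disjoint_family A"
        "(\<Union>i. A i) \<in> sets (restrict_space borel K)"
      moreover have "countably_additive L outer" using ms by (simp add: measure_space_def)
      ultimately show "(\<Sum>i. outer (A i)) = outer (\<Union>i. A i)"
        using sub unfolding countably_additive_def by blast
    qed
  qed (use sa outer_empty in \<open>auto simp: positive_def\<close>)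
  then show "emeasure content_measure A = outer A" if "A \<in> sets (restrict_space borel K)"
    using that sp ss sa unfolding content_measure_def
    by (intro emeasure_measure_of_sigma) (auto simp: measure_space_def)
qed

lemma content_measure_open:
  assumes "openin (top_of_set K) U" shows "emeasure content_measure U \<le> c U"
proof -
  have "U \<in> sets (restrict_space borel K)"
    using assms by (auto simp: sets_restrict_space openin_open)
  then show ?thesis by (simp add: emeasure_content_measure outer_open_le assms)
qed

lemma finite_cover_le:
  assumes "finite I" "\<And>i. i \<in> I \<Longrightarrow> A i \<subseteq> K" shows "c (\<Union>i\<in>I. A i) \<le> (\<Sum>i\<in>I. c (A i))"
  using assms
proof (induction I rule: finite_induct)
  case (insert i I)
  have "c (\<Union>i\<in>insert i I. A i) \<le> c (A i) + c (\<Union>i\<in>I. A i)"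
    using subadditive[of "A i" "\<Union>i\<in>I. A i"] insert by (simp add: UN_subset_iff)
  also have "\<dots> \<le> c (A i) + (\<Sum>i\<in>I. c (A i))" using insert by (intro add_left_mono) auto
  finally show ?case using insert by simp
qed (simp add: content_empty)

text \<open>Only finitely many members of an open cover are needed, and the content is finitely subadditive.
On open sets the content dominates the measure instead; in general neither is an equality.\<close>

lemma content_measure_compact:
  assumes "compact C" "C \<subseteq> K" shows "c C \<le> emeasure content_measure C"
proof -
  have "c C \<le> outer C"
    unfolding outer_def
  proof (rule INF_greatest)
    fix A assume A: "A \<in> open_covers C"
    then have "\<forall>i. \<exists>T. open T \<and> A i = K \<inter> T" by (auto simp: open_covers_def openin_open)
    then obtain T where T: "\<And>i. open (T i)" "\<And>i. A i = K \<inter> T i" by metis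
    have "C \<subseteq> (\<Union>i\<in>UNIV. T i)" using A T by (auto simp: open_covers_def)
    then obtain I where I: "finite I" "C \<subseteq> (\<Union>i\<in>I. T i)"
      using compactE_image[OF \<open>compact C\<close>, of UNIV T] T by metis
    have "c C \<le> c (\<Union>i\<in>I. A i)" by (rule mono) (use I T assms in auto)
    also have "\<dots> \<le> (\<Sum>i\<in>I. c (A i))" by (rule finite_cover_le) (use I T in auto)
    also have "\<dots> \<le> (\<Sum>i. c (A i))" by (rule sum_le_suminf) (use I in auto)
    finally show "c C \<le> (\<Sum>i. c (A i))" .
  qed
  moreover have "C \<in> sets (restrict_space borel K)"
    using assms by (auto simp: sets_restrict_space intro!: image_eqI[of _ _ C] dest: compact_imp_closed)
  ultimately show ?thesis by (simp add: emeasure_content_measure)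
qed

lemma finite_measure_content_measure: "finite_measure content_measure"
proof
  have "emeasure content_measure K < \<infinity>"
    using content_measure_open[of K] finite_total by (auto intro: le_less_trans)
  then show "emeasure content_measure (space content_measure) \<noteq> \<infinity>"
    by (simp add: space_content_measure)
qed

text \<open>The outer measure is defined from open covers and the content alone, so it inherits every symmetry of both.\<close>

lemma content_measure_invariant:
  assumes T: "homeomorphism K K T T'" and inv: "\<And>A. A \<subseteq> K \<Longrightarrow> c (T ` A) = c A"
  shows "distr content_measure content_measure T = content_measure"
proof (rule measure_eqI)
  have meas: "T \<in> measurable content_measure content_measure"
  proof -
    have "T \<in> measurable (restrict_space borel K) borel"
      using T by (intro borel_measurable_continuous_on_restrict) (auto simp: homeomorphism_def)
    then have "T \<in> measurable (restrict_space borel K) (restrict_space borel K)"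
      using T by (intro measurable_restrict_space2) (auto simp: homeomorphism_def space_restrict_space)
    then show ?thesis by (simp add: sets_content_measure cong: measurable_cong_sets)
  qed
  have le: "outer (S ` E) \<le> outer E"
    if S: "homeomorphism K K S S'" and i: "\<And>A. A \<subseteq> K \<Longrightarrow> c (S ` A) = c A" for S S' E
    unfolding outer_def[of E]
  proof (rule INF_greatest)
    fix A assume A: "A \<in> open_covers E"
    have "(\<lambda>i. S ` A i) \<in> open_covers (S ` E)"
      using A homeomorphism_imp_open_map[OF S] unfolding open_covers_def by auto blast
    then have "outer (S ` E) \<le> (\<Sum>i. c (S ` A i))" unfolding outer_def by (rule INF_lower)
    also have "\<dots> = (\<Sum>i. c (A i))"
      using A by (intro suminf_cong i) (auto simp: open_covers_def dest: openin_sub)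
    finally show "outer (S ` E) \<le> (\<Sum>i. c (A i))" .
  qed
  have TT': "T ` T' ` A = A" if "A \<subseteq> K" for A
    unfolding image_image using homeomorphism_apply2[OF T] that by (auto simp: subset_iff)
  have inv': "c (T' ` A) = c A" if "A \<subseteq> K" for A
  proof -
    have "T ` T' ` A = A" using that by (rule TT')
    moreover have "T' ` A \<subseteq> K" using homeomorphism_image2[OF T] that by blast
    ultimately show ?thesis using inv[of "T' ` A"] by simp
  qed
  show "sets (distr content_measure content_measure T) = sets content_measure" by simp
  fix A assume "A \<in> sets (distr content_measure content_measure T)"
  then have A: "A \<in> sets content_measure" by simp
  then have AK: "A \<subseteq> K" using sets.sets_into_space space_content_measure by blast
  have pre: "T -` A \<inter> K = T' ` A"
  proof (intro equalityI subsetI)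
    fix x assume "x \<in> T -` A \<inter> K"
    then show "x \<in> T' ` A" using homeomorphism_apply1[OF T, of x] by (metis IntE imageI vimageD)
  next
    fix x assume "x \<in> T' ` A"
    then obtain a where "a \<in> A" "x = T' a" by auto
    then show "x \<in> T -` A \<inter> K"
      using AK homeomorphism_apply2[OF T, of a] homeomorphism_image2[OF T] by auto
  qed
  have "T -` A \<inter> K \<in> sets content_measure"
    using measurable_sets[OF meas A] by (simp add: space_content_measure)
  then have "emeasure content_measure (T -` A \<inter> K) = outer (T' ` A)"
    unfolding pre by (simp add: emeasure_content_measure sets_content_measure)
  also have "\<dots> = outer A"
  proof (rule antisym)
    show "outer (T' ` A) \<le> outer A"
      using homeomorphism_symD[OF T] inv' by (rule le)
    show "outer A \<le> outer (T' ` A)" using le[OF T inv, of "T' ` A"] by (simp only: TT'[OF AK])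
  qed
  also have "\<dots> = emeasure content_measure A" using A by (simp add: emeasure_content_measure sets_content_measure)
  finally show "emeasure (distr content_measure content_measure T) A = emeasure content_measure A"
    by (simp add: emeasure_distr[OF meas A] space_content_measure)
qed

end

section \<open>Haar measure on compact metric groups\<close>

text \<open>A sequence of points of the cube need not converge, but by Tychonoff's theorem it has a cluster point,
and that point inherits every closed condition that holds eventually.  This replaces a generalized limit.\<close>

lemma pointwise_cluster:
  fixes h :: "nat \<Rightarrow> 'i \<Rightarrow> real"
  assumes "\<And>n i. h n i \<in> {0..1}"
  obtains l where "\<And>S. closed S \<Longrightarrow> eventually (\<lambda>n. h n \<in> S) sequentially \<Longrightarrow> l \<in> S"
proof -
  define X where "X = PiE (UNIV :: 'i set) (\<lambda>_. {0..1::real})"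
  have "compactin (product_topology (\<lambda>_. euclidean) (UNIV :: 'i set)) X"
    unfolding X_def by (simp add: compactin_PiE)
  then have "compact X" by (simp add: euclidean_product_topology)
  moreover have "eventually (\<lambda>x. x \<in> X) (filtermap h sequentially)"
    using assms by (auto simp: eventually_filtermap X_def PiE_def)
  moreover have "filtermap h sequentially \<noteq> bot" by (simp add: filtermap_bot_iff)
  ultimately obtain l where l: "inf (nhds l) (filtermap h sequentially) \<noteq> bot"
    unfolding compact_filter by blast
  show ?thesis
  proof
    fix S :: "('i \<Rightarrow> real) set"
    assume "closed S" and ev: "eventually (\<lambda>n. h n \<in> S) sequentially"
    show "l \<in> S"
    proof (rule ccontr)
      assume "l \<notin> S"
      then have "eventually (\<lambda>x. x \<in> - S) (nhds l)"
        using \<open>closed S\<close> by (intro eventually_nhds_in_open) auto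
      moreover have "eventually (\<lambda>x. x \<in> S) (filtermap h sequentially)"
        using ev by (simp add: eventually_filtermap)
      ultimately have "eventually (\<lambda>x. False) (inf (nhds l) (filtermap h sequentially))"
        by (auto simp: eventually_inf)
      with l show False by (simp add: trivial_limit_def)
    qed
  qed
qed

locale compact_group = group G for G :: "('a::metric_space, 'b) monoid_scheme" (structure) +
  assumes compact_carrier: "compact (carrier G)"
    and continuous_mult: "continuous_on (carrier G \<times> carrier G) (\<lambda>(x, y). x \<otimes> y)"
begin

lemma homeomorphism_translation:
  assumes "g \<in> carrier G"
  shows "homeomorphism (carrier G) (carrier G) (\<lambda>x. g \<otimes> x) (\<lambda>x. inv g \<otimes> x)"
proof -
  have cont: "continuous_on (carrier G) (\<lambda>x. a \<otimes> x)" if "a \<in> carrier G" for a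
  proof -
    have "continuous_on (carrier G) (\<lambda>x. (a, x))" by (intro continuous_intros)
    from continuous_on_compose2[OF continuous_mult this] show ?thesis using that by auto
  qed
  have im: "(\<lambda>x. a \<otimes> x) ` carrier G = carrier G" if "a \<in> carrier G" for a
    using that by (rule surj_const_mult)
  show ?thesis
    using assms by (intro homeomorphismI cont) (auto simp: im inv_solve_left' m_assoc[symmetric])
qed

definition nbhd :: "nat \<Rightarrow> 'a set" where
  "nbhd n = {u \<in> carrier G. dist u \<one> < inverse (real (Suc n))}"

definition translates_cover :: "nat \<Rightarrow> 'a set \<Rightarrow> 'a set \<Rightarrow> bool" where
  "translates_cover n A T \<longleftrightarrow>
     finite T \<and> T \<subseteq> carrier G \<and> A \<subseteq> (\<Union>t\<in>T. (\<lambda>u. t \<otimes> u) ` nbhd n)"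

definition covering_number :: "nat \<Rightarrow> 'a set \<Rightarrow> nat" where
  "covering_number n A = (LEAST k. \<exists>T. translates_cover n A T \<and> card T = k)"

lemma ex_translates_cover:
  assumes "A \<subseteq> carrier G" shows "\<exists>T. translates_cover n A T"
proof -
  have "\<exists>V. open V \<and> (\<lambda>u. t \<otimes> u) ` nbhd n = carrier G \<inter> V" if "t \<in> carrier G" for t
  proof -
    have "openin (top_of_set (carrier G)) (nbhd n)"
      unfolding openin_open nbhd_def
      by (rule exI[of _ "ball \<one> (inverse (real (Suc n)))"]) (auto simp: dist_commute)
    then have "openin (top_of_set (carrier G)) ((\<lambda>u. t \<otimes> u) ` nbhd n)"
      using homeomorphism_imp_open_map[OF homeomorphism_translation[OF that]] by blast
    then show ?thesis by (simp add: openin_open)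
  qed
  then obtain V where V: "\<And>t. t \<in> carrier G \<Longrightarrow> open (V t)"
    "\<And>t. t \<in> carrier G \<Longrightarrow> (\<lambda>u. t \<otimes> u) ` nbhd n = carrier G \<inter> V t" by metis
  have one: "\<one> \<in> nbhd n" by (simp add: nbhd_def)
  have "carrier G \<subseteq> (\<Union>t\<in>carrier G. V t)"
  proof
    fix t assume t: "t \<in> carrier G"
    then have "t \<in> (\<lambda>u. t \<otimes> u) ` nbhd n" using one by (intro image_eqI[of _ _ \<one>]) auto
    then show "t \<in> (\<Union>t\<in>carrier G. V t)" using V t by blast
  qed
  then obtain T where "T \<subseteq> carrier G" "finite T" "carrier G \<subseteq> (\<Union>t\<in>T. V t)"
    using compactE_image[OF compact_carrier, of "carrier G" V] V by metis
  then have "translates_cover n A T"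
    unfolding translates_cover_def
  proof (intro conjI subsetI)
    fix x assume "x \<in> A"
    then have x: "x \<in> carrier G" using assms by auto
    with \<open>carrier G \<subseteq> (\<Union>t\<in>T. V t)\<close> obtain t where t: "t \<in> T" "x \<in> V t" by auto
    with x V(2)[of t] \<open>T \<subseteq> carrier G\<close> have "x \<in> (\<lambda>u. t \<otimes> u) ` nbhd n" by auto
    with t show "x \<in> (\<Union>t\<in>T. (\<lambda>u. t \<otimes> u) ` nbhd n)" by blast
  qed auto
  then show ?thesis ..
qed

lemma covering_number_le: "translates_cover n A T \<Longrightarrow> covering_number n A \<le> card T"
  unfolding covering_number_def by (rule Least_le) auto

lemma covering_number_cover:
  assumes "A \<subseteq> carrier G"
  obtains T where "translates_cover n A T" "card T = covering_number n A"
  using LeastI_ex[of "\<lambda>k. \<exists>T. translates_cover n A T \<and> card T = k"] ex_translates_cover[OF assms]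
  unfolding covering_number_def by blast

lemma covering_number_mono:
  assumes "A \<subseteq> B" "B \<subseteq> carrier G" shows "covering_number n A \<le> covering_number n B"
proof -
  obtain T where T: "translates_cover n B T" "card T = covering_number n B"
    using covering_number_cover[OF assms(2)] .
  then have "translates_cover n A T" using assms by (auto simp: translates_cover_def)
  then show ?thesis using covering_number_le T by metis
qed

lemma covering_number_Un:
  assumes "A \<subseteq> carrier G" "B \<subseteq> carrier G"
  shows "covering_number n (A \<union> B) \<le> covering_number n A + covering_number n B"
proof -
  obtain S T where S: "translates_cover n A S" "card S = covering_number n A"
    and T: "translates_cover n B T" "card T = covering_number n B"
    using covering_number_cover assms by metis
  then have "translates_cover n (A \<union> B) (S \<union> T)" by (auto simp: translates_cover_def)
  from covering_number_le[OF this] show ?thesis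
    using card_Un_le[of S T] S T by simp
qed

lemma covering_number_translate_le:
  assumes "A \<subseteq> carrier G" "g \<in> carrier G"
  shows "covering_number n ((\<lambda>x. g \<otimes> x) ` A) \<le> covering_number n A"
proof -
  obtain T where T: "translates_cover n A T" "card T = covering_number n A"
    using covering_number_cover[OF assms(1)] .
  have "translates_cover n ((\<lambda>x. g \<otimes> x) ` A) ((\<lambda>x. g \<otimes> x) ` T)"
    unfolding translates_cover_def
  proof (intro conjI subsetI)
    show "finite ((\<lambda>x. g \<otimes> x) ` T)" using T by (simp add: translates_cover_def)
    show "x \<in> carrier G" if "x \<in> (\<lambda>x. g \<otimes> x) ` T" for x
      using that T assms by (auto simp: translates_cover_def)
    fix y assume "y \<in> (\<lambda>x. g \<otimes> x) ` A"
    then obtain t u where "t \<in> T" "u \<in> nbhd n" "y = g \<otimes> (t \<otimes> u)"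
      using T by (auto simp: translates_cover_def)
    moreover have "t \<in> carrier G" "u \<in> carrier G"
      using calculation T by (auto simp: translates_cover_def nbhd_def)
    ultimately show "y \<in> (\<Union>t\<in>(\<lambda>x. g \<otimes> x) ` T. (\<lambda>u. t \<otimes> u) ` nbhd n)"
      using assms by (auto simp: m_assoc[symmetric])
  qed
  from covering_number_le[OF this] show ?thesis
    using T card_image_le[of T "\<lambda>x. g \<otimes> x"] by (simp add: translates_cover_def)
qed

lemma covering_number_translate:
  assumes "A \<subseteq> carrier G" "g \<in> carrier G"
  shows "covering_number n ((\<lambda>x. g \<otimes> x) ` A) = covering_number n A"
proof (rule antisym)
  show "covering_number n ((\<lambda>x. g \<otimes> x) ` A) \<le> covering_number n A"
    using assms by (rule covering_number_translate_le)
  have "(\<lambda>x. inv g \<otimes> x) ` (\<lambda>x. g \<otimes> x) ` A = (\<lambda>x. x) ` A"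
    unfolding image_image by (rule image_cong) (use assms in \<open>auto simp: m_assoc[symmetric]\<close>)
  then show "covering_number n A \<le> covering_number n ((\<lambda>x. g \<otimes> x) ` A)"
    using covering_number_translate_le[of "(\<lambda>x. g \<otimes> x) ` A" "inv g" n] assms by (auto simp: image_subset_iff subset_iff)
qed

text \<open>When the neighbourhood of the unit is small, uniform continuity of the multiplication makes all its
translates smaller than the distance of the two sets, so no translate in an optimal cover meets both.\<close>

lemma covering_number_separated:
  assumes A: "A \<subseteq> carrier G" and B: "B \<subseteq> carrier G" and "0 < \<delta>"
    and dist: "\<And>a b. a \<in> A \<Longrightarrow> b \<in> B \<Longrightarrow> \<delta> \<le> dist a b"
  shows "eventually (\<lambda>n. covering_number n A + covering_number n B \<le> covering_number n (A \<union> B)) sequentially"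
proof -
  have "uniformly_continuous_on (carrier G \<times> carrier G) (\<lambda>(x, y). x \<otimes> y)"
    using continuous_mult compact_carrier by (intro compact_uniformly_continuous compact_Times)
  then obtain d where d: "0 < d"
    "\<And>p q. p \<in> carrier G \<times> carrier G \<Longrightarrow> q \<in> carrier G \<times> carrier G \<Longrightarrow> dist q p < d
      \<Longrightarrow> dist (case q of (x, y) \<Rightarrow> x \<otimes> y) (case p of (x, y) \<Rightarrow> x \<otimes> y) < \<delta> / 2"
    using \<open>0 < \<delta>\<close> unfolding uniformly_continuous_on_def by (metis half_gt_zero)
  obtain m where m: "inverse (real (Suc m)) < d" using reals_Archimedean[OF d(1)] by blast
  have "covering_number n A + covering_number n B \<le> covering_number n (A \<union> B)" if "m \<le> n" for n
  proof -
    obtain T where T: "translates_cover n (A \<union> B) T" "card T = covering_number n (A \<union> B)"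
      using covering_number_cover[of "A \<union> B"] A B by auto
    define S where "S C = {t \<in> T. (\<lambda>u. t \<otimes> u) ` nbhd n \<inter> C \<noteq> {}}" for C
    have near: "dist (t \<otimes> u) t < \<delta> / 2" if "t \<in> T" "u \<in> nbhd n" for t u
    proof -
      have tu: "t \<in> carrier G" "u \<in> carrier G" using that T by (auto simp: translates_cover_def nbhd_def)
      have "inverse (real (Suc n)) \<le> inverse (real (Suc m))" using \<open>m \<le> n\<close> by (intro le_imp_inverse_le) auto
      moreover have "dist u \<one> < inverse (real (Suc n))"
        using that(2) by (simp only: nbhd_def mem_Collect_eq)
      ultimately have "dist u \<one> < d" using m by linarith
      then have "dist (t, u) (t, \<one>) < d" by (simp add: dist_Pair_Pair)
      from d(2)[OF _ _ this] show ?thesis using tu by simp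
    qed
    have "S A \<inter> S B = {}"
    proof -
      have False if "t \<in> T" "u \<in> nbhd n" "t \<otimes> u \<in> A" "v \<in> nbhd n" "t \<otimes> v \<in> B" for t u v
        using dist[OF that(3,5)] near[OF that(1,2)] near[OF that(1,4)]
          dist_triangle2[of "t \<otimes> u" "t \<otimes> v" t] by linarith
      then show ?thesis unfolding S_def by blast
    qed
    moreover have "finite T" using T by (simp add: translates_cover_def)
    ultimately have "card (S A) + card (S B) = card (S A \<union> S B)"
      by (intro card_Un_disjoint[symmetric]) (auto simp: S_def)
    also have "\<dots> \<le> card T" by (rule card_mono) (use \<open>finite T\<close> in \<open>auto simp: S_def\<close>)
    finally have "card (S A) + card (S B) \<le> card T" .
    moreover have "translates_cover n C (S C)" if "C \<subseteq> A \<union> B" for C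
      using T(1) that unfolding translates_cover_def S_def by auto blast
    then have "covering_number n A \<le> card (S A)" "covering_number n B \<le> card (S B)"
      by (auto intro: covering_number_le)
    ultimately show ?thesis using T by linarith
  qed
  then show ?thesis unfolding eventually_sequentially by blast
qed

lemma covering_number_carrier_pos: "0 < covering_number n (carrier G)"
proof (rule ccontr)
  assume "\<not> ?thesis"
  then obtain T where "translates_cover n (carrier G) T" "card T = 0"
    using covering_number_cover[of "carrier G" n] by (metis gr0I order_refl)
  then show False by (auto simp: translates_cover_def)
qed

text \<open>The quotients of covering numbers are normalized, monotone, subadditive, invariant, and eventually
additive on separated sets.  Each of these is a closed condition, so a cluster point has them all.\<close>

lemma ex_translation_content:
  obtains c where "metric_content (carrier G) c" "c (carrier G) = 1"
    "\<And>g A. g \<in> carrier G \<Longrightarrow> A \<subseteq> carrier G \<Longrightarrow> c ((\<lambda>x. g \<otimes> x) ` A) = c A"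
proof -
  define r where "r n A = (if A \<subseteq> carrier G
      then real (covering_number n A) / real (covering_number n (carrier G)) else 0)" for n A
  have r: "r n A \<in> {0..1}" for n A
    using covering_number_mono[of A "carrier G"] covering_number_carrier_pos[of n]
    by (auto simp: r_def divide_le_eq)
  obtain l where l: "\<And>S. closed S \<Longrightarrow> eventually (\<lambda>n. r n \<in> S) sequentially \<Longrightarrow> l \<in> S"
    using pointwise_cluster[of r] r by blast
  have coord: "continuous_on UNIV (\<lambda>h::'a set \<Rightarrow> real. h A)" for A by simp
  note cl = closed_Collect_le closed_Collect_eq continuous_on_add coord continuous_on_const
  have l0: "0 \<le> l A" for A
    using l[of "{h. 0 \<le> h A}"] r by (simp add: cl)
  have lmono: "l A \<le> l B" if "A \<subseteq> B" "B \<subseteq> carrier G" for A B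
  proof -
    have "r n A \<le> r n B" for n
      using that covering_number_mono[of A B n] by (auto simp: r_def intro!: divide_right_mono)
    then show ?thesis using l[of "{h. h A \<le> h B}"] by (simp add: cl)
  qed
  have lUn: "l (A \<union> B) \<le> l A + l B" if "A \<subseteq> carrier G" "B \<subseteq> carrier G" for A B
  proof -
    have "r n (A \<union> B) \<le> r n A + r n B" for n
      using that covering_number_Un[of A B n]
      by (auto simp: r_def add_divide_distrib[symmetric] intro!: divide_right_mono)
    then show ?thesis using l[of "{h. h (A \<union> B) \<le> h A + h B}"] by (simp add: cl)
  qed
  have lsep: "l A + l B \<le> l (A \<union> B)"
    if "A \<subseteq> carrier G" "B \<subseteq> carrier G" "0 < \<delta>" "\<And>a b. a \<in> A \<Longrightarrow> b \<in> B \<Longrightarrow> \<delta> \<le> dist a b" for A B \<delta>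
  proof -
    have "eventually (\<lambda>n. covering_number n A + covering_number n B \<le> covering_number n (A \<union> B)) sequentially"
      using that by (rule covering_number_separated)
    then have "eventually (\<lambda>n. r n A + r n B \<le> r n (A \<union> B)) sequentially"
    proof eventually_elim
      case (elim n)
      then show ?case
        using that(1,2) by (auto simp: r_def add_divide_distrib[symmetric] intro!: divide_right_mono)
    qed
    then show ?thesis using l[of "{h. h A + h B \<le> h (A \<union> B)}"] by (simp add: cl)
  qed
  have l1: "l (carrier G) = 1"
  proof -
    have "r n (carrier G) = 1" for n using covering_number_carrier_pos[of n] by (simp add: r_def)
    then show ?thesis using l[of "{h. h (carrier G) = 1}"] by (simp add: cl)
  qed
  have linv: "l ((\<lambda>x. g \<otimes> x) ` A) = l A" if "g \<in> carrier G" "A \<subseteq> carrier G" for g A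
  proof -
    have "(\<lambda>x. g \<otimes> x) ` A \<subseteq> carrier G" using that by auto
    then have "r n ((\<lambda>x. g \<otimes> x) ` A) = r n A" for n
      using that covering_number_translate[of A g n] by (simp add: r_def)
    then show ?thesis using l[of "{h. h ((\<lambda>x. g \<otimes> x) ` A) = h A}"] by (simp add: cl)
  qed
  show ?thesis
  proof
    show "metric_content (carrier G) (\<lambda>A. ennreal (l A))"
    proof
      show "ennreal (l A) \<le> ennreal (l B)" if "A \<subseteq> B" "B \<subseteq> carrier G" for A B
        using lmono[OF that] by (rule ennreal_leI)
      show "ennreal (l (A \<union> B)) \<le> ennreal (l A) + ennreal (l B)"
        if "A \<subseteq> carrier G" "B \<subseteq> carrier G" for A B
        using lUn[OF that] l0 by (simp add: ennreal_plus[symmetric] ennreal_leI del: ennreal_plus)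
      show "ennreal (l A) + ennreal (l B) \<le> ennreal (l (A \<union> B))"
        if "A \<subseteq> carrier G" "B \<subseteq> carrier G" "0 < \<delta>" "\<And>a b. a \<in> A \<Longrightarrow> b \<in> B \<Longrightarrow> \<delta> \<le> dist a b" for A B \<delta>
        using lsep[OF that(1-3)] that(4) l0 by (simp add: ennreal_plus[symmetric] ennreal_leI del: ennreal_plus)
    qed simp
    show "ennreal (l (carrier G)) = 1" by (simp add: l1)
    show "ennreal (l ((\<lambda>x. g \<otimes> x) ` A)) = ennreal (l A)" if "g \<in> carrier G" "A \<subseteq> carrier G" for g A
      using linv[OF that] by simp
  qed
qed

theorem ex_haar_measure:
  obtains \<nu> where "space \<nu> = carrier G" "sets \<nu> = sets (restrict_space borel (carrier G))"
    "emeasure \<nu> (carrier G) = 1"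
    "\<And>g. g \<in> carrier G \<Longrightarrow> distr \<nu> \<nu> (\<lambda>x. g \<otimes> x) = \<nu>"
proof -
  obtain c where c: "metric_content (carrier G) c" "c (carrier G) = 1"
    "\<And>g A. g \<in> carrier G \<Longrightarrow> A \<subseteq> carrier G \<Longrightarrow> c ((\<lambda>x. g \<otimes> x) ` A) = c A"
    using ex_translation_content by blast
  interpret metric_content "carrier G" c by (rule c(1))
  show ?thesis
  proof
    show "space content_measure = carrier G" by (rule space_content_measure)
    show "sets content_measure = sets (restrict_space borel (carrier G))" by (rule sets_content_measure)
    show "emeasure content_measure (carrier G) = 1"
      using content_measure_open[of "carrier G"] content_measure_compact[OF compact_carrier] c(2)
      by (intro antisym) auto
    show "distr content_measure content_measure (\<lambda>x. g \<otimes> x) = content_measure" if "g \<in> carrier G" for g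
      using content_measure_invariant[OF homeomorphism_translation[OF that]] c(3)[OF that] by blast
  qed
qed

end

section \<open>Positive extension of linear functionals\<close>

text \<open>Only one inequality of positive homogeneity is asked for, as it is simpler to verify for infima; the other one
follows for positive factors.\<close>

definition sublinear_on :: "('a \<Rightarrow> real) set \<Rightarrow> (('a \<Rightarrow> real) \<Rightarrow> real) \<Rightarrow> bool" where
  "sublinear_on E p \<longleftrightarrow>
     (\<forall>f\<in>E. \<forall>g\<in>E. p (\<lambda>x. f x + g x) \<le> p f + p g) \<and> (\<forall>c\<ge>0. \<forall>f\<in>E. p (\<lambda>x. c * f x) \<le> c * p f)"

text \<open>A minimal element among the sublinear functions below \<open>p\<close> is linear.  Zorn's lemma applies since
the infimum of a chain is sublinear and stays finite, because \<open>q f \<ge> - p (- f)\<close> for all \<open>q\<close> below \<open>p\<close>.  If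
\<open>m\<close> is minimal, then the infimum of \<open>m (f + t g) - t m g\<close> over \<open>t \<ge> 0\<close> is sublinear in \<open>f\<close> and below
\<open>m\<close>, so it equals \<open>m\<close>; taking \<open>t = 1\<close> shows that \<open>m\<close> is superadditive.\<close>

lemma hahn_banach_functions:
  fixes E :: "('a \<Rightarrow> real) set"
  assumes add: "\<And>f g. f \<in> E \<Longrightarrow> g \<in> E \<Longrightarrow> (\<lambda>x. f x + g x) \<in> E"
    and scale: "\<And>c f. f \<in> E \<Longrightarrow> (\<lambda>x. c * f x) \<in> E"
    and p: "sublinear_on E p"
  obtains \<Lambda> where "\<And>f. f \<in> E \<Longrightarrow> \<Lambda> f \<le> p f"
    "\<And>f g. f \<in> E \<Longrightarrow> g \<in> E \<Longrightarrow> \<Lambda> (\<lambda>x. f x + g x) = \<Lambda> f + \<Lambda> g"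
    "\<And>c f. f \<in> E \<Longrightarrow> \<Lambda> (\<lambda>x. c * f x) = c * \<Lambda> f"
proof -
  define Q where "Q = {q. sublinear_on E q \<and> (\<forall>f\<in>E. q f \<le> p f) \<and> (\<forall>f. f \<notin> E \<longrightarrow> q f = 0)}"
  define ge where "ge q r \<longleftrightarrow> (\<forall>f\<in>E. r f \<le> q f)" for q r :: "('a \<Rightarrow> real) \<Rightarrow> real"
  have Qadd: "q (\<lambda>x. f x + g x) \<le> q f + q g" if "q \<in> Q" "f \<in> E" "g \<in> E" for q f g
    using that by (auto simp: Q_def sublinear_on_def)
  have Qscale: "q (\<lambda>x. c * f x) \<le> c * q f" if "q \<in> Q" "f \<in> E" "0 \<le> c" for q f c
    using that by (auto simp: Q_def sublinear_on_def)
  have neg: "(\<lambda>x. - f x) \<in> E" if "f \<in> E" for f using scale[OF that, of "-1"] by simp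
  have zero: "(\<lambda>x. 0) \<in> E" if "f \<in> E" for f using scale[OF that, of "0"] by simp
  have Q0: "q (\<lambda>x. 0) = 0" if "q \<in> Q" "f \<in> E" for q f
    using Qscale[OF that, of 0] Qadd[OF that(1) zero[OF that(2)] zero[OF that(2)]] by simp
  have Qneg: "- q (\<lambda>x. - f x) \<le> q f" if "q \<in> Q" "f \<in> E" for q f
    using Qadd[OF that(1) that(2) neg[OF that(2)]] Q0[OF that] by simp
  have Qlow: "- p (\<lambda>x. - f x) \<le> q f" if "q \<in> Q" "f \<in> E" for q f
  proof -
    have "q (\<lambda>x. - f x) \<le> p (\<lambda>x. - f x)" using that neg[OF that(2)] by (auto simp: Q_def)
    with Qneg[OF that] show ?thesis by linarith
  qed
  have Qge: "c * q f \<le> q (\<lambda>x. c * f x)" if "q \<in> Q" "f \<in> E" "0 \<le> c" for q f c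
  proof (cases "c = 0")
    case True
    then show ?thesis using Q0[OF that(1,2)] by simp
  next
    case False
    then have "0 < c" using that by simp
    have "q (\<lambda>x. (1 / c) * (c * f x)) \<le> (1 / c) * q (\<lambda>x. c * f x)"
      using \<open>0 < c\<close> by (intro Qscale that scale) auto
    then show ?thesis using \<open>0 < c\<close> by (simp add: field_simps)
  qed
  have "\<exists>m\<in>Q. \<forall>a\<in>Q. ge m a \<longrightarrow> a = m"
  proof (rule predicate_Zorn)
    show "partial_order_on Q (relation_of ge Q)"
    proof (rule partial_order_on_relation_ofI)
      show "ge a a" for a by (simp add: ge_def)
      show "ge a c" if "ge a b" "ge b c" for a b c
        using that unfolding ge_def by (meson order_trans)
      show "a = b" if "a \<in> Q" "b \<in> Q" "ge a b" "ge b a" for a b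
      proof
        fix f show "a f = b f"
          using that by (cases "f \<in> E") (auto simp: ge_def Q_def intro: antisym)
      qed
    qed
  next
    fix C assume "C \<in> Chains (relation_of ge Q)"
    then have C: "C \<subseteq> Q" and chain: "\<And>a b. a \<in> C \<Longrightarrow> b \<in> C \<Longrightarrow> ge a b \<or> ge b a"
      by (auto simp: Chains_def relation_of_def)
    show "\<exists>u\<in>Q. \<forall>a\<in>C. ge a u"
    proof (cases "C = {}")
      case True
      define u where "u f = (if f \<in> E then p f else 0)" for f
      have "u \<in> Q" using p add scale by (auto simp: Q_def u_def sublinear_on_def)
      then show ?thesis using True by auto
    next
      case False
      define u where "u f = (if f \<in> E then (INF q\<in>C. q f) else 0)" for f
      have bdd: "bdd_below ((\<lambda>q. q f) ` C)" if "f \<in> E" for f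
        using Qlow C that by (intro bdd_belowI2[of _ "- p (\<lambda>x. - f x)"]) auto
      have u_le: "u f \<le> q f" if "q \<in> C" "f \<in> E" for q f
        using that bdd by (auto simp: u_def intro!: cINF_lower)
      have u_greatest: "y \<le> u f" if "f \<in> E" "\<And>q. q \<in> C \<Longrightarrow> y \<le> q f" for f y
        using that False by (auto simp: u_def intro!: cINF_greatest)
      have "u \<in> Q" unfolding Q_def sublinear_on_def
      proof (intro CollectI conjI ballI allI impI)
        fix f g assume fg: "f \<in> E" "g \<in> E"
        have 1: "u (\<lambda>x. f x + g x) \<le> a f + b g" if ab: "a \<in> C" "b \<in> C" for a b
        proof -
          obtain d where d: "d \<in> C" "ge a d" "ge b d" using chain[OF ab] ab unfolding ge_def by blast
          have "u (\<lambda>x. f x + g x) \<le> d (\<lambda>x. f x + g x)" using d fg by (intro u_le add)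
          also have "\<dots> \<le> d f + d g" using d C fg by (intro Qadd) auto
          also have "\<dots> \<le> a f + b g" using d fg by (intro add_mono) (auto simp: ge_def)
          finally show ?thesis .
        qed
        have "u (\<lambda>x. f x + g x) - a f \<le> u g" if "a \<in> C" for a
          using 1[OF that] by (intro u_greatest fg) (auto simp: algebra_simps)
        then have "u (\<lambda>x. f x + g x) - u g \<le> a f" if "a \<in> C" for a
          using that by (fastforce simp: algebra_simps)
        then have "u (\<lambda>x. f x + g x) - u g \<le> u f" by (intro u_greatest fg)
        then show "u (\<lambda>x. f x + g x) \<le> u f + u g" by simp
      next
        fix c :: real and f assume c: "0 \<le> c" and f: "f \<in> E"
        have 1: "u (\<lambda>x. c * f x) \<le> c * q f" if "q \<in> C" for q
          using u_le[OF that scale[OF f], of c] Qscale[of q f c] C that f c by auto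
        show "u (\<lambda>x. c * f x) \<le> c * u f"
        proof (cases "c = 0")
          case True
          then show ?thesis using 1 \<open>C \<noteq> {}\<close> by auto
        next
          case False
          then have "0 < c" using c by simp
          then have "u (\<lambda>x. c * f x) / c \<le> u f"
            using 1 by (intro u_greatest f) (auto simp: field_simps)
          then show ?thesis using \<open>0 < c\<close> by (simp add: field_simps)
        qed
      next
        fix f assume "f \<in> E"
        obtain q where "q \<in> C" using False by auto
        then show "u f \<le> p f" using u_le[of q f] C \<open>f \<in> E\<close> by (auto simp: Q_def intro: order_trans)
      qed (simp add: u_def)
      then show ?thesis using u_le by (auto simp: ge_def)
    qed
  qed
  then obtain m where m: "m \<in> Q" and min: "\<And>a. a \<in> Q \<Longrightarrow> ge m a \<Longrightarrow> a = m" by blast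
  have super: "m f + m g \<le> m (\<lambda>x. f x + g x)" if f: "f \<in> E" and g: "g \<in> E" for f g
  proof -
    define q where "q f = (if f \<in> E then (INF t\<in>{0..}. m (\<lambda>x. f x + t * g x) - t * m g) else 0)" for f
    have low: "- m (\<lambda>x. - f x) \<le> m (\<lambda>x. f x + t * g x) - t * m g" if "f \<in> E" "0 \<le> t" for f t
    proof -
      have "m (\<lambda>x. (f x + t * g x) + - f x) \<le> m (\<lambda>x. f x + t * g x) + m (\<lambda>x. - f x)"
        using that g by (intro Qadd m add scale neg)
      moreover have "t * m g \<le> m (\<lambda>x. t * g x)" using that g by (intro Qge m)
      ultimately show ?thesis by simp
    qed
    have q_le: "q f \<le> m (\<lambda>x. f x + t * g x) - t * m g" if "f \<in> E" "0 \<le> t" for f t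
    proof -
      have "bdd_below ((\<lambda>t. m (\<lambda>x. f x + t * g x) - t * m g) ` {0..})"
        using low[OF that(1)] by (intro bdd_belowI2) auto
      then show ?thesis using that unfolding q_def by (auto intro!: cINF_lower)
    qed
    have q_greatest: "y \<le> q f" if "f \<in> E" "\<And>t. 0 \<le> t \<Longrightarrow> y \<le> m (\<lambda>x. f x + t * g x) - t * m g" for f y
      using that unfolding q_def by (auto intro!: cINF_greatest)
    have q_m: "q f \<le> m f" if "f \<in> E" for f using q_le[OF that, of 0] by simp
    have "q \<in> Q" unfolding Q_def sublinear_on_def
    proof (intro CollectI conjI ballI allI impI)
      fix a b assume ab: "a \<in> E" "b \<in> E"
      have 1: "q (\<lambda>x. a x + b x) \<le> (m (\<lambda>x. a x + s * g x) - s * m g) + (m (\<lambda>x. b x + t * g x) - t * m g)"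
        if "0 \<le> s" "0 \<le> t" for s t
      proof -
        have "q (\<lambda>x. a x + b x) \<le> m (\<lambda>x. (a x + b x) + (s + t) * g x) - (s + t) * m g"
          using ab that by (intro q_le add) auto
        also have "(\<lambda>x. (a x + b x) + (s + t) * g x) = (\<lambda>x. (a x + s * g x) + (b x + t * g x))"
          by (simp add: algebra_simps)
        also have "m \<dots> \<le> m (\<lambda>x. a x + s * g x) + m (\<lambda>x. b x + t * g x)"
          using ab g by (intro Qadd m add scale)
        finally show ?thesis by (simp add: algebra_simps)
      qed
      have "q (\<lambda>x. a x + b x) - (m (\<lambda>x. a x + s * g x) - s * m g) \<le> q b" if "0 \<le> s" for s
        using 1[OF that] by (intro q_greatest ab) (auto simp: algebra_simps)
      then have "q (\<lambda>x. a x + b x) - q b \<le> q a"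
        by (intro q_greatest ab) (force simp: algebra_simps)
      then show "q (\<lambda>x. a x + b x) \<le> q a + q b" by simp
    next
      fix c :: real and a assume c: "0 \<le> c" and a: "a \<in> E"
      have 1: "q (\<lambda>x. c * a x) \<le> c * (m (\<lambda>x. a x + t * g x) - t * m g)" if "0 \<le> t" for t
      proof -
        have "q (\<lambda>x. c * a x) \<le> m (\<lambda>x. c * a x + (c * t) * g x) - (c * t) * m g"
          using a c that by (intro q_le scale) auto
        also have "(\<lambda>x. c * a x + (c * t) * g x) = (\<lambda>x. c * (a x + t * g x))"
          by (simp add: algebra_simps)
        also have "m \<dots> \<le> c * m (\<lambda>x. a x + t * g x)"
          using a g c by (intro Qscale m add scale)
        finally show ?thesis by (simp add: algebra_simps)
      qed
      show "q (\<lambda>x. c * a x) \<le> c * q a"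
      proof (cases "c = 0")
        case True
        then show ?thesis using 1[of 0] by simp
      next
        case False
        then have "0 < c" using c by simp
        then have "q (\<lambda>x. c * a x) / c \<le> q a"
          using 1 by (intro q_greatest a) (auto simp: field_simps)
        then show ?thesis using \<open>0 < c\<close> by (simp add: field_simps)
      qed
    next
      fix a assume "a \<in> E"
      then show "q a \<le> p a" using q_m m by (force simp: Q_def)
    qed (simp add: q_def)
    then have "q = m" using min q_m by (auto simp: ge_def)
    then show ?thesis using q_le[OF f, of 1] by simp
  qed
  have m_add: "m (\<lambda>x. f x + g x) = m f + m g" if "f \<in> E" "g \<in> E" for f g
    using super[OF that] Qadd[OF m that] by simp
  have m_neg: "m (\<lambda>x. - f x) = - m f" if "f \<in> E" for f
    using m_add[OF that neg[OF that]] Q0[OF m that] by simp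
  have m_pos: "m (\<lambda>x. c * f x) = c * m f" if "f \<in> E" "0 \<le> c" for c f
    using Qscale[OF m that] Qge[OF m that] by simp
  show ?thesis
  proof
    show "m f \<le> p f" if "f \<in> E" for f using m that by (auto simp: Q_def)
    show "m (\<lambda>x. f x + g x) = m f + m g" if "f \<in> E" "g \<in> E" for f g by (rule m_add[OF that])
    show "m (\<lambda>x. c * f x) = c * m f" if "f \<in> E" for c f
    proof (cases "0 \<le> c")
      case False
      then have "m (\<lambda>x. - ((- c) * f x)) = - ((- c) * m f)"
        using m_neg[OF scale[OF that], of "- c"] m_pos[OF that, of "- c"] by simp
      then show ?thesis by simp
    qed (use m_pos[OF that] in simp)
  qed
qed

text \<open>The sublinear majorant is the infimum of \<open>L\<close> over the elements of \<open>P\<close> above the given function.  A linear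
functional below it is automatically positive and agrees with \<open>L\<close> on \<open>P\<close>.\<close>

lemma positive_extension:
  fixes P :: "('a \<Rightarrow> real) set" and L :: "('a \<Rightarrow> real) \<Rightarrow> real"
  assumes add: "\<And>p q. p \<in> P \<Longrightarrow> q \<in> P \<Longrightarrow> (\<lambda>x. p x + q x) \<in> P"
    and scale: "\<And>c p. p \<in> P \<Longrightarrow> (\<lambda>x. c * p x) \<in> P"
    and L_add: "\<And>p q. p \<in> P \<Longrightarrow> q \<in> P \<Longrightarrow> L (\<lambda>x. p x + q x) = L p + L q"
    and L_scale: "\<And>c p. p \<in> P \<Longrightarrow> L (\<lambda>x. c * p x) = c * L p"
    and L_pos: "\<And>p. p \<in> P \<Longrightarrow> (\<And>x. x \<in> K \<Longrightarrow> 0 \<le> p x) \<Longrightarrow> 0 \<le> L p"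
    and E_def: "E = {f. \<exists>p\<in>P. \<forall>x\<in>K. \<bar>f x\<bar> \<le> p x}"
    and PE: "P \<subseteq> E"
  obtains \<Lambda> where
    "\<And>f g. f \<in> E \<Longrightarrow> g \<in> E \<Longrightarrow> \<Lambda> (\<lambda>x. f x + g x) = \<Lambda> f + \<Lambda> g"
    "\<And>c f. f \<in> E \<Longrightarrow> \<Lambda> (\<lambda>x. c * f x) = c * \<Lambda> f"
    "\<And>f g. f \<in> E \<Longrightarrow> g \<in> E \<Longrightarrow> (\<And>x. x \<in> K \<Longrightarrow> f x \<le> g x) \<Longrightarrow> \<Lambda> f \<le> \<Lambda> g"
    "\<And>p. p \<in> P \<Longrightarrow> \<Lambda> p = L p"
proof -
  have E_add: "(\<lambda>x. f x + g x) \<in> E" if fg: "f \<in> E" "g \<in> E" for f g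
  proof -
    obtain p q where "p \<in> P" "q \<in> P" "\<And>x. x \<in> K \<Longrightarrow> \<bar>f x\<bar> \<le> p x" "\<And>x. x \<in> K \<Longrightarrow> \<bar>g x\<bar> \<le> q x"
      using fg unfolding E_def by blast
    then show ?thesis unfolding E_def
      by (intro CollectI bexI[of _ "\<lambda>x. p x + q x"] add) (auto intro: order_trans[OF abs_triangle_ineq add_mono])
  qed
  have E_scale: "(\<lambda>x. c * f x) \<in> E" if f: "f \<in> E" for c f
  proof -
    obtain p where "p \<in> P" "\<And>x. x \<in> K \<Longrightarrow> \<bar>f x\<bar> \<le> p x" using f unfolding E_def by blast
    then show ?thesis unfolding E_def
      by (intro CollectI bexI[of _ "\<lambda>x. \<bar>c\<bar> * p x"] scale) (auto simp: abs_mult intro: mult_left_mono)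
  qed
  define above where "above f = {p \<in> P. \<forall>x\<in>K. f x \<le> p x}" for f
  define S where "S f = (INF p\<in>above f. L p)" for f
  have L_mono: "L p \<le> L q" if "p \<in> P" "q \<in> P" "\<And>x. x \<in> K \<Longrightarrow> p x \<le> q x" for p q
  proof -
    have "0 \<le> L (\<lambda>x. q x + (-1) * p x)" using that by (intro L_pos add scale) auto
    then show ?thesis using L_add[OF that(2) scale[OF that(1)], of "-1"] L_scale[OF that(1), of "-1"] by simp
  qed
  have nonempty: "above f \<noteq> {}" and bdd: "bdd_below (L ` above f)" if f: "f \<in> E" for f
  proof -
    obtain r where r: "r \<in> P" "\<And>x. x \<in> K \<Longrightarrow> \<bar>f x\<bar> \<le> r x" using f unfolding E_def by blast
    then have "r \<in> above f" unfolding above_def by fastforce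
    then show "above f \<noteq> {}" by auto
    have "- L r \<le> L p" if "p \<in> above f" for p
    proof -
      have "L (\<lambda>x. (-1) * r x) \<le> L p"
      proof (rule L_mono)
        show "(-1) * r x \<le> p x" if "x \<in> K" for x
          using r(2)[OF that] \<open>p \<in> above f\<close> that unfolding above_def by force
      qed (use that scale[OF r(1), of "-1"] in \<open>auto simp: above_def\<close>)
      then show ?thesis using L_scale[OF r(1), of "-1"] by simp
    qed
    then show "bdd_below (L ` above f)" by (intro bdd_belowI2)
  qed
  have S_le: "S f \<le> L p" if "f \<in> E" "p \<in> above f" for f p
    unfolding S_def using bdd[OF that(1)] that(2) by (rule cINF_lower)
  have S_greatest: "y \<le> S f" if "f \<in> E" "\<And>p. p \<in> above f \<Longrightarrow> y \<le> L p" for f y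
    unfolding S_def using nonempty[OF that(1)] that(2) by (rule cINF_greatest)
  have S: "sublinear_on E S"
    unfolding sublinear_on_def
  proof (intro conjI ballI allI impI)
    fix f g assume fg: "f \<in> E" "g \<in> E"
    have 1: "S (\<lambda>x. f x + g x) \<le> L p + L q" if "p \<in> above f" "q \<in> above g" for p q
    proof -
      have pq: "p \<in> P" "q \<in> P" using that by (auto simp: above_def)
      have "(\<lambda>x. p x + q x) \<in> above (\<lambda>x. f x + g x)" using that add by (auto simp: above_def add_mono)
      then show ?thesis using S_le[OF E_add[OF fg]] L_add[OF pq] by fastforce
    qed
    have "S (\<lambda>x. f x + g x) - L p \<le> S g" if "p \<in> above f" for p
      using 1[OF that] by (intro S_greatest fg) (auto simp: algebra_simps)
    then have "S (\<lambda>x. f x + g x) - S g \<le> S f"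
      by (intro S_greatest fg) (force simp: algebra_simps)
    then show "S (\<lambda>x. f x + g x) \<le> S f + S g" by simp
  next
    fix c :: real and f assume c: "0 \<le> c" and f: "f \<in> E"
    have 1: "S (\<lambda>x. c * f x) \<le> c * L p" if "p \<in> above f" for p
    proof -
      have p: "p \<in> P" using that by (auto simp: above_def)
      have "(\<lambda>x. c * p x) \<in> above (\<lambda>x. c * f x)" using that scale c by (auto simp: above_def mult_left_mono)
      then show ?thesis using S_le[OF E_scale[OF f]] L_scale[OF p] by fastforce
    qed
    show "S (\<lambda>x. c * f x) \<le> c * S f"
    proof (cases "c = 0")
      case True
      then show ?thesis using 1 nonempty[OF f] by auto
    next
      case False
      then have "0 < c" using c by simp
      then have "S (\<lambda>x. c * f x) / c \<le> S f"
        using 1 by (intro S_greatest f) (auto simp: field_simps)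
      then show ?thesis using \<open>0 < c\<close> by (simp add: field_simps)
    qed
  qed
  obtain \<Lambda> where le: "\<And>f. f \<in> E \<Longrightarrow> \<Lambda> f \<le> S f"
    and \<Lambda>_add: "\<And>f g. f \<in> E \<Longrightarrow> g \<in> E \<Longrightarrow> \<Lambda> (\<lambda>x. f x + g x) = \<Lambda> f + \<Lambda> g"
    and \<Lambda>_scale: "\<And>c f. f \<in> E \<Longrightarrow> \<Lambda> (\<lambda>x. c * f x) = c * \<Lambda> f"
    using hahn_banach_functions[OF E_add E_scale S] by blast
  have le_L: "\<Lambda> f \<le> L p" if "f \<in> E" "p \<in> P" "\<And>x. x \<in> K \<Longrightarrow> f x \<le> p x" for f p
    using le[OF that(1)] S_le[of f p] that by (auto simp: above_def)
  show ?thesis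
  proof
    show "\<Lambda> (\<lambda>x. f x + g x) = \<Lambda> f + \<Lambda> g" if "f \<in> E" "g \<in> E" for f g by (rule \<Lambda>_add[OF that])
    show "\<Lambda> (\<lambda>x. c * f x) = c * \<Lambda> f" if "f \<in> E" for c f by (rule \<Lambda>_scale[OF that])
    show "\<Lambda> f \<le> \<Lambda> g" if "f \<in> E" "g \<in> E" "\<And>x. x \<in> K \<Longrightarrow> f x \<le> g x" for f g
    proof -
      obtain r where r: "r \<in> P" using \<open>f \<in> E\<close> by (auto simp: E_def)
      have "\<Lambda> (\<lambda>x. f x + (-1) * g x) \<le> L (\<lambda>x. 0 * r x)"
        using that r by (intro le_L E_add E_scale scale) auto
      then show ?thesis
        using \<Lambda>_add[OF that(1) E_scale[OF that(2)], of "-1"] \<Lambda>_scale[OF that(2), of "-1"] L_scale[OF r, of 0]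
        by simp
    qed
    show "\<Lambda> p = L p" if "p \<in> P" for p
    proof -
      have E: "p \<in> E" using that PE by auto
      have "\<Lambda> (\<lambda>x. (-1) * p x) \<le> L (\<lambda>x. (-1) * p x)"
        using that E by (intro le_L E_scale scale) auto
      moreover have "\<Lambda> p \<le> L p" using that E by (intro le_L) auto
      ultimately show ?thesis using \<Lambda>_scale[OF E, of "-1"] L_scale[OF that, of "-1"] by simp
    qed
  qed
qed

section \<open>Haviland's theorem\<close>

text \<open>The predicate \<open>Q\<close> stands for either \<open>k h < y\<close> or \<open>k h \<le> y\<close>, that is, for open or for closed superlevel
sets in a layer-cake sum.\<close>

lemma step_sum_le:
  fixes h y :: real
  assumes "0 \<le> h" "0 \<le> y" "\<And>k. Q k \<Longrightarrow> real k * h \<le> y"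
  shows "(\<Sum>k=1..N. h * of_bool (Q k)) \<le> y"
proof (induction N)
  case (Suc N)
  show ?case
  proof (cases "Q (Suc N)")
    case True
    have "(\<Sum>k=1..Suc N. h * of_bool (Q k)) \<le> (\<Sum>k=1..Suc N. h)"
      using assms(1) by (intro sum_mono) (auto simp: of_bool_def)
    also have "\<dots> = real (Suc N) * h" by simp
    also have "\<dots> \<le> y" using assms(3)[OF True] .
    finally show ?thesis .
  next
    case False
    then show ?thesis using Suc by simp
  qed
qed (use assms in simp)

lemma step_sum_ge:
  fixes h y :: real
  assumes "0 \<le> h" "\<And>k. real k * h < y \<Longrightarrow> Q k"
  shows "min y (real N * h) \<le> h + (\<Sum>k=1..N. h * of_bool (Q k))"
proof (induction N)
  case 0
  then show ?case using assms(1) by simp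
next
  case (Suc N)
  show ?case
  proof (cases "real N * h < y")
    case True
    have "Q k" if "k \<in> {1..N}" for k
    proof (rule assms(2))
      have "real k * h \<le> real N * h" using that assms(1) by (intro mult_right_mono) auto
      then show "real k * h < y" using True by simp
    qed
    then have "(\<Sum>k=1..N. h * of_bool (Q k)) = (\<Sum>k=1..N. h)" by (intro sum.cong) auto
    then have "h + (\<Sum>k=1..N. h * of_bool (Q k)) = real (Suc N) * h" by (simp add: algebra_simps)
    moreover have "(\<Sum>k=1..N. h * of_bool (Q k)) \<le> (\<Sum>k=1..Suc N. h * of_bool (Q k))"
      using assms(1) by simp
    ultimately show ?thesis by simp
  next
    case False
    then have "min y (real (Suc N) * h) \<le> min y (real N * h)" by simp
    also have "\<dots> \<le> h + (\<Sum>k=1..N. h * of_bool (Q k))" by (rule Suc)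
    also have "\<dots> \<le> h + (\<Sum>k=1..Suc N. h * of_bool (Q k))"
      using assms(1) by simp
    finally show ?thesis .
  qed
qed

text \<open>The content of a set is the value of the extended functional at its indicator function.  The content
dominates the measure on open sets and is dominated by it on closed sets: on compact sets this
holds in general, and the proper function \<open>q\<close> controls the rest.  Layer-cake sums over open and over closed superlevel
sets then bound the integral of a nonnegative element of \<open>P\<close> from both sides, and every element of
\<open>P\<close> is a difference of nonnegative ones.\<close>

theorem haviland:
  fixes K :: "'a::metric_space set" and P :: "('a \<Rightarrow> real) set" and L :: "('a \<Rightarrow> real) \<Rightarrow> real"
  assumes const: "\<And>c. (\<lambda>_. c) \<in> P"
    and add: "\<And>p q. p \<in> P \<Longrightarrow> q \<in> P \<Longrightarrow> (\<lambda>x. p x + q x) \<in> P"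
    and mult: "\<And>p q. p \<in> P \<Longrightarrow> q \<in> P \<Longrightarrow> (\<lambda>x. p x * q x) \<in> P"
    and continuous: "\<And>p. p \<in> P \<Longrightarrow> continuous_on K p"
    and proper: "q \<in> P" "\<And>R. compact {x \<in> K. q x \<le> R}"
    and L_add: "\<And>p q. p \<in> P \<Longrightarrow> q \<in> P \<Longrightarrow> L (\<lambda>x. p x + q x) = L p + L q"
    and L_scale: "\<And>c p. p \<in> P \<Longrightarrow> L (\<lambda>x. c * p x) = c * L p"
    and L_pos: "\<And>p. p \<in> P \<Longrightarrow> (\<And>x. x \<in> K \<Longrightarrow> 0 \<le> p x) \<Longrightarrow> 0 \<le> L p"
  obtains \<mu> where "space \<mu> = K" "sets \<mu> = sets (restrict_space borel K)"
    "\<And>p. p \<in> P \<Longrightarrow> integrable \<mu> p" "\<And>p. p \<in> P \<Longrightarrow> (\<integral>x. p x \<partial>\<mu>) = L p"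
proof -
  define E where "E = {f. \<exists>p\<in>P. \<forall>x\<in>K. \<bar>f x\<bar> \<le> p x}"
  have scale: "(\<lambda>x. c * p x) \<in> P" if "p \<in> P" for c p
    using mult[OF const that] .
  have PE: "P \<subseteq> E"
  proof
    fix p assume p: "p \<in> P"
    have "\<bar>p x\<bar> \<le> 1 + p x * p x" for x
      using zero_le_square[of "\<bar>p x\<bar> - 1"] by (simp add: algebra_simps abs_mult_self_eq)
    then show "p \<in> E" unfolding E_def
      using add[OF const[of 1] mult[OF p p]] by (intro CollectI bexI[of _ "\<lambda>x. 1 + p x * p x"]) auto
  qed
  obtain \<Lambda> where \<Lambda>_add: "\<And>f g. f \<in> E \<Longrightarrow> g \<in> E \<Longrightarrow> \<Lambda> (\<lambda>x. f x + g x) = \<Lambda> f + \<Lambda> g"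
    and \<Lambda>_scale: "\<And>c f. f \<in> E \<Longrightarrow> \<Lambda> (\<lambda>x. c * f x) = c * \<Lambda> f"
    and \<Lambda>_mono: "\<And>f g. f \<in> E \<Longrightarrow> g \<in> E \<Longrightarrow> (\<And>x. x \<in> K \<Longrightarrow> f x \<le> g x) \<Longrightarrow> \<Lambda> f \<le> \<Lambda> g"
    and \<Lambda>_L: "\<And>p. p \<in> P \<Longrightarrow> \<Lambda> p = L p"
    using positive_extension[of P L K E, OF add scale L_add L_scale L_pos E_def PE] by blast
  have E_dom: "f \<in> E" if "p \<in> P" "\<And>x. x \<in> K \<Longrightarrow> \<bar>f x\<bar> \<le> p x" for f p
    using that unfolding E_def by auto
  have ind_E: "indicat_real A \<in> E" for A
    by (rule E_dom[OF const[of 1]]) (auto simp: indicator_def)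
  have E_add: "(\<lambda>x. f x + g x) \<in> E" if fg: "f \<in> E" "g \<in> E" for f g
  proof -
    obtain p r where "p \<in> P" "r \<in> P" "\<And>x. x \<in> K \<Longrightarrow> \<bar>f x\<bar> \<le> p x" "\<And>x. x \<in> K \<Longrightarrow> \<bar>g x\<bar> \<le> r x"
      using fg unfolding E_def by blast
    then show ?thesis
      by (intro E_dom[OF add[of p r]]) (auto intro: order_trans[OF abs_triangle_ineq add_mono])
  qed
  have E_scale: "(\<lambda>x. c * f x) \<in> E" if f: "f \<in> E" for c f
  proof -
    obtain p where "p \<in> P" "\<And>x. x \<in> K \<Longrightarrow> \<bar>f x\<bar> \<le> p x" using f unfolding E_def by blast
    then show ?thesis
      by (intro E_dom[OF scale[of p "\<bar>c\<bar>"]]) (auto simp: abs_mult intro: mult_left_mono)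
  qed
  have \<Lambda>_sum: "(\<lambda>x. \<Sum>k\<in>I. f k x) \<in> E \<and> \<Lambda> (\<lambda>x. \<Sum>k\<in>I. f k x) = (\<Sum>k\<in>I. \<Lambda> (f k))"
    if "finite I" "\<And>k. k \<in> I \<Longrightarrow> f k \<in> E" for f and I :: "nat set"
    using that
  proof (induction I rule: finite_induct)
    case empty
    have "(\<lambda>_. 0::real) \<in> E" using const PE by auto
    moreover have "\<Lambda> (\<lambda>_. 0) = 0" using \<Lambda>_scale[OF calculation, of 0] by simp
    ultimately show ?case by simp
  next
    case (insert k I)
    then show ?case using E_add[of "f k" "\<lambda>x. \<Sum>k\<in>I. f k x"] \<Lambda>_add[of "f k" "\<lambda>x. \<Sum>k\<in>I. f k x"] by simp
  qed
  define c where "c A = \<Lambda> (indicat_real A)" for A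
  have c0: "0 \<le> c A" for A
  proof -
    have "\<Lambda> (\<lambda>x. 0 * indicat_real A x) \<le> \<Lambda> (indicat_real A)"
      by (intro \<Lambda>_mono E_scale ind_E) auto
    then show ?thesis using \<Lambda>_scale[OF ind_E, of 0 A] by (simp add: c_def)
  qed
  interpret metric_content K "\<lambda>A. ennreal (c A)"
  proof
    show "ennreal (c A) \<le> ennreal (c B)" if "A \<subseteq> B" for A B
      unfolding c_def using that by (intro ennreal_leI \<Lambda>_mono ind_E) (auto simp: indicator_def)
    show "ennreal (c (A \<union> B)) \<le> ennreal (c A) + ennreal (c B)" for A B
    proof -
      have "c (A \<union> B) \<le> \<Lambda> (\<lambda>x. indicat_real A x + indicat_real B x)"
        unfolding c_def by (intro \<Lambda>_mono E_add ind_E) (auto simp: indicator_def)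
      then have "c (A \<union> B) \<le> c A + c B" by (simp add: \<Lambda>_add ind_E c_def)
      then show ?thesis using c0 by (simp add: ennreal_plus[symmetric] ennreal_leI del: ennreal_plus)
    qed
    show "ennreal (c A) + ennreal (c B) \<le> ennreal (c (A \<union> B))"
      if "0 < \<delta>" "\<And>a b. a \<in> A \<Longrightarrow> b \<in> B \<Longrightarrow> \<delta> \<le> dist a b" for A B \<delta>
    proof -
      have "x \<notin> A \<or> x \<notin> B" for x using that(1) that(2)[of x x] by auto
      then have "\<Lambda> (\<lambda>x. indicat_real A x + indicat_real B x) \<le> c (A \<union> B)"
        unfolding c_def by (intro \<Lambda>_mono E_add ind_E) (auto simp: indicator_def)
      then have "c A + c B \<le> c (A \<union> B)" by (simp add: \<Lambda>_add ind_E c_def)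
      then show ?thesis using c0 by (simp add: ennreal_plus[symmetric] ennreal_leI del: ennreal_plus)
    qed
  qed simp
  define \<mu> where "\<mu> = content_measure"
  have sp: "space \<mu> = K" and st: "sets \<mu> = sets (restrict_space borel K)"
    by (simp_all add: \<mu>_def space_content_measure sets_content_measure)
  interpret finite_measure \<mu> unfolding \<mu>_def by (rule finite_measure_content_measure)
  have meas: "f \<in> borel_measurable \<mu>" if "continuous_on K f" for f :: "'a \<Rightarrow> real"
    using borel_measurable_continuous_on_restrict[OF that] st by (simp cong: measurable_cong_sets)
  have open_le: "measure \<mu> U \<le> c U" if "openin (top_of_set K) U" for U
    using content_measure_open[OF that] c0 by (simp add: \<mu>_def[symmetric] emeasure_eq_measure)
  \<comment> \<open>no mass escapes to infinity: \<open>q > R\<close> has content at most \<open>L q\<^sup>2 / R\<^sup>2\<close>\<close>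
  have closed_le: "c F \<le> measure \<mu> F" if F: "closedin (top_of_set K) F" for F
  proof -
    have FK: "F \<subseteq> K" using F by (rule closedin_imp_subset)
    have Fm: "F \<in> sets \<mu>" using F unfolding st by (auto simp: closedin_closed sets_restrict_space)
    have "c F \<le> measure \<mu> F + L (\<lambda>x. q x * q x) * inverse (real (Suc n)) ^ 2" for n
    proof -
      define R where "R = real (Suc n)"
      define A where "A = F \<inter> {x \<in> K. q x \<le> R}"
      have R: "0 < R" by (simp add: R_def)
      have "compact A"
      proof -
        obtain S where "closed S" "F = K \<inter> S" using F by (auto simp: closedin_closed)
        then have "A = {x \<in> K. q x \<le> R} \<inter> S" by (auto simp: A_def)
        then show ?thesis using proper(2) \<open>closed S\<close> by (simp add: compact_Int_closed)
      qed
      then have "c A \<le> measure \<mu> A" using content_measure_compact[of A] FK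
        by (auto simp: A_def \<mu>_def[symmetric] emeasure_eq_measure)
      also have "\<dots> \<le> measure \<mu> F" by (rule finite_measure_mono[OF _ Fm]) (auto simp: A_def)
      finally have 1: "c A \<le> measure \<mu> F" .
      have qq: "(\<lambda>x. q x * q x) \<in> P" using proper by (intro mult)
      have "indicat_real F x \<le> indicat_real A x + (inverse R ^ 2) * (q x * q x)" if "x \<in> K" for x
      proof (cases "x \<in> F \<and> R < q x")
        case True
        then have "1 \<le> (inverse R * q x) ^ 2"
          using R by (intro one_le_power) (simp add: field_simps)
        then show ?thesis by (auto simp: indicator_def power2_eq_square algebra_simps)
      next
        case False
        then show ?thesis using that by (auto simp: indicator_def A_def)
      qed
      then have "c F \<le> \<Lambda> (\<lambda>x. indicat_real A x + (inverse R ^ 2) * (q x * q x))"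
        unfolding c_def using qq PE by (intro \<Lambda>_mono E_add E_scale ind_E) auto
      also have "\<dots> = c A + (inverse R ^ 2) * L (\<lambda>x. q x * q x)"
        using qq PE by (subst \<Lambda>_add) (auto simp: ind_E E_scale \<Lambda>_scale \<Lambda>_L c_def)
      finally show ?thesis using 1 by (simp add: R_def mult.commute)
    qed
    moreover have "(\<lambda>n. measure \<mu> F + L (\<lambda>x. q x * q x) * inverse (real (Suc n)) ^ 2) \<longlonglongrightarrow> measure \<mu> F + L (\<lambda>x. q x * q x) * 0 ^ 2"
      by (intro tendsto_intros LIMSEQ_inverse_real_of_nat)
    ultimately have "c F \<le> measure \<mu> F + L (\<lambda>x. q x * q x) * 0 ^ 2"
      by (intro LIMSEQ_le_const) auto
    then show ?thesis by simp
  qed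
  \<comment> \<open>layer cake: \<open>f\<close> is compared with step functions whose steps have height \<open>1/(m+1)\<close> up to level \<open>m+1\<close>\<close>
  have main: "integrable \<mu> f \<and> (\<integral>x. f x \<partial>\<mu>) = L f" if f: "f \<in> P" and f0: "\<And>x. x \<in> K \<Longrightarrow> 0 \<le> f x" for f
  proof -
    define h where "h m = inverse (real (Suc m))" for m
    define N where "N m = Suc m * Suc m" for m
    have h0: "0 < h m" and Nh: "real (N m) * h m = real (Suc m)" for m
      by (simp_all only: h_def N_def of_nat_mult mult.assoc right_inverse of_nat_neq_0 mult_1_right
        not_False_eq_True positive_imp_inverse_positive of_nat_0_less_iff zero_less_Suc of_nat_eq_0_iff nat.distinct)
    define U where "U m k = {x \<in> K. real k * h m < f x}" for m k
    define F where "F m k = {x \<in> K. real k * h m \<le> f x}" for m k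
    define so where "so m x = (\<Sum>k=1..N m. h m * of_bool (real k * h m < f x))" for m x
    define sc where "sc m x = (\<Sum>k=1..N m. h m * of_bool (real k * h m \<le> f x))" for m x
    have fm: "f \<in> borel_measurable \<mu>" using meas continuous f by blast
    have U: "openin (top_of_set K) (U m k)" for m k
      using continuous_openin_preimage_gen[OF continuous[OF f] open_greaterThan[of "real k * h m"]]
      by (simp add: U_def vimage_def Int_def)
    have F: "closedin (top_of_set K) (F m k)" for m k
      using continuous_closedin_preimage[OF continuous[OF f] closed_atLeast[of "real k * h m"]]
      by (simp add: F_def vimage_def Int_def)
    have Um: "U m k \<in> sets \<mu>" and Fm: "F m k \<in> sets \<mu>" for m k
      using U[of m k] F[of m k] unfolding st by (auto simp: openin_open closedin_closed sets_restrict_space)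
    have so_eq: "so m x = (\<Sum>k=1..N m. h m * indicat_real (U m k) x)"
      and sc_eq: "sc m x = (\<Sum>k=1..N m. h m * indicat_real (F m k) x)" if "x \<in> K" for m x
      using that by (auto simp: so_def sc_def U_def F_def indicator_def of_bool_def intro!: sum.cong)
    have so_le: "so m x \<le> f x" and sc_le: "sc m x \<le> f x" if "x \<in> K" for m x
      unfolding so_def sc_def using that f0 h0[of m] by (intro step_sum_le; simp)+
    have so_ge: "min (f x) (real (Suc m)) \<le> h m + so m x"
      and sc_ge: "min (f x) (real (Suc m)) \<le> h m + sc m x" for m x
      unfolding so_def sc_def Nh[symmetric] using h0[of m] by (intro step_sum_ge; simp)+
    have sum_E: "(\<lambda>x. \<Sum>k=1..N m. h m * indicat_real (A k) x) \<in> E"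
      and \<Lambda>_step: "\<Lambda> (\<lambda>x. \<Sum>k=1..N m. h m * indicat_real (A k) x) = (\<Sum>k=1..N m. h m * c (A k))" for m A
      using \<Lambda>_sum[of "{1..N m}" "\<lambda>k x. h m * indicat_real (A k) x"]
      by (auto simp: E_scale ind_E \<Lambda>_scale c_def)
    have step_int: "integrable \<mu> (\<lambda>x. \<Sum>k=1..N m. h m * indicat_real (A k) x)"
      "(\<integral>x. (\<Sum>k=1..N m. h m * indicat_real (A k) x) \<partial>\<mu>) = (\<Sum>k=1..N m. h m * measure \<mu> (A k))"
      if A: "\<And>k. A k \<in> sets \<mu>" for m A
    proof -
      have i: "integrable \<mu> (\<lambda>x. h m * indicat_real (A k) x)"
        and e: "(\<integral>x. h m * indicat_real (A k) x \<partial>\<mu>) = h m * measure \<mu> (A k)" for k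
        using A[of k] sets.sets_into_space[OF A[of k]]
        by (simp_all add: Int_absorb2 less_top[symmetric])
      show "integrable \<mu> (\<lambda>x. \<Sum>k=1..N m. h m * indicat_real (A k) x)"
        by (rule Bochner_Integration.integrable_sum) (rule i)
      show "(\<integral>x. (\<Sum>k=1..N m. h m * indicat_real (A k) x) \<partial>\<mu>) = (\<Sum>k=1..N m. h m * measure \<mu> (A k))"
        by (subst Bochner_Integration.integral_sum) (simp_all only: i e)
    qed
    have fE: "f \<in> E" using f PE by auto
    have so_int: "(\<integral>x. so m x \<partial>\<mu>) \<le> L f" "integrable \<mu> (so m)" for m
    proof -
      have eq: "(\<integral>x. so m x \<partial>\<mu>) = (\<integral>x. (\<Sum>k=1..N m. h m * indicat_real (U m k) x) \<partial>\<mu>)"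
        by (rule Bochner_Integration.integral_cong) (auto simp: so_eq sp)
      have "integrable \<mu> (so m) \<longleftrightarrow> integrable \<mu> (\<lambda>x. \<Sum>k=1..N m. h m * indicat_real (U m k) x)"
        by (rule Bochner_Integration.integrable_cong) (auto simp: so_eq sp)
      then show "integrable \<mu> (so m)" using step_int(1)[OF Um] by simp
      have "(\<integral>x. so m x \<partial>\<mu>) = (\<Sum>k=1..N m. h m * measure \<mu> (U m k))"
        using eq step_int(2)[OF Um] by simp
      also have "\<dots> \<le> (\<Sum>k=1..N m. h m * c (U m k))"
        using h0[of m] by (intro sum_mono mult_left_mono open_le U) auto
      also have "\<dots> = \<Lambda> (\<lambda>x. \<Sum>k=1..N m. h m * indicat_real (U m k) x)" by (rule \<Lambda>_step[symmetric])
      also have "\<dots> \<le> \<Lambda> f" by (intro \<Lambda>_mono sum_E fE) (simp only: so_eq[symmetric] so_le)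
      finally show "(\<integral>x. so m x \<partial>\<mu>) \<le> L f" by (simp add: \<Lambda>_L f)
    qed
    have lim: "(\<lambda>m. so m x) \<longlonglongrightarrow> f x" if x: "x \<in> K" for x
    proof (rule tendsto_sandwich)
      obtain n where n: "f x \<le> real n" using real_arch_simple by blast
      show "eventually (\<lambda>m. f x - h m \<le> so m x) sequentially"
        unfolding eventually_sequentially
      proof (intro exI allI impI)
        fix m assume "n \<le> m"
        then have "f x \<le> real (Suc m)" using n by (meson le_Suc_eq of_nat_mono order_trans)
        then show "f x - h m \<le> so m x" using so_ge[of x m] by (simp del: of_nat_Suc)
      qed
      show "eventually (\<lambda>m. so m x \<le> f x) sequentially" using so_le[OF x] by simp
      have "(\<lambda>m. f x - h m) \<longlonglongrightarrow> f x - 0"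
        unfolding h_def by (intro tendsto_intros LIMSEQ_inverse_real_of_nat)
      then show "(\<lambda>m. f x - h m) \<longlonglongrightarrow> f x" by simp
    qed simp
    have so0: "0 \<le> so m x" for m x unfolding so_def using h0[of m] by (intro sum_nonneg) (auto simp: less_imp_le)
    have "(\<integral>\<^sup>+x. ennreal (f x) \<partial>\<mu>) = (\<integral>\<^sup>+x. liminf (\<lambda>m. ennreal (so m x)) \<partial>\<mu>)"
      using lim by (intro nn_integral_cong lim_imp_Liminf[symmetric] tendsto_ennrealI) (auto simp: sp)
    also have "\<dots> \<le> liminf (\<lambda>m. \<integral>\<^sup>+x. ennreal (so m x) \<partial>\<mu>)"
      using so_int(2) by (intro nn_integral_liminf) auto
    also have "\<dots> \<le> liminf (\<lambda>m. ennreal (L f))"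
      using so_int so0 by (intro Liminf_mono always_eventually allI)
        (simp add: nn_integral_eq_integral ennreal_leI)
    finally have "(\<integral>\<^sup>+x. ennreal (f x) \<partial>\<mu>) \<le> ennreal (L f)" by (simp add: Liminf_const)
    then have int_f: "integrable \<mu> f"
      using fm f0 by (intro integrableI_nonneg) (auto simp: sp intro: le_less_trans)
    have le: "(\<integral>x. f x \<partial>\<mu>) \<le> L f"
    proof (rule LIMSEQ_le_const2)
      show "(\<lambda>m. \<integral>x. so m x \<partial>\<mu>) \<longlonglongrightarrow> (\<integral>x. f x \<partial>\<mu>)"
        using so_int(2) lim so_le so0 fm
        by (intro integral_dominated_convergence[where w = f] int_f) (auto simp: sp)
    qed (use so_int in auto)
    have ge: "L f \<le> (\<integral>x. f x \<partial>\<mu>)"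
    proof -
      have ff: "(\<lambda>x. f x * f x) \<in> P" by (rule mult[OF f f])
      have "L f \<le> (h m * L (\<lambda>x. f x * f x) + h m * L (\<lambda>_. 1)) + (\<integral>x. f x \<partial>\<mu>)" for m
      proof -
        have pt: "f x \<le> (h m * (f x * f x) + h m * 1) + (\<Sum>k=1..N m. h m * indicat_real (F m k) x)"
          if x: "x \<in> K" for x
        proof (cases "f x \<le> real (Suc m)")
          case True
          then have "f x \<le> h m + sc m x" using sc_ge[of x m] by (simp del: of_nat_Suc)
          moreover have "0 \<le> h m * (f x * f x)" using h0[of m] by simp
          ultimately show ?thesis using sc_eq[OF x, of m] by linarith
        next
          case False
          then have "1 \<le> h m * f x" by (simp add: h_def field_simps)
          then have "f x \<le> (h m * f x) * f x" using f0[OF x] mult_right_mono[of 1 "h m * f x" "f x"] by simp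
          moreover have "0 \<le> (\<Sum>k=1..N m. h m * indicat_real (F m k) x)"
            using h0[of m] by (intro sum_nonneg) auto
          ultimately show ?thesis using h0[of m] unfolding mult.assoc mult_1_right by linarith
        qed
        have E1: "(\<lambda>x. h m * (f x * f x)) \<in> E" "(\<lambda>x. h m * 1) \<in> E"
          using ff const PE by (auto intro: E_scale)
        have "L f = \<Lambda> f" by (simp add: \<Lambda>_L f)
        also have "\<dots> \<le> \<Lambda> (\<lambda>x. (h m * (f x * f x) + h m * 1) + (\<Sum>k=1..N m. h m * indicat_real (F m k) x))"
          using pt by (intro \<Lambda>_mono fE E_add E1 sum_E)
        also have "\<dots> = (\<Lambda> (\<lambda>x. h m * (f x * f x)) + \<Lambda> (\<lambda>x. h m * 1)) + (\<Sum>k=1..N m. h m * c (F m k))"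
          using \<Lambda>_add[OF E_add[OF E1] sum_E] \<Lambda>_add[OF E1] \<Lambda>_step by simp
        also have "\<Lambda> (\<lambda>x. h m * (f x * f x)) = h m * L (\<lambda>x. f x * f x)"
          using ff PE by (subst \<Lambda>_scale) (auto simp: \<Lambda>_L)
        also have "\<Lambda> (\<lambda>x. h m * 1) = h m * L (\<lambda>_. 1)"
          using const[of 1] PE by (subst \<Lambda>_scale) (auto simp: \<Lambda>_L)
        also have "(\<Sum>k=1..N m. h m * c (F m k)) \<le> (\<Sum>k=1..N m. h m * measure \<mu> (F m k))"
          using h0[of m] by (intro sum_mono mult_left_mono closed_le F) auto
        also have "\<dots> = (\<integral>x. (\<Sum>k=1..N m. h m * indicat_real (F m k) x) \<partial>\<mu>)"
          by (rule step_int(2)[OF Fm, symmetric])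
        also have "\<dots> \<le> (\<integral>x. f x \<partial>\<mu>)"
          by (intro integral_mono step_int(1) Fm int_f) (simp only: sp sc_eq[symmetric] sc_le)
        finally show ?thesis by simp
      qed
      moreover have "(\<lambda>m. (h m * L (\<lambda>x. f x * f x) + h m * L (\<lambda>_. 1)) + (\<integral>x. f x \<partial>\<mu>))
          \<longlonglongrightarrow> (0 * L (\<lambda>x. f x * f x) + 0 * L (\<lambda>_. 1)) + (\<integral>x. f x \<partial>\<mu>)"
        unfolding h_def by (intro tendsto_intros LIMSEQ_inverse_real_of_nat)
      ultimately have "L f \<le> (0 * L (\<lambda>x. f x * f x) + 0 * L (\<lambda>_. 1)) + (\<integral>x. f x \<partial>\<mu>)"
        by (intro LIMSEQ_le_const) auto
      then show ?thesis by simp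
    qed
    show ?thesis using int_f le ge by simp
  qed
  have all: "integrable \<mu> p \<and> (\<integral>x. p x \<partial>\<mu>) = L p" if p: "p \<in> P" for p
  proof -
    have p1: "(\<lambda>x. p x + 1) \<in> P" using add[OF p const[of 1]] .
    \<comment> \<open>\<open>2 p = (p + 1)\<^sup>2 - (p\<^sup>2 + 1)\<close> is a difference of nonnegative elements\<close>
    define a b where "a = (\<lambda>x. (p x + 1) * (p x + 1))" and "b = (\<lambda>x. p x * p x + 1)"
    have ab: "a \<in> P" "b \<in> P" using mult[OF p1 p1] add[OF mult[OF p p] const[of 1]] by (auto simp: a_def b_def)
    have A: "integrable \<mu> a" "(\<integral>x. a x \<partial>\<mu>) = L a" using main[OF ab(1)] by (auto simp: a_def)
    have B: "integrable \<mu> b" "(\<integral>x. b x \<partial>\<mu>) = L b" using main[OF ab(2)] by (auto simp: b_def)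
    have eq: "p = (\<lambda>x. (1/2) * (a x + (-1) * b x))" by (auto simp: a_def b_def algebra_simps)
    have "L (\<lambda>x. (1/2) * (a x + (-1) * b x)) = (1/2) * (L a + (-1) * L b)"
      by (simp only: L_scale[OF add[OF ab(1) scale[OF ab(2)]]] L_add[OF ab(1) scale[OF ab(2)]] L_scale[OF ab(2)])
    then have Lp: "L p = (1/2) * (L a + (-1) * L b)" using eq by simp
    have "integrable \<mu> (\<lambda>x. (1/2) * (a x + (-1) * b x))" using A B by (intro integrable_mult_right Bochner_Integration.integrable_add)
    moreover have "(\<integral>x. (1/2) * (a x + (-1) * b x) \<partial>\<mu>) = (1/2) * (L a + (-1) * L b)"
      using A B by simp
    ultimately show ?thesis using eq Lp by simp
  qed
  show ?thesis
  proof (rule that)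
    show "space \<mu> = K" "sets \<mu> = sets (restrict_space borel K)" by (rule sp, rule st)
  qed (use all in auto)
qed

section \<open>Polynomial functions and coordinate algebras\<close>

lemma real_subalgebra_pred:
  assumes "f \<in> real_subalgebra S" "\<And>f. f \<in> S \<Longrightarrow> f x \<in> \<real>"
  shows "f x \<in> \<real>"
  using assms(1) by induction (use assms(2) in auto)

lemma real_subalgebra_continuous:
  assumes "f \<in> real_subalgebra S" "\<And>f. f \<in> S \<Longrightarrow> continuous_on A f"
  shows "continuous_on A f"
  using assms(1) by induction (use assms(2) in \<open>auto intro!: continuous_intros\<close>)

lemma real_subalgebra_subst:
  assumes "p \<in> real_subalgebra S"
    and "\<And>s. s \<in> S \<Longrightarrow> \<exists>r\<in>real_subalgebra T. \<forall>z\<in>Z. s (h z) = r z"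
  shows "\<exists>r\<in>real_subalgebra T. \<forall>z\<in>Z. p (h z) = r z"
  using assms(1)
proof induction
  case (const c)
  show ?case by (intro bexI[OF _ real_subalgebra.const]) auto
next
  case (add f g)
  then obtain a b where "a \<in> real_subalgebra T" "b \<in> real_subalgebra T"
    "\<forall>z\<in>Z. f (h z) = a z" "\<forall>z\<in>Z. g (h z) = b z" by blast
  then show ?case by (intro bexI[OF _ real_subalgebra.add[of a T b]]) auto
next
  case (mult f g)
  then obtain a b where "a \<in> real_subalgebra T" "b \<in> real_subalgebra T"
    "\<forall>z\<in>Z. f (h z) = a z" "\<forall>z\<in>Z. g (h z) = b z" by blast
  then show ?case by (intro bexI[OF _ real_subalgebra.mult[of a T b]]) auto
qed (use assms(2) in auto)

lemma real_polys_coord: "i < n \<Longrightarrow> (\<lambda>x. x i) \<in> real_polys n"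
  unfolding real_polys_def by (auto intro: real_subalgebra.gen)

lemma real_polys_const: "(\<lambda>_. complex_of_real c) \<in> real_polys n"
  unfolding real_polys_def by (rule real_subalgebra.const)

lemma real_polys_add: "f \<in> real_polys n \<Longrightarrow> g \<in> real_polys n \<Longrightarrow> (\<lambda>x. f x + g x) \<in> real_polys n"
  unfolding real_polys_def by (rule real_subalgebra.add)

lemma real_polys_mult: "f \<in> real_polys n \<Longrightarrow> g \<in> real_polys n \<Longrightarrow> (\<lambda>x. f x * g x) \<in> real_polys n"
  unfolding real_polys_def by (rule real_subalgebra.mult)

lemma real_polys_real: "p \<in> real_polys n \<Longrightarrow> (\<And>i. x i \<in> \<real>) \<Longrightarrow> p x \<in> \<real>"
  unfolding real_polys_def by (erule real_subalgebra_pred) auto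

lemma real_polys_continuous: "p \<in> real_polys n \<Longrightarrow> continuous_on A p"
  unfolding real_polys_def
  by (erule real_subalgebra_continuous) (auto intro: continuous_on_subset[OF continuous_on_product_coordinates subset_UNIV])

lemma real_polys2_real: "p \<in> real_polys2 k n \<Longrightarrow> (\<And>i. y i \<in> \<real>) \<Longrightarrow> (\<And>i. x i \<in> \<real>) \<Longrightarrow> p (y, x) \<in> \<real>"
  unfolding real_polys2_def by (erule real_subalgebra_pred) auto

lemma real_polys2_continuous: "p \<in> real_polys2 k n \<Longrightarrow> continuous_on A p"
  unfolding real_polys2_def
proof (erule real_subalgebra_continuous)
  fix s :: "(nat \<Rightarrow> complex) \<times> (nat \<Rightarrow> complex) \<Rightarrow> complex"
  assume "s \<in> {(\<lambda>(y, x). y i) | i. i < k} \<union> {(\<lambda>(y, x). x j) | j. j < n}"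
  then consider i where "s = (\<lambda>z. fst z i)" | j where "s = (\<lambda>z. snd z j)"
    unfolding case_prod_beta' by blast
  then show "continuous_on A s"
    using continuous_on_product_then_coordinatewise[OF continuous_on_fst[OF continuous_on_id]]
      continuous_on_product_then_coordinatewise[OF continuous_on_snd[OF continuous_on_id]]
    by cases auto
qed

lemma real_polys2_fix:
  assumes "p \<in> real_polys2 k n" "\<And>i. y i \<in> \<real>"
  shows "\<exists>r\<in>real_polys n. \<forall>x. p (y, x) = r x"
proof -
  have "\<exists>r\<in>real_subalgebra {(\<lambda>x. x i) | i. i < n}. \<forall>x\<in>UNIV. p ((\<lambda>x. (y, x)) x) = r x"
    using assms(1) unfolding real_polys2_def
  proof (rule real_subalgebra_subst)
    fix s :: "(nat \<Rightarrow> complex) \<times> (nat \<Rightarrow> complex) \<Rightarrow> complex"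
    assume "s \<in> {(\<lambda>(y, x). y i) | i. i < k} \<union> {(\<lambda>(y, x). x j) | j. j < n}"
    then consider i where "s = (\<lambda>(y, x). y i)" | j where "s = (\<lambda>(y, x). x j)" "j < n" by auto
    then show "\<exists>r\<in>real_subalgebra {(\<lambda>x. x i) | i. i < n}. \<forall>x\<in>UNIV. s (y, x) = r x"
    proof cases
      case 1
      have "y i = complex_of_real (Re (y i))" using assms(2) by simp
      then show ?thesis using 1 by (intro bexI[OF _ real_subalgebra.const[of "Re (y i)"]]) auto
    next
      case 2
      then show ?thesis by (intro bexI[OF _ real_subalgebra.gen[of "\<lambda>x. x j"]]) auto
    qed
  qed
  then show ?thesis by (simp add: real_polys_def)
qed

text \<open>A coordinate of \<open>y\<close> is bounded on the compact set, a real coordinate \<open>t\<close> of \<open>x\<close> satisfies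
\<open>\<bar>t\<bar> \<le> 1 + t\<^sup>2\<close>, and the bounds can be added and multiplied.\<close>

lemma real_polys2_dominated:
  assumes "F \<in> real_polys2 k n" and "compact C"
  shows "\<exists>b\<in>real_polys n. \<forall>y\<in>C. \<forall>x. (\<forall>i. x i \<in> \<real>) \<longrightarrow> norm (F (y, x)) \<le> Re (b x)"
  using assms(1) unfolding real_polys2_def
proof induction
  case (gen f)
  then consider i where "f = (\<lambda>(y, x). y i)" | j where "f = (\<lambda>(y, x). x j)" "j < n" by auto
  then show ?case
  proof cases
    case 1
    have "compact ((\<lambda>y. y i) ` C)"
      using assms(2) by (intro compact_continuous_image) (auto intro: continuous_on_subset[OF continuous_on_product_coordinates subset_UNIV])
    then obtain B where "\<And>y. y \<in> C \<Longrightarrow> norm (y i) \<le> B"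
      by (meson bounded_iff compact_imp_bounded imageI)
    then show ?thesis using 1 by (intro bexI[OF _ real_polys_const[of B]]) auto
  next
    case 2
    have "norm z \<le> Re (complex_of_real 1 + z * z)" if z: "z \<in> \<real>" for z
    proof -
      obtain r where r: "z = complex_of_real r" using z by (rule Reals_cases)
      show ?thesis using zero_le_square[of "\<bar>r\<bar> - 1"] r by (simp add: algebra_simps abs_mult_self_eq)
    qed
    then show ?thesis using 2 real_polys_add[OF real_polys_const[of 1] real_polys_mult[OF real_polys_coord[of j n] real_polys_coord[of j n]]]
      by (intro bexI[of _ "\<lambda>x. complex_of_real 1 + x j * x j"]) auto
  qed
next
  case (const c)
  show ?case by (intro bexI[OF _ real_polys_const[of "\<bar>c\<bar>"]]) auto
next
  case (add f g)
  then obtain a b where "a \<in> real_polys n" "b \<in> real_polys n"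
    "\<forall>y\<in>C. \<forall>x. (\<forall>i. x i \<in> \<real>) \<longrightarrow> norm (f (y, x)) \<le> Re (a x)"
    "\<forall>y\<in>C. \<forall>x. (\<forall>i. x i \<in> \<real>) \<longrightarrow> norm (g (y, x)) \<le> Re (b x)" by blast
  then show ?case
    by (intro bexI[OF _ real_polys_add[of a n b]]) (auto intro!: order_trans[OF norm_triangle_ineq] add_mono)
next
  case (mult f g)
  then obtain a b where ab: "a \<in> real_polys n" "b \<in> real_polys n"
    "\<And>y x. y \<in> C \<Longrightarrow> (\<forall>i. x i \<in> \<real>) \<Longrightarrow> norm (f (y, x)) \<le> Re (a x)"
    "\<And>y x. y \<in> C \<Longrightarrow> (\<forall>i. x i \<in> \<real>) \<Longrightarrow> norm (g (y, x)) \<le> Re (b x)" by blast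
  have "norm (f (y, x) * g (y, x)) \<le> Re (a x * b x)" if "y \<in> C" "\<forall>i. x i \<in> \<real>" for y x
  proof -
    have "a x \<in> \<real>" "b x \<in> \<real>" using ab that by (auto intro: real_polys_real)
    then have "Re (a x * b x) = Re (a x) * Re (b x)" by (auto elim!: Reals_cases)
    moreover have "0 \<le> Re (a x)" using ab(3)[OF that] norm_ge_zero[of "f (y, x)"] by linarith
    ultimately show ?thesis using ab(3,4)[OF that] by (simp only: norm_mult mult_mono norm_ge_zero)
  qed
  then show ?case by (intro bexI[OF _ real_polys_mult[of a n b]] ab) auto
qed

lemma coord_algebra_carrierE:
  assumes "f \<in> carrier (coord_algebra n V)"
  obtains p where "p \<in> real_polys n" "f = restrict p V"
  using assms by (auto simp: coord_algebra_def)

lemma coord_algebra_carrierI: "p \<in> real_polys n \<Longrightarrow> restrict p V \<in> carrier (coord_algebra n V)"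
  by (auto simp: coord_algebra_def)

lemma coord_algebra_simps:
  "f \<oplus>\<^bsub>coord_algebra n V\<^esub> g = (\<lambda>x\<in>V. f x + g x)"
  "f \<otimes>\<^bsub>coord_algebra n V\<^esub> g = (\<lambda>x\<in>V. f x * g x)"
  "\<one>\<^bsub>coord_algebra n V\<^esub> = (\<lambda>x\<in>V. 1)"
  "c \<odot>\<^bsub>coord_algebra n V\<^esub> f = (\<lambda>x\<in>V. complex_of_real c * f x)"
  by (simp_all add: coord_algebra_def)

lemma invariant_algebra_simps:
  "carrier (invariant_algebra G n V \<phi>) =
     {f \<in> carrier (coord_algebra n V). \<forall>g\<in>real_points (carrier G). compose V f (\<phi> g) = f}"
  "f \<oplus>\<^bsub>invariant_algebra G n V \<phi>\<^esub> g = (\<lambda>x\<in>V. f x + g x)"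
  "f \<otimes>\<^bsub>invariant_algebra G n V \<phi>\<^esub> g = (\<lambda>x\<in>V. f x * g x)"
  "\<one>\<^bsub>invariant_algebra G n V \<phi>\<^esub> = (\<lambda>x\<in>V. 1)"
  by (simp_all add: invariant_algebra_def coord_algebra_def)

lemma coord_algebra_add: 
  assumes "f \<in> carrier (coord_algebra n V)" "g \<in> carrier (coord_algebra n V)"
  shows "(\<lambda>x\<in>V. f x + g x) \<in> carrier (coord_algebra n V)"
proof -
  obtain p q where "p \<in> real_polys n" "f = restrict p V" "q \<in> real_polys n" "g = restrict q V"
    using assms by (auto elim!: coord_algebra_carrierE)
  then show ?thesis using coord_algebra_carrierI[OF real_polys_add[of p n q], of V]
    by (simp add: restrict_def cong: if_cong)
qed

lemma coord_algebra_mult: 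
  assumes "f \<in> carrier (coord_algebra n V)" "g \<in> carrier (coord_algebra n V)"
  shows "(\<lambda>x\<in>V. f x * g x) \<in> carrier (coord_algebra n V)"
proof -
  obtain p q where "p \<in> real_polys n" "f = restrict p V" "q \<in> real_polys n" "g = restrict q V"
    using assms by (auto elim!: coord_algebra_carrierE)
  then show ?thesis using coord_algebra_carrierI[OF real_polys_mult[of p n q], of V]
    by (simp add: restrict_def cong: if_cong)
qed

lemma coord_algebra_const: "(\<lambda>x\<in>V. complex_of_real c) \<in> carrier (coord_algebra n V)"
  using coord_algebra_carrierI[OF real_polys_const] .

lemma coord_algebra_real:
  assumes "f \<in> carrier (coord_algebra n V)" "x \<in> real_points V" shows "f x \<in> \<real>"
proof -
  obtain p where "p \<in> real_polys n" "f = restrict p V" using assms(1) by (rule coord_algebra_carrierE)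
  then show ?thesis using assms(2) real_polys_real[of p n x] by (simp add: real_points_def)
qed

lemma coord_algebra_continuous:
  assumes "f \<in> carrier (coord_algebra n V)" "K \<subseteq> V" shows "continuous_on K f"
proof -
  obtain p where "p \<in> real_polys n" "f = restrict p V" using assms(1) by (rule coord_algebra_carrierE)
  then show ?thesis using assms(2) real_polys_continuous[of p n K]
    by (subst continuous_on_cong[OF refl, of K f p]) auto
qed

lemma quadratic_module_carrier: "quadratic_module (coord_algebra n V) (carrier (coord_algebra n V))"
  unfolding quadratic_module_def coord_algebra_simps
  using coord_algebra_const[where V = V and c = 1 and n = n]
  by (intro conjI ballI order_refl coord_algebra_add coord_algebra_mult) simp_all

lemma quadratic_module_generated:
  assumes "S \<subseteq> carrier (coord_algebra n V)"
  shows "quadratic_module (coord_algebra n V) (quadratic_module_generated (coord_algebra n V) S)"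
    and "S \<subseteq> quadratic_module_generated (coord_algebra n V) S"
proof -
  let ?A = "coord_algebra n V" and ?M = "quadratic_module_generated (coord_algebra n V) S"
  have M: "?M = \<Inter>{M. quadratic_module ?A M \<and> S \<subseteq> M}" by (simp add: quadratic_module_generated_def)
  have sub: "?M \<subseteq> carrier ?A" unfolding M using quadratic_module_carrier[of n V] assms by blast
  show "S \<subseteq> ?M" unfolding M by blast
  show "quadratic_module ?A ?M"
    unfolding quadratic_module_def[of ?A ?M]
  proof (intro conjI ballI sub)
    show "\<one>\<^bsub>?A\<^esub> \<in> ?M" unfolding M by (simp add: quadratic_module_def)
    show "p \<oplus>\<^bsub>?A\<^esub> q \<in> ?M" if "p \<in> ?M" "q \<in> ?M" for p q
      using that unfolding M by (simp add: quadratic_module_def)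
    show "(a \<otimes>\<^bsub>?A\<^esub> a) \<otimes>\<^bsub>?A\<^esub> p \<in> ?M" if "a \<in> carrier ?A" "p \<in> ?M" for a p
      using that unfolding M by (simp add: quadratic_module_def)
  qed
qed

lemma quadratic_module_generated_least:
  "quadratic_module A M \<Longrightarrow> S \<subseteq> M \<Longrightarrow> quadratic_module_generated A S \<subseteq> M"
  unfolding quadratic_module_generated_def by auto

lemma compose_in_coord_algebra:
  assumes "\<And>x. x \<in> V \<Longrightarrow> h x \<in> V"
    and "\<And>i. i < n \<Longrightarrow> \<exists>r\<in>real_polys n. \<forall>x\<in>V. h x i = r x"
    and "f \<in> carrier (coord_algebra n V)"
  shows "compose V f h \<in> carrier (coord_algebra n V)"
proof -
  obtain p where p: "p \<in> real_polys n" "f = restrict p V" using assms(3) by (rule coord_algebra_carrierE)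
  have "\<exists>r\<in>real_subalgebra {(\<lambda>x. x i) | i. i < n}. \<forall>x\<in>V. p (h x) = r x"
    using p(1) unfolding real_polys_def
    by (rule real_subalgebra_subst) (use assms(2) in \<open>auto simp: real_polys_def\<close>)
  then obtain r where r: "r \<in> real_polys n" "\<forall>x\<in>V. p (h x) = r x" unfolding real_polys_def by blast
  have "compose V f h = restrict r V" using r(2) p(2) assms(1) by (auto simp: compose_def restrict_def)
  then show ?thesis using coord_algebra_carrierI[OF r(1)] by simp
qed

lemma finite_measure_of_measure_on:
  assumes K: "K \<subseteq> real_points V" and \<mu>: "measure_on n V K \<mu>"
  shows "finite_measure \<mu>"
proof -
  have "integrable \<mu> (\<lambda>x. Re ((\<lambda>x\<in>V. complex_of_real 1) x))"
    using \<mu> coord_algebra_const unfolding measure_on_def by blast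
  moreover have "integrable \<mu> (\<lambda>x. Re ((\<lambda>x\<in>V. complex_of_real 1) x)) \<longleftrightarrow> integrable \<mu> (\<lambda>x. 1 :: real)"
    by (rule Bochner_Integration.integrable_cong)
       (use K \<mu> in \<open>auto simp: measure_on_def real_points_def\<close>)
  ultimately have "integrable \<mu> (\<lambda>x. 1 :: real)" by blast
  then have "emeasure \<mu> (space \<mu>) < \<infinity>" by (simp add: integrable_iff_bounded)
  then show ?thesis by (intro finite_measureI) simp
qed

lemma real_polys2_measurable:
  assumes "p \<in> real_polys2 k n" "sets \<nu> = sets (restrict_space borel A)" "sets \<mu> = sets (restrict_space borel B)"
  shows "p \<in> borel_measurable (\<nu> \<Otimes>\<^sub>M \<mu>)"
proof -
  have "p \<in> borel_measurable (borel \<Otimes>\<^sub>M borel)"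
    unfolding borel_prod using real_polys2_continuous[OF assms(1)] by (rule borel_measurable_continuous_onI)
  moreover have "(\<lambda>z. (fst z, snd z)) \<in> restrict_space borel A \<Otimes>\<^sub>M restrict_space borel B \<rightarrow>\<^sub>M borel \<Otimes>\<^sub>M borel"
    by (intro measurable_Pair measurable_compose[OF measurable_fst] measurable_compose[OF measurable_snd]
        measurable_restrict_space1 measurable_ident_sets refl)
  ultimately have "p \<in> borel_measurable (restrict_space borel A \<Otimes>\<^sub>M restrict_space borel B)"
    by (simp add: measurable_compose)
  then show ?thesis
    using sets_pair_measure_cong[OF assms(2,3)] by (simp cong: measurable_cong_sets)
qed

section \<open>Averaging over a compact group\<close>

locale compact_algebraic_action =
  fixes k :: nat and G :: "(nat \<Rightarrow> complex) monoid" (structure) and n :: nat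
    and V :: "(nat \<Rightarrow> complex) set" and \<phi> :: "(nat \<Rightarrow> complex) \<Rightarrow> (nat \<Rightarrow> complex) \<Rightarrow> (nat \<Rightarrow> complex)"
  assumes linear: "linear_algebraic_group k G"
    and compact: "compact (real_points (carrier G))"
    and action: "affine_G_variety k G n V \<phi>"
begin

sublocale group G using linear by (simp add: linear_algebraic_group_def)

sublocale group_action G V \<phi> using action by (simp add: affine_G_variety_def)

abbreviation GR where "GR \<equiv> real_points (carrier G)"

lemma GR_sub: "g \<in> GR \<Longrightarrow> g \<in> carrier G" and GR_real: "g \<in> GR \<Longrightarrow> g i \<in> \<real>"
  by (auto simp: real_points_def)

lemma G_affine: "g \<in> carrier G \<Longrightarrow> g \<in> affine_space k"
  using linear by (auto simp: linear_algebraic_group_def affine_variety_def)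

lemma V_affine: "x \<in> V \<Longrightarrow> x \<in> affine_space n"
  using action by (auto simp: affine_G_variety_def affine_variety_def)

lemma mult_poly: "i < k \<Longrightarrow> \<exists>p\<in>real_polys2 k k. \<forall>x\<in>carrier G. \<forall>y\<in>carrier G. (x \<otimes> y) i = p (x, y)"
  using linear by (auto simp: linear_algebraic_group_def regular_map2_def)

lemma inv_poly: "i < k \<Longrightarrow> \<exists>p\<in>real_polys k. \<forall>x\<in>carrier G. (inv x) i = p x"
  using linear by (auto simp: linear_algebraic_group_def regular_map_def)

lemma action_poly: "i < n \<Longrightarrow> \<exists>p\<in>real_polys2 k n. \<forall>g\<in>carrier G. \<forall>x\<in>V. \<phi> g x i = p (g, x)"
  using action by (auto simp: affine_G_variety_def regular_map2_def)

lemma action_closed: "g \<in> carrier G \<Longrightarrow> x \<in> V \<Longrightarrow> \<phi> g x \<in> V"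
  by (rule element_image) auto

lemma subgroup_GR: "subgroup GR G"
proof (rule subgroupI)
  show "GR \<subseteq> carrier G" using GR_sub by auto
  show "GR \<noteq> {}" using linear by (auto simp: linear_algebraic_group_def)
  show "inv a \<in> GR" if "a \<in> GR" for a
  proof -
    have a: "a \<in> carrier G" "inv a \<in> carrier G" using GR_sub[OF that] by auto
    have "(inv a) i \<in> \<real>" for i
    proof (cases "i < k")
      case True
      then obtain p where "p \<in> real_polys k" "(inv a) i = p a" using inv_poly a by blast
      then show ?thesis using GR_real[OF that] by (simp add: real_polys_real)
    next
      case False
      then show ?thesis using G_affine[OF a(2)] by (simp add: affine_space_def)
    qed
    then show ?thesis using a by (simp add: real_points_def)
  qed
  show "a \<otimes> b \<in> GR" if "a \<in> GR" "b \<in> GR" for a b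
  proof -
    have ab: "a \<in> carrier G" "b \<in> carrier G" "a \<otimes> b \<in> carrier G" using GR_sub that by auto
    have "(a \<otimes> b) i \<in> \<real>" for i
    proof (cases "i < k")
      case True
      then obtain p where "p \<in> real_polys2 k k" "(a \<otimes> b) i = p (a, b)" using mult_poly ab by blast
      then show ?thesis using GR_real that by (simp add: real_polys2_real)
    next
      case False
      then show ?thesis using G_affine[OF ab(3)] by (simp add: affine_space_def)
    qed
    then show ?thesis using ab by (simp add: real_points_def)
  qed
qed

lemma compact_group_GR: "compact_group (G\<lparr>carrier := GR\<rparr>)"
proof (intro compact_group.intro compact_group_axioms.intro)
  show "group (G\<lparr>carrier := GR\<rparr>)" using subgroup_GR by (rule subgroup_imp_group)
  show "compact (carrier (G\<lparr>carrier := GR\<rparr>))" using compact by simp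
  have "continuous_on (GR \<times> GR) (\<lambda>z. (case z of (x, y) \<Rightarrow> x \<otimes> y) i)" for i
  proof (cases "i < k")
    case True
    then obtain p where "p \<in> real_polys2 k k" "\<forall>x\<in>carrier G. \<forall>y\<in>carrier G. (x \<otimes> y) i = p (x, y)"
      using mult_poly by blast
    then show ?thesis using real_polys2_continuous[of p k k "GR \<times> GR"]
      by (subst continuous_on_cong[OF refl, where g = p]) (auto simp: GR_sub)
  next
    case False
    then have "(x \<otimes> y) i = 0" if "x \<in> GR" "y \<in> GR" for x y
      using G_affine[of "x \<otimes> y"] GR_sub that by (simp add: affine_space_def)
    then show ?thesis by (subst continuous_on_cong[OF refl, where g = "\<lambda>_. 0"]) auto
  qed
  then have "continuous_on (GR \<times> GR) (\<lambda>(x, y). x \<otimes> y)"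
    by (rule continuous_on_coordinatewise_then_product)
  then show "continuous_on (carrier (G\<lparr>carrier := GR\<rparr>) \<times> carrier (G\<lparr>carrier := GR\<rparr>))
      (\<lambda>(x, y). x \<otimes>\<^bsub>G\<lparr>carrier := GR\<rparr>\<^esub> y)" by simp
qed

lemma compose_action_in_coord_algebra:
  assumes "g \<in> GR" "f \<in> carrier (coord_algebra n V)"
  shows "compose V f (\<phi> g) \<in> carrier (coord_algebra n V)"
proof (rule compose_in_coord_algebra[OF _ _ assms(2)])
  show "\<phi> g x \<in> V" if "x \<in> V" for x by (rule action_closed[OF GR_sub[OF assms(1)] that])
  fix i assume "i < n"
  then obtain p where p: "p \<in> real_polys2 k n" "\<forall>x\<in>V. \<phi> g x i = p (g, x)"
    using action_poly GR_sub[OF assms(1)] by blast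
  then show "\<exists>r\<in>real_polys n. \<forall>x\<in>V. \<phi> g x i = r x"
    using real_polys2_fix[OF p(1), of g] GR_real[OF assms(1)] by auto
qed

lemma action_pullback_poly:
  assumes "f \<in> carrier (coord_algebra n V)"
  obtains F where "F \<in> real_polys2 k n" "\<And>g x. g \<in> carrier G \<Longrightarrow> x \<in> V \<Longrightarrow> f (\<phi> g x) = F (g, x)"
proof -
  obtain p where p: "p \<in> real_polys n" "f = restrict p V" using assms by (rule coord_algebra_carrierE)
  have "\<exists>r\<in>real_subalgebra ({(\<lambda>(y, x). y i) | i. i < k} \<union> {(\<lambda>(y, x). x j) | j. j < n}).
      \<forall>z\<in>carrier G \<times> V. p ((\<lambda>(g, x). \<phi> g x) z) = r z"
    using p(1) unfolding real_polys_def
  proof (rule real_subalgebra_subst)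
    fix s :: "(nat \<Rightarrow> complex) \<Rightarrow> complex" assume "s \<in> {(\<lambda>x. x i) | i. i < n}"
    then obtain i where "i < n" "s = (\<lambda>x. x i)" by auto
    then show "\<exists>r\<in>real_subalgebra ({(\<lambda>(y, x). y i) | i. i < k} \<union> {(\<lambda>(y, x). x j) | j. j < n}).
      \<forall>z\<in>carrier G \<times> V. s ((\<lambda>(g, x). \<phi> g x) z) = r z"
      using action_poly[of i] unfolding real_polys2_def by auto
  qed
  then obtain F where "F \<in> real_polys2 k n" "\<forall>z\<in>carrier G \<times> V. p ((\<lambda>(g, x). \<phi> g x) z) = F z"
    unfolding real_polys2_def by blast
  then show ?thesis using p(2) action_closed by (intro that[of F]) simp_all
qed

text \<open>The function is dominated by one that depends on \<open>x\<close> alone and is integrable for \<open>\<mu>\<close>.\<close>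

lemma integrable_action:
  assumes K: "K \<subseteq> real_points V"
    and \<mu>: "measure_on n V K \<mu>"
    and \<nu>: "space \<nu> = GR" "sets \<nu> = sets (restrict_space borel GR)" "finite_measure \<nu>"
    and f: "f \<in> carrier (coord_algebra n V)"
  shows "integrable (\<nu> \<Otimes>\<^sub>M \<mu>) (\<lambda>z. Re (f (\<phi> (fst z) (snd z))))"
proof -
  interpret \<nu>: finite_measure \<nu> by (rule \<nu>(3))
  have sp\<mu>: "space \<mu> = K" and st\<mu>: "sets \<mu> = sets (restrict_space borel K)"
    and int: "\<And>f. f \<in> carrier (coord_algebra n V) \<Longrightarrow> integrable \<mu> (\<lambda>x. Re (f x))"
    using \<mu> by (auto simp: measure_on_def)
  have KV: "x \<in> V" "\<And>i. x i \<in> \<real>" if "x \<in> K" for x using that K by (auto simp: real_points_def)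
  interpret \<mu>: finite_measure \<mu> by (rule finite_measure_of_measure_on[OF K \<mu>])
  interpret P: pair_sigma_finite \<nu> \<mu> ..
  obtain F where F: "F \<in> real_polys2 k n" "\<And>g x. g \<in> carrier G \<Longrightarrow> x \<in> V \<Longrightarrow> f (\<phi> g x) = F (g, x)"
    using f by (rule action_pullback_poly) blast
  obtain b where b: "b \<in> real_polys n"
    "\<And>g x. g \<in> GR \<Longrightarrow> (\<forall>i. x i \<in> \<real>) \<Longrightarrow> norm (F (g, x)) \<le> Re (b x)"
    using real_polys2_dominated[OF F(1) compact] by blast
  have bint: "integrable \<mu> (\<lambda>x. Re (b x))"
    using int[OF coord_algebra_carrierI[OF b(1)]]
    by (rule Bochner_Integration.integrable_cong[THEN iffD1, rotated -1]) (auto simp: sp\<mu> KV)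
  show ?thesis
  proof (rule Bochner_Integration.integrable_bound)
    show "integrable (\<nu> \<Otimes>\<^sub>M \<mu>) (\<lambda>z. Re (b (snd z)))"
    proof (rule P.Fubini_integrable)
      show "(\<lambda>z. Re (b (snd z))) \<in> borel_measurable (\<nu> \<Otimes>\<^sub>M \<mu>)"
        using borel_measurable_integrable[OF bint] by measurable
    qed (use bint in auto)
    have "(\<lambda>z. Re (F z)) \<in> borel_measurable (\<nu> \<Otimes>\<^sub>M \<mu>)"
      using real_polys2_measurable[OF F(1) \<nu>(2) st\<mu>] by measurable
    then show "(\<lambda>z. Re (f (\<phi> (fst z) (snd z)))) \<in> borel_measurable (\<nu> \<Otimes>\<^sub>M \<mu>)"
      by (rule measurable_cong[THEN iffD1, rotated]) (auto simp: space_pair_measure \<nu>(1) sp\<mu> F(2) GR_sub KV)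
    show "AE z in \<nu> \<Otimes>\<^sub>M \<mu>. norm (Re (f (\<phi> (fst z) (snd z)))) \<le> norm (Re (b (snd z)))"
    proof (rule AE_I2)
      fix z assume "z \<in> space (\<nu> \<Otimes>\<^sub>M \<mu>)"
      then have z: "fst z \<in> GR" "snd z \<in> K" by (auto simp: space_pair_measure \<nu>(1) sp\<mu>)
      have "\<bar>Re (F (fst z, snd z))\<bar> \<le> norm (F (fst z, snd z))" by (rule abs_Re_le_cmod)
      also have "\<dots> \<le> Re (b (snd z))" using b(2) z KV by blast
      finally show "norm (Re (f (\<phi> (fst z) (snd z)))) \<le> norm (Re (b (snd z)))"
        using F(2)[of "fst z" "snd z"] z GR_sub KV by simp
    qed
  qed
qed

text \<open>The invariant measure is the image of \<open>\<nu> \<times> \<mu>\<close> under the action.  It is invariant because left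
translation preserves \<open>\<nu>\<close>, and the integral of \<open>f\<close> is the \<open>\<nu>\<close>-average of the values
\<open>L (f\<^sup>g) = L f\<close>.\<close>

theorem ex_invariant_representing_measure:
  assumes K: "K \<subseteq> real_points V" and inv: "invariant_set G \<phi> K"
    and L: "invariant_functional G n V \<phi> L"
    and \<mu>: "measure_on n V K \<mu>" and rep: "represents n V \<mu> L"
  shows "has_invariant_measure G n V \<phi> K L"
proof -
  interpret H: compact_group "G\<lparr>carrier := GR\<rparr>" by (rule compact_group_GR)
  obtain \<nu> where \<nu>: "space \<nu> = GR" "sets \<nu> = sets (restrict_space borel GR)"
    "emeasure \<nu> GR = 1" "\<And>g. g \<in> GR \<Longrightarrow> distr \<nu> \<nu> (\<lambda>x. g \<otimes> x) = \<nu>"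
    using H.ex_haar_measure by auto
  have fin: "finite_measure \<nu>" by (rule finite_measureI) (simp add: \<nu>)
  interpret \<nu>: finite_measure \<nu> by (rule fin)
  interpret \<mu>: finite_measure \<mu> by (rule finite_measure_of_measure_on[OF K \<mu>])
  interpret P: pair_sigma_finite \<nu> \<mu> ..
  have sp\<mu>: "space \<mu> = K" and st\<mu>: "sets \<mu> = sets (restrict_space borel K)"
    using \<mu> by (auto simp: measure_on_def)
  have KV: "x \<in> V" if "x \<in> K" for x using that K by (auto simp: real_points_def)
  have act: "\<phi> g x \<in> K" if "g \<in> GR" "x \<in> K" for g x using inv that by (auto simp: invariant_set_def)
  have meas: "(\<lambda>z. \<phi> (fst z) (snd z)) \<in> \<nu> \<Otimes>\<^sub>M \<mu> \<rightarrow>\<^sub>M \<mu>"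
  proof -
    have "(\<lambda>z. \<phi> (fst z) (snd z) i) \<in> borel_measurable (\<nu> \<Otimes>\<^sub>M \<mu>)" for i
    proof (cases "i < n")
      case True
      then obtain p where p: "p \<in> real_polys2 k n" "\<forall>g\<in>carrier G. \<forall>x\<in>V. \<phi> g x i = p (g, x)"
        using action_poly by blast
      have "p \<in> borel_measurable (\<nu> \<Otimes>\<^sub>M \<mu>)" by (rule real_polys2_measurable[OF p(1) \<nu>(2) st\<mu>])
      then show ?thesis
        by (rule measurable_cong[THEN iffD1, rotated]) (use p(2) in \<open>auto simp: space_pair_measure \<nu>(1) sp\<mu> GR_sub KV\<close>)
    next
      case False
      have "\<phi> g x i = 0" if "g \<in> GR" "x \<in> K" for g x
        using V_affine[OF KV[OF act[OF that]]] False by (simp add: affine_space_def)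
      then show ?thesis
        by (intro measurable_cong[THEN iffD1, OF _ borel_measurable_const[where c = 0]]) (auto simp: space_pair_measure \<nu>(1) sp\<mu>)
    qed
    then have "(\<lambda>z. \<phi> (fst z) (snd z)) \<in> borel_measurable (\<nu> \<Otimes>\<^sub>M \<mu>)"
      by (rule measurable_coordinatewise_then_product)
    then have "(\<lambda>z. \<phi> (fst z) (snd z)) \<in> \<nu> \<Otimes>\<^sub>M \<mu> \<rightarrow>\<^sub>M restrict_space borel K"
      by (rule measurable_restrict_space2[rotated]) (auto simp: space_pair_measure \<nu>(1) sp\<mu> act)
    then show ?thesis using st\<mu> by (simp cong: measurable_cong_sets)
  qed
  define M where "M = distr (\<nu> \<Otimes>\<^sub>M \<mu>) \<mu> (\<lambda>z. \<phi> (fst z) (snd z))"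
  have spM: "space M = K" and stM: "sets M = sets \<mu>" by (simp_all add: M_def sp\<mu>)
  have Re_meas: "(\<lambda>x. Re (f x)) \<in> borel_measurable \<mu>" if "f \<in> carrier (coord_algebra n V)" for f
    using \<mu> that by (auto simp: measure_on_def)
  have M1: "measure_on n V K M"
    unfolding measure_on_def
  proof (intro conjI ballI)
    fix f assume f: "f \<in> carrier (coord_algebra n V)"
    show "integrable M (\<lambda>x. Re (f x))"
      unfolding M_def using integrable_action[OF K \<mu> \<nu>(1,2) fin f]
      by (subst integrable_distr_eq[OF meas Re_meas[OF f]])
  qed (simp_all add: spM stM st\<mu>)
  have M2: "represents n V M L"
    unfolding represents_def
  proof
    fix f assume f: "f \<in> carrier (coord_algebra n V)"
    have inner: "(\<integral>x. Re (f (\<phi> g x)) \<partial>\<mu>) = L f" if "g \<in> GR" for g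
    proof -
      have "L f = L (compose V f (\<phi> g))" using L f that by (auto simp: invariant_functional_def)
      also have "\<dots> = (\<integral>x. Re (compose V f (\<phi> g) x) \<partial>\<mu>)"
        using rep compose_action_in_coord_algebra[OF that f] by (simp add: represents_def)
      also have "\<dots> = (\<integral>x. Re (f (\<phi> g x)) \<partial>\<mu>)"
        by (rule Bochner_Integration.integral_cong) (auto simp: sp\<mu> KV compose_def)
      finally show ?thesis by simp
    qed
    have "(\<integral>x. Re (f x) \<partial>M) = (\<integral>z. Re (f (\<phi> (fst z) (snd z))) \<partial>(\<nu> \<Otimes>\<^sub>M \<mu>))"
      unfolding M_def by (rule integral_distr[OF meas Re_meas[OF f]])
    also have "\<dots> = (\<integral>g. (\<integral>x. Re (f (\<phi> g x)) \<partial>\<mu>) \<partial>\<nu>)"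
      using P.integral_fst'[OF integrable_action[OF K \<mu> \<nu>(1,2) fin f]] by simp
    also have "\<dots> = (\<integral>g. L f \<partial>\<nu>)"
      by (rule Bochner_Integration.integral_cong) (auto simp: \<nu>(1) inner)
    also have "\<dots> = L f" by (simp add: measure_def \<nu>(1,3))
    finally show "L f = (\<integral>x. Re (f x) \<partial>M)" by simp
  qed
  have M3: "invariant_measure G \<phi> M"
    unfolding invariant_measure_def
  proof
    fix h assume h: "h \<in> GR"
    have trans: "(\<lambda>g. h \<otimes> g) \<in> \<nu> \<rightarrow>\<^sub>M \<nu>"
      using borel_measurable_continuous_on_restrict[OF homeomorphism_cont1[OF H.homeomorphism_translation[of h]]] h
      by (intro measurable_cong_sets[OF \<nu>(2) \<nu>(2), THEN equalityD2, THEN subsetD] measurable_restrict_space2)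
         (auto simp: space_restrict_space subgroup.m_closed[OF subgroup_GR])
    have \<phi>h: "\<phi> h \<in> \<mu> \<rightarrow>\<^sub>M \<mu>"
    proof -
      have "(\<lambda>x. (\<lambda>z. \<phi> (fst z) (snd z)) (h, x)) \<in> \<mu> \<rightarrow>\<^sub>M \<mu>"
        by (rule measurable_compose[OF _ meas]) (use h in \<open>auto simp: \<nu>(1)\<close>)
      then show ?thesis by simp
    qed
    have "distr M M (\<phi> h) = distr M \<mu> (\<phi> h)" by (rule distr_cong) (simp_all add: stM)
    also have "\<dots> = distr (\<nu> \<Otimes>\<^sub>M \<mu>) \<mu> (\<phi> h \<circ> (\<lambda>z. \<phi> (fst z) (snd z)))"
      unfolding M_def by (rule distr_distr[OF \<phi>h meas])
    also have "\<dots> = distr (\<nu> \<Otimes>\<^sub>M \<mu>) \<mu> ((\<lambda>z. \<phi> (fst z) (snd z)) \<circ> (\<lambda>(g, x). (h \<otimes> g, x)))"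
      by (rule distr_cong) (auto simp: space_pair_measure \<nu>(1) sp\<mu> h GR_sub KV composition_rule)
    also have "\<dots> = distr (distr (\<nu> \<Otimes>\<^sub>M \<mu>) (\<nu> \<Otimes>\<^sub>M \<mu>) (\<lambda>(g, x). (h \<otimes> g, x))) \<mu> (\<lambda>z. \<phi> (fst z) (snd z))"
      unfolding case_prod_beta'
      by (intro distr_distr[symmetric] meas measurable_Pair measurable_compose[OF measurable_fst trans] measurable_snd)
    also have "distr (\<nu> \<Otimes>\<^sub>M \<mu>) (\<nu> \<Otimes>\<^sub>M \<mu>) (\<lambda>(g, x). (h \<otimes> g, x)) = \<nu> \<Otimes>\<^sub>M \<mu>"
      using pair_measure_distr[OF trans measurable_ident_sets[OF refl, of \<mu>]] \<nu>(4)[OF h]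
      by (simp add: distr_id2 \<mu>.sigma_finite_measure_axioms)
    finally show "distr M M (\<phi> h) = M" by (simp add: M_def)
  qed
  show ?thesis unfolding has_invariant_measure_def using M1 M2 M3 by blast
qed

end

section \<open>Ordinary or invariant moment problem implies averaged moment problem\<close>

lemma solves_moment_imp_averaged:
  fixes G :: "(nat \<Rightarrow> complex) monoid"
  assumes act: "compact_algebraic_action k G n V \<phi>" and K: "K \<subseteq> real_points V" and inv: "invariant_set G \<phi> K"
    and smp: "solves_moment_problem n V K M"
  shows "solves_averaged_moment_problem G n V \<phi> K M"
  unfolding solves_averaged_moment_problem_def
proof (intro conjI allI impI)
  interpret compact_algebraic_action k G n V \<phi> by (rule act)
  show "quadratic_module (coord_algebra n V) M" using smp by (simp add: solves_moment_problem_def)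
  fix L assume L: "invariant_functional G n V \<phi> L"
  then have "linear_functional (coord_algebra n V) L" by (simp add: invariant_functional_def)
  then have iff: "(\<forall>f\<in>M. 0 \<le> L f) \<longleftrightarrow> (\<exists>\<mu>. measure_on n V K \<mu> \<and> represents n V \<mu> L)"
    using smp by (simp add: solves_moment_problem_def)
  show "has_invariant_measure G n V \<phi> K L \<longleftrightarrow> (\<forall>f\<in>M. 0 \<le> L f)"
    unfolding iff
  proof
    assume "has_invariant_measure G n V \<phi> K L"
    then show "\<exists>\<mu>. measure_on n V K \<mu> \<and> represents n V \<mu> L"
      unfolding has_invariant_measure_def by blast
  next
    assume "\<exists>\<mu>. measure_on n V K \<mu> \<and> represents n V \<mu> L"
    then show "has_invariant_measure G n V \<phi> K L"
      using ex_invariant_representing_measure[OF K inv L] by blast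
  qed
qed

context compact_algebraic_action
begin

lemma continuous_action: 
  assumes "g \<in> GR" shows "continuous_on V (\<phi> g)"
proof (rule continuous_on_coordinatewise_then_product)
  fix i
  show "continuous_on V (\<lambda>x. \<phi> g x i)"
  proof (cases "i < n")
    case True
    then obtain p where p: "p \<in> real_polys2 k n" "\<forall>x\<in>V. \<phi> g x i = p (g, x)"
      using action_poly GR_sub[OF assms] by blast
    obtain r where "r \<in> real_polys n" "\<And>x. p (g, x) = r x"
      using real_polys2_fix[OF p(1), of g] GR_real[OF assms] by auto
    then show ?thesis using p(2) real_polys_continuous[of r n V]
      by (subst continuous_on_cong[OF refl, where g = r]) auto
  next
    case False
    then have "\<phi> g x i = 0" if "x \<in> V" for x
      using V_affine[OF action_closed[OF GR_sub[OF assms] that]] by (simp add: affine_space_def)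
    then show ?thesis by (subst continuous_on_cong[OF refl, where g = "\<lambda>_. 0"]) auto
  qed
qed

lemma measurable_action:
  assumes "g \<in> GR" "K \<subseteq> V" "invariant_set G \<phi> K" "sets \<mu> = sets (restrict_space borel K)"
  shows "\<phi> g \<in> \<mu> \<rightarrow>\<^sub>M \<mu>"
proof -
  have "\<phi> g \<in> restrict_space borel K \<rightarrow>\<^sub>M borel"
    using continuous_on_subset[OF continuous_action[OF assms(1)] assms(2)]
    by (rule borel_measurable_continuous_on_restrict)
  then have "\<phi> g \<in> restrict_space borel K \<rightarrow>\<^sub>M restrict_space borel K"
    by (rule measurable_restrict_space2[rotated]) (use assms in \<open>auto simp: invariant_set_def space_restrict_space\<close>)
  then show ?thesis using assms(4) by (simp cong: measurable_cong_sets)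
qed

text \<open>If \<open>\<mu>\<close> is an invariant measure and \<open>f\<close> an invariant function, then the set \<open>{f < 0}\<close> is invariant
and so is the restriction of \<open>\<mu>\<close> to it.  The hypothesis on the
functional of that restriction says that the integral of \<open>f\<close> over \<open>{f < 0}\<close> is nonnegative.\<close>

lemma AE_nonneg_if_invariant_moments:
  assumes K: "K \<subseteq> real_points V" and inv: "invariant_set G \<phi> K"
    and \<mu>: "measure_on n V K \<mu>" and inv\<mu>: "invariant_measure G \<phi> \<mu>"
    and f: "f \<in> carrier (invariant_algebra G n V \<phi>)"
    and pos: "\<And>L. invariant_functional G n V \<phi> L \<Longrightarrow> has_invariant_measure G n V \<phi> K L \<Longrightarrow> 0 \<le> L f"
  shows "AE x in \<mu>. 0 \<le> Re (f x)"
proof -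
  define B where "B = {x \<in> space \<mu>. Re (f x) < 0}"
  define \<mu>' where "\<mu>' = density \<mu> (indicator B)"
  define L where "L h = (\<integral>x. Re (h x) \<partial>\<mu>')" for h
  have sp: "space \<mu> = K" and st: "sets \<mu> = sets (restrict_space borel K)"
    and int: "\<And>h. h \<in> carrier (coord_algebra n V) \<Longrightarrow> integrable \<mu> (\<lambda>x. Re (h x))"
    using \<mu> by (auto simp: measure_on_def)
  have KV: "K \<subseteq> V" using K by (auto simp: real_points_def)
  have fc: "f \<in> carrier (coord_algebra n V)"
    and finv: "\<And>g. g \<in> GR \<Longrightarrow> compose V f (\<phi> g) = f"
    using f by (auto simp: invariant_algebra_simps)
  have fm[measurable]: "(\<lambda>x. Re (f x)) \<in> borel_measurable \<mu>" using int[OF fc] by auto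
  have B[measurable]: "B \<in> sets \<mu>" unfolding B_def by measurable
  have sp': "space \<mu>' = K" and st': "sets \<mu>' = sets \<mu>" by (simp_all add: \<mu>'_def sp)
  have \<mu>'_real: "\<mu>' = density \<mu> (\<lambda>x. ennreal (indicator B x))"
    by (simp add: \<mu>'_def ennreal_indicator)
  have int': "integrable \<mu>' (\<lambda>x. Re (h x))"
    and int_eq: "(\<integral>x. Re (h x) \<partial>\<mu>') = (\<integral>x. indicator B x * Re (h x) \<partial>\<mu>)"
    if "h \<in> carrier (coord_algebra n V)" for h
  proof -
    have m: "(\<lambda>x. Re (h x)) \<in> borel_measurable \<mu>" using int[OF that] by auto
    show "integrable \<mu>' (\<lambda>x. Re (h x))"
      unfolding \<mu>'_real using integrable_real_mult_indicator[OF B int[OF that]] m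
      by (subst integrable_density) (auto simp: mult.commute)
    show "(\<integral>x. Re (h x) \<partial>\<mu>') = (\<integral>x. indicator B x * Re (h x) \<partial>\<mu>)"
      unfolding \<mu>'_real using m by (subst integral_density) auto
  qed
  have \<mu>'1: "measure_on n V K \<mu>'"
    unfolding measure_on_def using sp' st' st int' by auto
  have B_inv: "\<phi> g x \<in> B \<longleftrightarrow> x \<in> B" if g: "g \<in> GR" and x: "x \<in> K" for g x
  proof -
    have "f (\<phi> g x) = f x" using finv[OF g] x KV by (metis compose_eq subsetD)
    moreover have "\<phi> g x \<in> K" using inv g x by (auto simp: invariant_set_def)
    ultimately show ?thesis using x by (simp add: B_def sp)
  qed
  have meas: "\<phi> g \<in> \<mu> \<rightarrow>\<^sub>M \<mu>" if "g \<in> GR" for g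
    using measurable_action[OF that KV inv st] .
  have \<mu>'_inv: "distr \<mu>' \<mu>' (\<phi> g) = \<mu>'" if g: "g \<in> GR" for g
  proof -
    note [measurable] = meas[OF g]
    have eq: "\<mu>' = density \<mu> (\<lambda>x. indicator B (\<phi> g x))"
      unfolding \<mu>'_def by (rule density_cong) (auto simp: B_inv[OF g] sp indicator_def)
    have "distr \<mu>' \<mu>' (\<phi> g) = distr \<mu>' \<mu> (\<phi> g)" by (rule distr_cong) (simp_all add: st')
    also have "\<dots> = distr (density \<mu> (\<lambda>x. indicator B (\<phi> g x))) \<mu> (\<phi> g)"
      by (simp only: eq[symmetric])
    also have "\<dots> = density (distr \<mu> \<mu> (\<phi> g)) (indicator B)"
      by (rule density_distr[symmetric]) auto
    also have "\<dots> = \<mu>'" using inv\<mu> g by (simp add: invariant_measure_def \<mu>'_def)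
    finally show ?thesis .
  qed
  have "invariant_functional G n V \<phi> L"
    unfolding invariant_functional_def linear_functional_def coord_algebra_simps
  proof (intro conjI ballI allI)
    fix a b assume ab: "a \<in> carrier (coord_algebra n V)" "b \<in> carrier (coord_algebra n V)"
    have "L (\<lambda>x\<in>V. a x + b x) = (\<integral>x. Re (a x) + Re (b x) \<partial>\<mu>')"
      unfolding L_def by (rule Bochner_Integration.integral_cong) (use KV sp' in auto)
    then show "L (\<lambda>x\<in>V. a x + b x) = L a + L b" using ab int' by (simp add: L_def)
  next
    fix c a assume a: "a \<in> carrier (coord_algebra n V)"
    have "L (\<lambda>x\<in>V. complex_of_real c * a x) = (\<integral>x. c * Re (a x) \<partial>\<mu>')"
      unfolding L_def by (rule Bochner_Integration.integral_cong) (use KV sp' in auto)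
    then show "L (\<lambda>x\<in>V. complex_of_real c * a x) = c * L a" by (simp add: L_def)
  next
    fix a g assume a: "a \<in> carrier (coord_algebra n V)" and g: "g \<in> GR"
    have m: "\<phi> g \<in> \<mu>' \<rightarrow>\<^sub>M \<mu>'" using meas[OF g] st' by (simp cong: measurable_cong_sets)
    have "L (compose V a (\<phi> g)) = (\<integral>x. Re (a (\<phi> g x)) \<partial>\<mu>')"
      unfolding L_def by (rule Bochner_Integration.integral_cong) (use KV sp' in \<open>auto simp: compose_def\<close>)
    also have "\<dots> = (\<integral>x. Re (a x) \<partial>distr \<mu>' \<mu>' (\<phi> g))"
      using int'[OF a] by (intro integral_distr[OF m, symmetric]) auto
    also have "\<dots> = L a" by (simp add: \<mu>'_inv[OF g] L_def)
    finally show "L (compose V a (\<phi> g)) = L a" .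
  qed
  moreover have "has_invariant_measure G n V \<phi> K L"
    unfolding has_invariant_measure_def invariant_measure_def represents_def
    using \<mu>'1 \<mu>'_inv L_def by blast
  ultimately have "0 \<le> (\<integral>x. indicator B x * Re (f x) \<partial>\<mu>)"
    using pos[of L] int_eq[OF fc] by (simp add: L_def)
  moreover have i: "integrable \<mu> (\<lambda>x. - (indicator B x * Re (f x)))"
    using integrable_real_mult_indicator[OF B int[OF fc]] by (simp add: mult.commute)
  moreover have nn: "AE x in \<mu>. 0 \<le> - (indicator B x * Re (f x))"
    by (rule AE_I2) (auto simp: B_def indicator_def)
  ultimately have "AE x in \<mu>. - (indicator B x * Re (f x)) = 0"
    using integral_nonneg_AE[OF nn] integral_nonneg_eq_0_iff_AE[OF i nn] by simp
  then show ?thesis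
    by (rule AE_mp) (auto intro!: AE_I2 simp: B_def indicator_def)
qed

lemma solves_invariant_imp_averaged:
  assumes K: "K \<subseteq> real_points V" and inv: "invariant_set G \<phi> K"
    and imp: "solves_invariant_moment_problem G n V \<phi> K N"
    and M: "M = quadratic_module_generated (coord_algebra n V) N"
  shows "solves_averaged_moment_problem G n V \<phi> K M"
  unfolding solves_averaged_moment_problem_def
proof (intro conjI allI impI)
  have N: "N \<subseteq> carrier (invariant_algebra G n V \<phi>)"
    using imp by (simp add: solves_invariant_moment_problem_def quadratic_module_def)
  then have Nc: "N \<subseteq> carrier (coord_algebra n V)" by (auto simp: invariant_algebra_simps)
  show "quadratic_module (coord_algebra n V) M"
    unfolding M by (rule quadratic_module_generated(1)[OF Nc])
  fix L assume L: "invariant_functional G n V \<phi> L"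
  have iff: "has_invariant_measure G n V \<phi> K L \<longleftrightarrow> (\<forall>f\<in>N. 0 \<le> L f)"
    if "invariant_functional G n V \<phi> L" for L
    using imp that by (simp add: solves_invariant_moment_problem_def)
  show "has_invariant_measure G n V \<phi> K L \<longleftrightarrow> (\<forall>f\<in>M. 0 \<le> L f)"
  proof
    assume "\<forall>f\<in>M. 0 \<le> L f"
    then show "has_invariant_measure G n V \<phi> K L"
      using iff[OF L] quadratic_module_generated(2)[OF Nc] M by blast
  next
    assume "has_invariant_measure G n V \<phi> K L"
    then obtain \<mu> where \<mu>: "measure_on n V K \<mu>" "invariant_measure G \<phi> \<mu>" "represents n V \<mu> L"
      unfolding has_invariant_measure_def by blast
    define Q where "Q = {f \<in> carrier (coord_algebra n V). AE x in \<mu>. 0 \<le> Re (f x)}"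
    have sp: "space \<mu> = K" using \<mu>(1) by (simp add: measure_on_def)
    have KV: "x \<in> V" if "x \<in> space \<mu>" for x using that K sp by (auto simp: real_points_def)
    have "quadratic_module (coord_algebra n V) Q"
      unfolding quadratic_module_def coord_algebra_simps
    proof (intro conjI ballI)
      show "Q \<subseteq> carrier (coord_algebra n V)" by (auto simp: Q_def)
      show "(\<lambda>x\<in>V. 1) \<in> Q"
        using coord_algebra_const[where V = V and c = 1 and n = n] KV by (auto simp: Q_def intro!: AE_I2)
      fix p q assume pq: "p \<in> Q" "q \<in> Q"
      then have "AE x in \<mu>. 0 \<le> Re (p x)" "AE x in \<mu>. 0 \<le> Re (q x)" by (auto simp: Q_def)
      then have "AE x in \<mu>. 0 \<le> Re ((\<lambda>x\<in>V. p x + q x) x)"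
        using AE_space by eventually_elim (auto simp: KV)
      then show "(\<lambda>x\<in>V. p x + q x) \<in> Q" using pq by (auto simp: Q_def intro: coord_algebra_add)
    next
      fix a p assume a: "a \<in> carrier (coord_algebra n V)" and p: "p \<in> Q"
      then have "AE x in \<mu>. 0 \<le> Re (p x)" by (auto simp: Q_def)
      then have "AE x in \<mu>. 0 \<le> Re ((\<lambda>x\<in>V. (\<lambda>x\<in>V. a x * a x) x * p x) x)"
        using AE_space
      proof eventually_elim
        case (elim x)
        then have "x \<in> real_points V" using K sp by auto
        then have "a x \<in> \<real>" using coord_algebra_real[OF a] by blast
        then obtain r where "a x = complex_of_real r" by (rule Reals_cases)
        then show ?case using elim KV by (simp add: mult_nonneg_nonneg)
      qed
      then show "(\<lambda>x\<in>V. (\<lambda>x\<in>V. a x * a x) x * p x) \<in> Q"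
        using a p unfolding Q_def by (intro CollectI conjI coord_algebra_mult) auto
    qed
    moreover have "N \<subseteq> Q"
    proof
      fix f assume f: "f \<in> N"
      have "AE x in \<mu>. 0 \<le> Re (f x)"
      proof (rule AE_nonneg_if_invariant_moments[OF K inv \<mu>(1,2)])
        show "0 \<le> L f" if "invariant_functional G n V \<phi> L" "has_invariant_measure G n V \<phi> K L" for L
          using iff[OF that(1)] that(2) f by blast
      qed (use f N in auto)
      then show "f \<in> Q" using f Nc by (auto simp: Q_def)
    qed
    ultimately have "M \<subseteq> Q" unfolding M by (rule quadratic_module_generated_least)
    show "\<forall>f\<in>M. 0 \<le> L f"
    proof
      fix f assume "f \<in> M"
      with \<open>M \<subseteq> Q\<close> have "f \<in> carrier (coord_algebra n V)" "AE x in \<mu>. 0 \<le> Re (f x)" by (auto simp: Q_def)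
      then show "0 \<le> L f" using \<mu>(3) integral_nonneg_AE by (simp add: represents_def)
    qed
  qed
qed

end

section \<open>The moment problem for all nonnegative functions on a closed set\<close>

lemma real_polys_sum:
  fixes m :: nat
  shows "(\<And>i. i < m \<Longrightarrow> f i \<in> real_polys n) \<Longrightarrow> (\<lambda>x. \<Sum>i<m. f i x) \<in> real_polys n"
proof (induction m)
  case 0
  show ?case using real_polys_const[of 0] by simp
next
  case (Suc m)
  then show ?case using real_polys_add[of "\<lambda>x. \<Sum>i<m. f i x" n "f m"] by simp
qed

text \<open>The sum of the squares of the coordinates is a proper function on the real points.  Since a functional
on the coordinate algebra need not come from one on functions on \<open>K\<close>, it first has to be seen
that positivity forces equal values at functions with the same restriction to \<open>K\<close>.\<close>

lemma haviland_variety: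
  assumes K: "K \<subseteq> real_points V" "closed K" and V: "V \<subseteq> affine_space n"
    and L: "linear_functional (coord_algebra n V) L"
    and pos: "\<And>f. f \<in> carrier (coord_algebra n V) \<Longrightarrow> (\<And>x. x \<in> K \<Longrightarrow> 0 \<le> Re (f x)) \<Longrightarrow> 0 \<le> L f"
  shows "\<exists>\<mu>. measure_on n V K \<mu> \<and> represents n V \<mu> L"
proof -
  let ?A = "carrier (coord_algebra n V)"
  have L_add: "L (\<lambda>x\<in>V. f x + g x) = L f + L g" if "f \<in> ?A" "g \<in> ?A" for f g
    using L that by (simp add: linear_functional_def coord_algebra_simps)
  have L_scale: "L (\<lambda>x\<in>V. complex_of_real c * f x) = c * L f" if "f \<in> ?A" for c f
    using L that by (simp add: linear_functional_def coord_algebra_simps)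
  have scale: "(\<lambda>x\<in>V. complex_of_real c * f x) \<in> ?A" if "f \<in> ?A" for c f
  proof -
    have "(\<lambda>x\<in>V. (\<lambda>x\<in>V. complex_of_real c) x * f x) \<in> ?A"
      using coord_algebra_mult[OF coord_algebra_const that] .
    then show ?thesis by (simp add: restrict_def cong: if_cong)
  qed
  have KV: "x \<in> V" if "x \<in> K" for x using that K by (auto simp: real_points_def)
  define rep where "rep p f \<longleftrightarrow> f \<in> ?A \<and> (\<forall>x\<in>K. p x = Re (f x))" for p f
  define P where "P = {p. \<exists>f. rep p f}"
  define L' where "L' p = L (SOME f. rep p f)" for p
  have L'_eq: "L' p = L f" if pf: "rep p f" for p f
  proof -
    define g where "g = (SOME f. rep p f)"
    have g: "rep p g" unfolding g_def using pf by (rule someI[where P = "rep p"])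
    have "L a \<le> L b" if "rep p a" "rep p b" for a b
    proof -
      have ab: "a \<in> ?A" "b \<in> ?A" "\<And>x. x \<in> K \<Longrightarrow> Re (a x) = Re (b x)" using that by (auto simp: rep_def)
      have "0 \<le> L (\<lambda>x\<in>V. b x + (\<lambda>x\<in>V. complex_of_real (-1) * a x) x)"
        using ab KV by (intro pos coord_algebra_add scale) auto
      also have "\<dots> = L b + (-1) * L a" using ab by (simp only: L_add L_scale scale)
      finally show ?thesis by simp
    qed
    then have "L f = L g" using pf g by (intro antisym) auto
    then show ?thesis by (simp add: L'_def g_def)
  qed
  have rep_add: "rep (\<lambda>x. p x + q x) (\<lambda>x\<in>V. f x + g x)" if "rep p f" "rep q g" for p q f g
    using that KV by (auto simp: rep_def coord_algebra_add)
  have rep_mult: "rep (\<lambda>x. p x * q x) (\<lambda>x\<in>V. f x * g x)" if "rep p f" "rep q g" for p q f g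
  proof -
    have "Re (f x * g x) = Re (f x) * Re (g x)" if "x \<in> K" for x
    proof -
      have "f x \<in> \<real>" using coord_algebra_real[of f n V x] \<open>rep p f\<close> K that by (auto simp: rep_def)
      then show ?thesis by (simp add: complex_is_Real_iff)
    qed
    then show ?thesis using that KV by (auto simp: rep_def coord_algebra_mult)
  qed
  have rep_const: "rep (\<lambda>_. c) (\<lambda>x\<in>V. complex_of_real c)" for c
    using KV by (auto simp: rep_def coord_algebra_const)
  have rep_scale: "rep (\<lambda>x. c * p x) (\<lambda>x\<in>V. complex_of_real c * f x)" if "rep p f" for c p f
    using that KV by (auto simp: rep_def scale)
  define q where "q x = Re (\<Sum>i<n. x i * x i)" for x :: "nat \<Rightarrow> complex"
  have qP: "q \<in> P"
  proof -
    have "(\<lambda>x. \<Sum>i<n. x i * x i) \<in> real_polys n"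
      by (rule real_polys_sum) (intro real_polys_mult real_polys_coord)
    from coord_algebra_carrierI[OF this, of V] show ?thesis
      unfolding P_def rep_def using KV by (intro CollectI exI[of _ "restrict (\<lambda>x. \<Sum>i<n. x i * x i) V"]) (auto simp: q_def)
  qed
  have comp: "compact {x \<in> K. q x \<le> R}" for R
  proof -
    define B where "B = (PiE UNIV (\<lambda>i. if i < n then cball 0 (1 + \<bar>R\<bar>) else {0 :: complex}) :: (nat \<Rightarrow> complex) set)"
    have "compactin (product_topology (\<lambda>_. euclidean) (UNIV :: nat set)) B"
      unfolding B_def by (simp add: compactin_PiE)
    then have "compact B" by (simp add: euclidean_product_topology)
    moreover have "closed (K \<inter> {x. q x \<le> R})"
      unfolding q_def using K(2)
      by (intro closed_Int closed_Collect_le continuous_intros continuous_on_product_then_coordinatewise[OF continuous_on_id]) auto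
    moreover have "K \<inter> {x. q x \<le> R} \<subseteq> B"
    proof
      fix x assume x: "x \<in> K \<inter> {x. q x \<le> R}"
      have re: "x i \<in> \<real>" for i using x K by (auto simp: real_points_def)
      have sq: "Re (x i * x i) = (Re (x i))\<^sup>2" for i
        using re[of i] by (simp add: complex_is_Real_iff power2_eq_square)
      have "x i \<in> (if i < n then cball 0 (1 + \<bar>R\<bar>) else {0})" for i
      proof (cases "i < n")
        case True
        have "(Re (x i))\<^sup>2 \<le> (\<Sum>i<n. (Re (x i))\<^sup>2)" by (rule member_le_sum) (use True in auto)
        also have "\<dots> = q x" unfolding q_def Re_sum sq ..
        also have "\<dots> \<le> \<bar>R\<bar>" using x by auto
        also have "\<dots> \<le> (1 + \<bar>R\<bar>)\<^sup>2" by (simp add: power2_eq_square algebra_simps)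
        finally have "\<bar>Re (x i)\<bar> \<le> 1 + \<bar>R\<bar>" by (simp add: abs_le_square_iff[symmetric])
        moreover have "norm (x i) = \<bar>Re (x i)\<bar>" using re[of i] by (simp add: in_Reals_norm)
        ultimately show ?thesis using True by simp
      next
        case False
        then show ?thesis using KV[of x] V x by (auto simp: affine_space_def)
      qed
      then show "x \<in> B" by (auto simp: B_def)
    qed
    ultimately have "compact (B \<inter> (K \<inter> {x. q x \<le> R}))" by (intro compact_Int_closed)
    moreover have "B \<inter> (K \<inter> {x. q x \<le> R}) = {x \<in> K. q x \<le> R}"
      using \<open>K \<inter> {x. q x \<le> R} \<subseteq> B\<close> by auto
    ultimately show ?thesis by simp
  qed
  obtain \<mu> where \<mu>: "space \<mu> = K" "sets \<mu> = sets (restrict_space borel K)"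
    "\<And>p. p \<in> P \<Longrightarrow> integrable \<mu> p" "\<And>p. p \<in> P \<Longrightarrow> (\<integral>x. p x \<partial>\<mu>) = L' p"
  proof (rule haviland[of P K q L'])
    show "(\<lambda>_. c) \<in> P" for c using rep_const by (auto simp: P_def)
    show "(\<lambda>x. p x + q x) \<in> P" if "p \<in> P" "q \<in> P" for p q using rep_add that unfolding P_def by blast
    show "(\<lambda>x. p x * q x) \<in> P" if "p \<in> P" "q \<in> P" for p q using rep_mult that unfolding P_def by blast
    show "L' (\<lambda>x. p x + q x) = L' p + L' q" if pq: "p \<in> P" "q \<in> P" for p q
    proof -
      obtain f g where fg: "rep p f" "rep q g" using pq by (auto simp: P_def)
      then have "L (\<lambda>x\<in>V. f x + g x) = L f + L g" by (intro L_add) (simp_all add: rep_def)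
      then show ?thesis by (simp only: L'_eq[OF rep_add[OF fg]] L'_eq[OF fg(1)] L'_eq[OF fg(2)])
    qed
    show "L' (\<lambda>x. c * p x) = c * L' p" if p: "p \<in> P" for c p
    proof -
      obtain f where f: "rep p f" using p by (auto simp: P_def)
      then have "L (\<lambda>x\<in>V. complex_of_real c * f x) = c * L f" by (intro L_scale) (simp add: rep_def)
      then show ?thesis by (simp only: L'_eq[OF rep_scale[OF f]] L'_eq[OF f])
    qed
    show "0 \<le> L' p" if p: "p \<in> P" "\<And>x. x \<in> K \<Longrightarrow> 0 \<le> p x" for p
    proof -
      obtain f where "rep p f" using p(1) by (auto simp: P_def)
      then show ?thesis using L'_eq[of p f] pos[of f] p(2) by (auto simp: rep_def)
    qed
    show "continuous_on K p" if p: "p \<in> P" for p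
    proof -
      obtain f where f: "rep p f" using p by (auto simp: P_def)
      then have "continuous_on K (\<lambda>x. Re (f x))"
        using coord_algebra_continuous[of f n V K] KV by (intro continuous_intros) (auto simp: rep_def)
      then show ?thesis using f by (subst continuous_on_cong[OF refl, where g = "\<lambda>x. Re (f x)"]) (auto simp: rep_def)
    qed
  qed (use qP comp in auto)
  have "rep (\<lambda>x. Re (f x)) f" if "f \<in> ?A" for f using that by (simp add: rep_def)
  then have "measure_on n V K \<mu>" "represents n V \<mu> L"
    using \<mu> L'_eq unfolding measure_on_def represents_def P_def by auto metis+
  then show ?thesis by blast
qed

lemma closed_affine_variety:
  assumes "affine_variety n V" shows "closed V"
proof -
  obtain S where S: "S \<subseteq> real_polys n" "V = {x \<in> affine_space n. \<forall>p\<in>S. p x = 0}"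
    using assms unfolding affine_variety_def by blast
  have coord: "continuous_on UNIV (\<lambda>x. x i)" for i :: nat
    using continuous_on_product_coordinates[of i] .
  have "closed {x :: nat \<Rightarrow> complex. x i = 0}" for i :: nat
    by (intro closed_Collect_eq coord continuous_on_const)
  moreover have "closed {x. p x = 0}" if "p \<in> S" for p
    using S(1) that by (intro closed_Collect_eq real_polys_continuous[of p n] continuous_on_const) auto
  ultimately have "closed ((\<Inter>i\<in>{n..}. {x :: nat \<Rightarrow> complex. x i = 0}) \<inter> (\<Inter>p\<in>S. {x. p x = 0}))"
    by (intro closed_Int closed_INT) auto
  moreover have "(\<Inter>i\<in>{n..}. {x :: nat \<Rightarrow> complex. x i = 0}) \<inter> (\<Inter>p\<in>S. {x. p x = 0}) = V"
    by (auto simp: S(2) affine_space_def)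
  ultimately show ?thesis by simp
qed

lemma closed_real_points:
  assumes "closed V" shows "closed (real_points V)"
proof -
  have "closed {x :: nat \<Rightarrow> complex. Im (x i) = 0}" for i :: nat
    by (intro closed_Collect_eq continuous_intros continuous_on_product_then_coordinatewise[OF continuous_on_id])
  then have "closed (V \<inter> (\<Inter>i. {x. Im (x i) = 0}))" using assms by (intro closed_Int closed_INT) auto
  moreover have "V \<inter> (\<Inter>i. {x. Im (x i) = 0}) = real_points V"
    by (auto simp: real_points_def complex_is_Real_iff)
  ultimately show ?thesis by simp
qed

context compact_algebraic_action
begin

definition nonneg_invariants :: "(nat \<Rightarrow> complex) set \<Rightarrow> ((nat \<Rightarrow> complex) \<Rightarrow> complex) set" where
  "nonneg_invariants K = {f \<in> carrier (invariant_algebra G n V \<phi>). \<forall>x\<in>K. 0 \<le> Re (f x)}"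

lemma quadratic_module_nonneg_invariants:
  assumes K: "K \<subseteq> real_points V"
  shows "quadratic_module (invariant_algebra G n V \<phi>) (nonneg_invariants K)"
proof -
  let ?I = "carrier (invariant_algebra G n V \<phi>)"
  have KV: "x \<in> V" if "x \<in> K" for x using that K by (auto simp: real_points_def)
  have ptw: "f (\<phi> g x) = f x" if "f \<in> ?I" "g \<in> GR" "x \<in> V" for f g x
    using that by (auto simp: invariant_algebra_simps compose_def restrict_def fun_eq_iff) metis
  have I: "(\<lambda>x\<in>V. h x) \<in> ?I" if "(\<lambda>x\<in>V. h x) \<in> carrier (coord_algebra n V)"
    "\<And>g x. g \<in> GR \<Longrightarrow> x \<in> V \<Longrightarrow> h (\<phi> g x) = h x" for h
    using that action_closed GR_sub by (auto simp: invariant_algebra_simps compose_def fun_eq_iff)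
  have I_add: "(\<lambda>x\<in>V. f x + g x) \<in> ?I" if "f \<in> ?I" "g \<in> ?I" for f g
    using that by (intro I coord_algebra_add) (auto simp: ptw invariant_algebra_simps(1))
  have I_mult: "(\<lambda>x\<in>V. f x * g x) \<in> ?I" if "f \<in> ?I" "g \<in> ?I" for f g
    using that by (intro I coord_algebra_mult) (auto simp: ptw invariant_algebra_simps(1))
  have I_one: "(\<lambda>x\<in>V. 1) \<in> ?I"
    using coord_algebra_const[where c = 1] by (intro I) auto
  show ?thesis
    unfolding quadratic_module_def invariant_algebra_simps(2-4)
  proof (intro conjI ballI)
    show "nonneg_invariants K \<subseteq> ?I" by (auto simp: nonneg_invariants_def)
    show "(\<lambda>x\<in>V. 1) \<in> nonneg_invariants K"
      using I_one by (auto simp: nonneg_invariants_def KV)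
    show "(\<lambda>x\<in>V. p x + q x) \<in> nonneg_invariants K" if "p \<in> nonneg_invariants K" "q \<in> nonneg_invariants K" for p q
      using that I_add by (auto simp: nonneg_invariants_def KV)
    fix a p assume a: "a \<in> ?I" and p: "p \<in> nonneg_invariants K"
    have "0 \<le> Re (a x * a x * p x)" if "x \<in> K" for x
    proof -
      have "a x \<in> \<real>" using a K that by (intro coord_algebra_real[of a n V]) (auto simp: invariant_algebra_simps(1))
      then obtain r where "a x = complex_of_real r" by (rule Reals_cases)
      moreover have "0 \<le> Re (p x)" using p that by (auto simp: nonneg_invariants_def)
      ultimately show ?thesis by (simp add: mult_nonneg_nonneg)
    qed
    then show "(\<lambda>x\<in>V. (\<lambda>x\<in>V. a x * a x) x * p x) \<in> nonneg_invariants K"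
      using a p I_mult[OF I_mult[OF a a], of p] by (auto simp: nonneg_invariants_def KV)
  qed
qed

end

section \<open>Sums of squares and a rapidly growing moment sequence\<close>

text \<open>A root of a nonnegative polynomial has even multiplicity; this lemma and its mirror image
compare the signs of a cofactor on both sides of the root.\<close>

lemma poly_nonneg_at:
  fixes q :: "real poly"
  assumes "\<And>x. x > a \<Longrightarrow> 0 \<le> poly q x" shows "0 \<le> poly q a"
proof -
  have "(poly q \<longlongrightarrow> poly q a) (at_right a)"
    using poly_isCont[of a q] unfolding isCont_def by (rule tendsto_within_subset) simp
  moreover have "eventually (\<lambda>x. 0 \<le> poly q x) (at_right a)"
    using eventually_at_right_less by (rule eventually_mono) (rule assms)
  ultimately show ?thesis by (rule tendsto_lowerbound) simp
qed

lemma poly_nonpos_at: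
  fixes q :: "real poly"
  assumes "\<And>x. x < a \<Longrightarrow> poly q x \<le> 0" shows "poly q a \<le> 0"
proof -
  have "(poly q \<longlongrightarrow> poly q a) (at_left a)"
    using poly_isCont[of a q] unfolding isCont_def by (rule tendsto_within_subset) simp
  moreover have "eventually (\<lambda>x. poly q x \<le> 0) (at_left a)"
    using eventually_at_left_real[of "a - 1" a] by (auto elim!: eventually_mono intro: assms)
  ultimately show ?thesis by (rule tendsto_upperbound) simp
qed

lemma poly_map_of_real: "poly (map_poly of_real p) (of_real x) = (of_real (poly p x) :: complex)"
  by (induction p) (auto simp: map_poly_pCons)

lemma map_of_real_poly_add: "map_poly complex_of_real (p + q) = map_poly complex_of_real p + map_poly complex_of_real q"
  by (rule poly_eqI) (simp add: coeff_map_poly)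

lemma map_of_real_poly_mult: "map_poly complex_of_real (p * q) = map_poly complex_of_real p * map_poly complex_of_real q"
  by (rule poly_eqI) (simp add: coeff_map_poly coeff_mult)

text \<open>A complex root gives either a squared real linear factor or a real quadratic factor
\<open>(x - a)\<^sup>2 + b\<^sup>2\<close>, and a product of two sums of two squares is again a sum of two squares.\<close>

lemma nonneg_poly_sum_two_squares:
  fixes p :: "real poly"
  assumes "\<And>x. 0 \<le> poly p x"
  shows "\<exists>r s. p = r * r + s * s"
  using assms
proof (induction "degree p" arbitrary: p rule: less_induct)
  case less
  show ?case
  proof (cases "degree p = 0")
    case True
    then obtain c where c: "p = [:c:]" by (metis degree_eq_zeroE)
    then have "0 \<le> c" using less.prems[of 0] by simp
    then have "p = [:sqrt c:] * [:sqrt c:] + 0 * 0" using c by simp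
    then show ?thesis by blast
  next
    case False
    let ?P = "map_poly complex_of_real p"
    have dP: "degree ?P = degree p" by (rule degree_map_poly) simp
    have "\<not> constant (poly ?P)" using False by (simp add: constant_degree dP)
    then obtain z where z: "poly ?P z = 0" using fundamental_theorem_of_algebra by blast
    show ?thesis
    proof (cases "z \<in> \<real>")
      case True
      then obtain a where a: "z = complex_of_real a" by (rule Reals_cases)
      then have "poly p a = 0" using z by (simp add: poly_map_of_real)
      then obtain q where q: "p = [:-a, 1:] * q" by (metis poly_eq_0_iff_dvd dvdE)
      have pq: "poly p x = (x - a) * poly q x" for x by (simp add: q algebra_simps)
      have "0 \<le> poly q a"
      proof (rule poly_nonneg_at)
        fix x assume "a < x"
        then show "0 \<le> poly q x" using less.prems[of x] pq[of x] by (simp add: zero_le_mult_iff)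
      qed
      moreover have "poly q a \<le> 0"
      proof (rule poly_nonpos_at)
        fix x assume "x < a"
        then show "poly q x \<le> 0" using less.prems[of x] pq[of x] by (auto simp: zero_le_mult_iff)
      qed
      ultimately have "poly q a = 0" by simp
      then obtain t where t: "q = [:-a, 1:] * t" by (metis poly_eq_0_iff_dvd dvdE)
      have pt: "poly p x = (x - a) * (x - a) * poly t x" for x by (simp add: pq t algebra_simps)
      have off: "0 \<le> poly t x" if "x \<noteq> a" for x
      proof -
        have "0 < (x - a) * (x - a)" using that by (simp add: zero_less_mult_iff) linarith
        then show ?thesis using less.prems[of x] unfolding pt by (simp add: zero_le_mult_iff)
      qed
      have "0 \<le> poly t x" for x
        using off by (cases "x = a") (auto intro: poly_nonneg_at)
      moreover have "degree t < degree p"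
      proof -
        have "q \<noteq> 0" using \<open>degree p \<noteq> 0\<close> q by auto
        moreover have "t \<noteq> 0" using calculation t by auto
        moreover have lin: "degree ([:-a, 1:] * f) = Suc (degree f)" if "f \<noteq> 0" for f :: "real poly"
          using that by (simp add: degree_mult_eq del: mult_pCons_left)
        ultimately have "degree q = Suc (degree t)" "degree p = Suc (degree q)"
          using lin[of t] lin[of q] q t by (simp_all only:)
        then show ?thesis by simp
      qed
      ultimately obtain r s where "t = r * r + s * s" using less.hyps by blast
      then have "p = ([:-a, 1:] * r) * ([:-a, 1:] * r) + ([:-a, 1:] * s) * ([:-a, 1:] * s)"
        unfolding q t by (simp only: algebra_simps)
      then show ?thesis by blast
    next
      case False
      define a b where "a = Re z" and "b = Im z"
      have "b \<noteq> 0" using False by (simp add: b_def complex_is_Real_iff)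
      define c where "c = [:a\<^sup>2 + b\<^sup>2, - (2 * a), 1:]"
      have degc: "degree c = 2" and "c \<noteq> 0" by (simp_all add: c_def)
      have cz: "poly (map_poly complex_of_real c) z = 0"
        by (simp add: c_def map_poly_pCons complex_eq_iff a_def b_def power2_eq_square algebra_simps)
      define q r where "q = p div c" and "r = p mod c"
      have pqr: "p = c * q + r" by (simp add: q_def r_def)
      have "degree r < 2"
        using degree_mod_less'[OF \<open>c \<noteq> 0\<close>, of p] degc by (cases "r = 0") (auto simp: r_def)
      then have r: "r = [:coeff r 0, coeff r 1:]"
        by (intro poly_eqI) (auto simp: coeff_pCons coeff_eq_0 split: nat.splits)
      have "poly (map_poly complex_of_real r) z = 0"
        using z cz unfolding pqr map_of_real_poly_add map_of_real_poly_mult by simp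
      then have rz: "complex_of_real (coeff r 0) + z * complex_of_real (coeff r 1) = 0"
        by (subst (asm) r) (simp add: map_poly_pCons)
      have "coeff r 1 = 0"
        using arg_cong[OF rz, of Im] \<open>b \<noteq> 0\<close> by (simp add: b_def)
      moreover have "coeff r 0 = 0" using rz calculation by simp
      ultimately have "r = 0" using r by simp
      then have p: "p = c * q" using pqr by simp
      have c_eq: "c = [:-a, 1:] * [:-a, 1:] + [:b:] * [:b:]"
        by (simp add: c_def power2_eq_square)
      have c_pos: "0 < poly c x" for x
      proof -
        have "poly c x = (x - a) * (x - a) + b * b" by (simp add: c_eq algebra_simps)
        moreover have "0 < b * b" using \<open>b \<noteq> 0\<close> by (metis not_real_square_gt_zero)
        ultimately show ?thesis using zero_le_square[of "x - a"] by linarith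
      qed
      have "0 \<le> poly q x" for x
        using less.prems[of x] c_pos[of x] unfolding p by (simp add: zero_le_mult_iff)
      moreover have "degree q < degree p"
      proof -
        have "q \<noteq> 0" using \<open>degree p \<noteq> 0\<close> p by auto
        then have "degree p = 2 + degree q" unfolding p using degc by (subst degree_mult_eq) auto
        then show ?thesis by simp
      qed
      ultimately obtain t s where ts: "q = t * t + s * s" using less.hyps by blast
      have "p = ([:-a, 1:] * t - [:b:] * s) * ([:-a, 1:] * t - [:b:] * s)
          + ([:-a, 1:] * s + [:b:] * t) * ([:-a, 1:] * s + [:b:] * t)"
        unfolding p ts c_eq by (simp only: algebra_simps)
      then show ?thesis by blast
    qed
  qed
qed

text \<open>These grow so fast that the Hankel matrix is dominated by its diagonal after rescaling: since
\<open>(i + j)\<^sup>2 + (i - j)\<^sup>2 = 2 i\<^sup>2 + 2 j\<^sup>2\<close>, a nonzero entry at \<open>(i, j)\<close> is the product of two factors depending on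
\<open>i\<close> and \<open>j\<close> alone with \<open>2\<^bsup>-(i-j)\<^sup>2\<^esup>\<close>.\<close>

definition moment :: "nat \<Rightarrow> real" where "moment n = (if even n then 2 ^ (n * n) else 0)"

definition moments :: "real poly \<Rightarrow> real" where
  "moments p = (\<Sum>i\<le>degree p. coeff p i * moment i)"

lemma moments_bound: "degree p \<le> d \<Longrightarrow> moments p = (\<Sum>i\<le>d. coeff p i * moment i)"
  unfolding moments_def by (rule sum.mono_neutral_left) (auto simp: coeff_eq_0)

lemma moments_add: "moments (p + q) = moments p + moments q"
proof -
  let ?d = "max (degree p) (degree q)"
  have "moments p = (\<Sum>i\<le>?d. coeff p i * moment i)" "moments q = (\<Sum>i\<le>?d. coeff q i * moment i)"
    by (rule moments_bound; simp)+
  moreover have "moments (p + q) = (\<Sum>i\<le>?d. coeff (p + q) i * moment i)"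
    by (rule moments_bound[OF degree_add_le_max])
  ultimately show ?thesis by (simp only: coeff_add distrib_right sum.distrib)
qed

lemma moments_smult: "moments (Polynomial.smult c p) = c * moments p"
  using moments_bound[OF degree_smult_le[of c p]] by (simp add: moments_def sum_distrib_left mult.assoc)

lemma moments_0: "moments 0 = 0" by (simp add: moments_def)

lemma moments_sum: "moments (\<Sum>i\<in>I. f i) = (\<Sum>i\<in>I. moments (f i))"
  by (induction I rule: infinite_finite_induct) (auto simp: moments_add moments_0)

lemma moments_monom: "moments (monom c n) = c * moment n"
proof -
  have "moments (monom c n) = (\<Sum>i\<le>n. coeff (monom c n) i * moment i)"
    by (rule moments_bound[OF degree_monom_le])
  also have "\<dots> = (\<Sum>i\<le>n. if i = n then c * moment n else 0)"
    by (rule sum.cong) auto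
  finally show ?thesis by simp
qed

lemma moments_square_shift:
  "moments (monom 1 (2 * s) * (w * w)) =
     (\<Sum>i\<le>degree w. \<Sum>j\<le>degree w. coeff w i * coeff w j * moment ((i + s) + (j + s)))"
proof -
  have term_eq: "monom 1 (2 * s) * (monom a i * monom b j) = monom (a * b) ((i + s) + (j + s))"
    for a b :: real and i j
  proof -
    have "2 * s + (i + j) = (i + s) + (j + s)" by simp
    then show ?thesis by (simp only: mult_monom mult_1_left)
  qed
  have "monom 1 (2 * s) * (w * w) =
      monom 1 (2 * s) * ((\<Sum>i\<le>degree w. monom (coeff w i) i) * (\<Sum>i\<le>degree w. monom (coeff w i) i))"
    by (simp add: poly_as_sum_of_monoms)
  also have "\<dots> = (\<Sum>i\<le>degree w. \<Sum>j\<le>degree w. monom (coeff w i * coeff w j) ((i + s) + (j + s)))"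
    by (subst sum_product) (simp only: sum_distrib_left term_eq)
  finally show ?thesis by (simp add: moments_sum moments_monom)
qed

text \<open>An upper bound for the rescaled off-diagonal Hankel entries: they vanish at odd distance, and
\<open>2\<^bsup>-d\<^sup>2\<^esup> \<le> 4\<^bsup>-d\<^esup>\<close> for \<open>d \<ge> 2\<close>.\<close>

definition gap_weight :: "nat \<Rightarrow> nat \<Rightarrow> real" where
  "gap_weight i j = (if i = j then 0 else (1 / 4) ^ (if i \<le> j then j - i else i - j))"

lemma moment_factor:
  "\<bar>moment (i + j)\<bar> \<le> 4 ^ (i * i) * 4 ^ (j * j) * gap_weight i j" if "i \<noteq> j"
proof (cases "even (i + j)")
  case True
  define d where "d = (if i \<le> j then j - i else i - j)"
  have "(i + j) * (i + j) + d * d = 2 * (i * i) + 2 * (j * j)"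
  proof (cases "i \<le> j")
    case True
    then obtain e where "j = i + e" using le_Suc_ex by blast
    then show ?thesis by (simp add: d_def algebra_simps)
  next
    case False
    then obtain e where "i = j + e" using le_Suc_ex by (metis nat_le_linear)
    then show ?thesis using False by (simp add: d_def algebra_simps)
  qed
  then have "(2::real) ^ ((i + j) * (i + j)) * 2 ^ (d * d) = 2 ^ (2 * (i * i)) * 2 ^ (2 * (j * j))"
    by (metis power_add)
  then have eq: "(2::real) ^ ((i + j) * (i + j)) * 2 ^ (d * d) = 4 ^ (i * i) * 4 ^ (j * j)"
    by (simp add: power_mult)
  have "even d" "d \<noteq> 0" using True that by (auto simp: d_def)
  then have "2 \<le> d" by (cases d rule: nat.exhaust) (auto elim: oddE)
  then have "(2::real) ^ (2 * d) \<le> 2 ^ (d * d)" by (intro power_increasing) auto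
  then have "(2::real) ^ ((i + j) * (i + j)) * 4 ^ d \<le> 4 ^ (i * i) * 4 ^ (j * j)"
    unfolding eq[symmetric] by (simp add: power_mult)
  then show ?thesis using True that
    by (simp add: moment_def gap_weight_def d_def[symmetric] power_divide field_simps)
qed (auto simp: moment_def gap_weight_def)

lemma gap_weight_row: "(\<Sum>j\<le>d. gap_weight i j) \<le> 2 / 3"
proof -
  have low: "(\<Sum>j<i. (1 / 4 :: real) ^ (i - j)) \<le> 1 / 3" for i
  proof (induction i)
    case (Suc i)
    have "(\<Sum>j<Suc i. (1 / 4 :: real) ^ (Suc i - j)) = (1 / 4) * (\<Sum>j<i. (1 / 4) ^ (i - j)) + 1 / 4"
      by (simp add: sum_distrib_left Suc_diff_le)
    then show ?case using Suc by simp
  qed simp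
  have up: "(\<Sum>j<n. (1 / 4 :: real) ^ Suc j) \<le> 1 / 3" for n
  proof -
    have "(\<Sum>j<n. (1 / 4 :: real) ^ Suc j) = (1 - (1/4) ^ n) / 3"
    proof (induction n)
      case (Suc n)
      then show ?case by (simp only: sum.lessThan_Suc power_Suc) argo
    qed simp
    then show ?thesis by simp
  qed
  have "(\<Sum>j\<le>d. gap_weight i j) \<le> (\<Sum>j\<in>{..<i} \<union> {i} \<union> {i+1..<i+1+d}. gap_weight i j)"
    by (rule sum_mono2) (auto simp: gap_weight_def)
  also have "\<dots> = (\<Sum>j<i. gap_weight i j) + gap_weight i i + (\<Sum>j=i+1..<i+1+d. gap_weight i j)"
    by (subst sum.union_disjoint; (subst sum.union_disjoint)?) auto
  also have "(\<Sum>j<i. gap_weight i j) = (\<Sum>j<i. (1 / 4) ^ (i - j))"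
    by (rule sum.cong) (auto simp: gap_weight_def)
  also have "(\<Sum>j=i+1..<i+1+d. gap_weight i j) = (\<Sum>j<d. (1 / 4) ^ Suc j)"
    by (rule sum.reindex_bij_witness[of _ "\<lambda>j. j + (i + 1)" "\<lambda>j. j - (i + 1)"])
       (auto simp: gap_weight_def Suc_diff_Suc simp del: power_Suc)
  finally show ?thesis using low[of i] up[of d] by (simp add: gap_weight_def)
qed

text \<open>Diagonal dominance: the off-diagonal entries of a row of the rescaled Hankel matrix add up to at most
\<open>2/3\<close>, so the quadratic form is at least a third of the sum of squares, of which one term is kept.
The shift \<open>s\<close> is \<open>0\<close> for squares of functions of \<open>x\<close> and \<open>2\<close> for squares of multiples of \<open>y\<close>,
because \<open>y\<^sup>2 = x\<^sup>4\<close>.\<close>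

lemma moments_square_ge: "(4 ^ (s * s) * coeff w 0)\<^sup>2 / 3 \<le> moments (monom 1 (2 * s) * (w * w))"
proof -
  define d where "d = degree w"
  define y where "y i = coeff w i * 4 ^ ((i + s) * (i + s))" for i
  have gs: "gap_weight (i + s) (j + s) = gap_weight i j" for i j by (auto simp: gap_weight_def)
  have diag: "coeff w i * coeff w i * moment ((i + s) + (i + s)) = (y i)\<^sup>2" for i
  proof -
    have "((i + s) + (i + s)) * ((i + s) + (i + s)) = 2 * ((i + s) * (i + s) + (i + s) * (i + s))"
      by (simp add: algebra_simps)
    moreover have "(2::real) ^ (2 * (m + m)) = 4 ^ m * 4 ^ m" for m
      by (simp only: power_mult power_add mult_2) (simp add: power_mult_distrib[symmetric])
    ultimately have "moment ((i + s) + (i + s)) = 4 ^ ((i + s) * (i + s)) * 4 ^ ((i + s) * (i + s))"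
      by (simp only: moment_def) simp
    then show ?thesis by (simp add: y_def power2_eq_square)
  qed
  have off: "- (((y i)\<^sup>2 + (y j)\<^sup>2) / 2 * gap_weight i j) \<le> coeff w i * coeff w j * moment ((i + s) + (j + s))"
    if "i \<noteq> j" for i j
  proof -
    have g0: "0 \<le> gap_weight i j" by (simp add: gap_weight_def)
    have "\<bar>coeff w i * coeff w j * moment ((i + s) + (j + s))\<bar>
        \<le> \<bar>coeff w i * coeff w j\<bar> * (4 ^ ((i + s) * (i + s)) * 4 ^ ((j + s) * (j + s)) * gap_weight i j)"
      using moment_factor[of "i + s" "j + s"] that unfolding gs by (simp add: abs_mult mult_left_mono)
    also have "\<dots> = \<bar>y i\<bar> * \<bar>y j\<bar> * gap_weight i j"
      by (simp add: y_def abs_mult)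
    also have "\<dots> \<le> ((y i)\<^sup>2 + (y j)\<^sup>2) / 2 * gap_weight i j"
      using zero_le_power2[of "\<bar>y i\<bar> - \<bar>y j\<bar>"]
      by (intro mult_right_mono g0) (simp add: power2_diff)
    finally show ?thesis by (simp only: abs_le_iff minus_le_iff)
  qed
  have all: "(if i = j then (y i)\<^sup>2 else 0) - (y i)\<^sup>2 / 2 * gap_weight i j - (y j)\<^sup>2 / 2 * gap_weight i j
      \<le> coeff w i * coeff w j * moment ((i + s) + (j + s))" for i j
    using off[of i j] diag[of i] by (cases "i = j") (auto simp: gap_weight_def algebra_simps add_divide_distrib)
  have sym: "gap_weight i j = gap_weight j i" for i j by (auto simp: gap_weight_def)
  have row: "(\<Sum>i\<le>d. (y i)\<^sup>2 / 2 * (\<Sum>j\<le>d. gap_weight i j)) \<le> (\<Sum>i\<le>d. (y i)\<^sup>2) / 3"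
  proof -
    have "(\<Sum>i\<le>d. (y i)\<^sup>2 / 2 * (\<Sum>j\<le>d. gap_weight i j)) \<le> (\<Sum>i\<le>d. (y i)\<^sup>2 / 2 * (2 / 3))"
      by (intro sum_mono mult_left_mono gap_weight_row) auto
    also have "\<dots> = (\<Sum>i\<le>d. (y i)\<^sup>2) / 3" by (simp add: sum_divide_distrib)
    finally show ?thesis .
  qed
  have "(4 ^ (s * s) * coeff w 0)\<^sup>2 = (y 0)\<^sup>2" by (simp add: y_def mult.commute)
  also have "\<dots> \<le> (\<Sum>i\<le>d. (y i)\<^sup>2)" by (rule member_le_sum) auto
  finally have "(4 ^ (s * s) * coeff w 0)\<^sup>2 / 3 \<le> (\<Sum>i\<le>d. (y i)\<^sup>2) - (\<Sum>i\<le>d. (y i)\<^sup>2) / 3 - (\<Sum>i\<le>d. (y i)\<^sup>2) / 3"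
    by simp
  also have "\<dots> \<le> (\<Sum>i\<le>d. (y i)\<^sup>2) - (\<Sum>i\<le>d. (y i)\<^sup>2 / 2 * (\<Sum>j\<le>d. gap_weight i j))
      - (\<Sum>j\<le>d. (y j)\<^sup>2 / 2 * (\<Sum>i\<le>d. gap_weight j i))"
    using row by linarith
  also have "\<dots> = (\<Sum>i\<le>d. \<Sum>j\<le>d. (if i = j then (y i)\<^sup>2 else 0) - (y i)\<^sup>2 / 2 * gap_weight i j - (y j)\<^sup>2 / 2 * gap_weight i j)"
  proof -
    have "(\<Sum>j\<le>d. (y j)\<^sup>2 / 2 * (\<Sum>i\<le>d. gap_weight j i)) = (\<Sum>i\<le>d. \<Sum>j\<le>d. (y j)\<^sup>2 / 2 * gap_weight i j)"
      unfolding sum_distrib_left by (subst sum.swap) (simp add: sym)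
    then show ?thesis by (simp add: sum_subtractf sum_distrib_left)
  qed
  also have "\<dots> \<le> (\<Sum>i\<le>d. \<Sum>j\<le>d. coeff w i * coeff w j * moment ((i + s) + (j + s)))"
    by (intro sum_mono all)
  also have "\<dots> = moments (monom 1 (2 * s) * (w * w))" by (simp add: moments_square_shift d_def)
  finally show ?thesis .
qed

text \<open>The value at the function \<open>u(x) + v(x) y\<close> on the curve \<open>y\<^sup>2 = x\<^sup>4\<close>.  The factor \<open>64\<close> has to exceed
\<open>moment 2 = 16\<close>, so that the value at \<open>x\<^sup>2 + y\<close> is negative, and must not exceed \<open>256/3\<close>, the bound that the
lower estimates for squares allow.\<close>

definition curve_functional :: "real poly \<Rightarrow> real poly \<Rightarrow> real" where
  "curve_functional u v = moments u - 64 * coeff v 0"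

text \<open>The arguments are the components of \<open>(u + v y)\<^sup>2\<close>.  The mixed term is controlled by the
inequality of arithmetic and geometric means from the two lower bounds with shifts \<open>0\<close> and \<open>2\<close>.\<close>

lemma curve_functional_square:
  "0 \<le> curve_functional (u * u + monom 1 4 * (v * v)) (2 * (u * v))"
proof -
  define a b where "a = coeff u 0" and "b = 256 * coeff v 0"
  have "a\<^sup>2 / 3 \<le> moments (u * u)"
    using moments_square_ge[of 0 u] by (simp add: a_def)
  moreover have "b\<^sup>2 / 3 \<le> moments (monom 1 4 * (v * v))"
    using moments_square_ge[of 2 v] by (simp add: b_def)
  moreover have "coeff (2 * (u * v)) 0 = 2 * (coeff u 0 * coeff v 0)"
    by (simp only: mult_2 coeff_add coeff_mult) simp
  then have "64 * coeff (2 * (u * v)) 0 = a * b / 2" by (simp add: a_def b_def)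
  moreover have "a * b / 2 \<le> a\<^sup>2 / 3 + b\<^sup>2 / 3"
    using sum_squares_bound[of a b] zero_le_power2[of a] zero_le_power2[of b] by linarith
  ultimately show ?thesis unfolding curve_functional_def moments_add by linarith
qed

section \<open>Two tangent parabolas with a reflection\<close>

text \<open>The group of order two is the zero set of \<open>x\<^sup>2 - 1\<close> on the affine line.\<close>

definition sign_point :: "complex \<Rightarrow> nat \<Rightarrow> complex" where
  "sign_point c = (\<lambda>i. if i = 0 then c else 0)"

definition sign_group :: "(nat \<Rightarrow> complex) monoid" where
  "sign_group = \<lparr>carrier = {sign_point 1, sign_point (-1)}, monoid.mult = (\<lambda>g h i. g i * h i), one = sign_point 1\<rparr>"

text \<open>The union of the parabolas \<open>y = x\<^sup>2\<close> and \<open>y = -x\<^sup>2\<close>, which touch at the origin.\<close>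

definition parabolas :: "(nat \<Rightarrow> complex) set" where
  "parabolas = {z \<in> affine_space 2. z 1 * z 1 = z 0 * z 0 * z 0 * z 0}"

definition flip :: "(nat \<Rightarrow> complex) \<Rightarrow> (nat \<Rightarrow> complex) \<Rightarrow> nat \<Rightarrow> complex" where
  "flip g = (\<lambda>z\<in>parabolas. z(1 := g 0 * z 1))"

lemma sign_group_carrier: "g \<in> carrier sign_group \<longleftrightarrow> g = sign_point 1 \<or> g = sign_point (-1)"
  by (simp add: sign_group_def)

lemma sign_mult: "sign_point a \<otimes>\<^bsub>sign_group\<^esub> sign_point b = sign_point (a * b)"
  by (auto simp: sign_group_def sign_point_def)

lemma sign_one: "\<one>\<^bsub>sign_group\<^esub> = sign_point 1"
  by (simp add: sign_group_def)

lemma group_sign_group: "group sign_group"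
proof (rule groupI)
  fix x assume "x \<in> carrier sign_group"
  then show "\<exists>y\<in>carrier sign_group. y \<otimes>\<^bsub>sign_group\<^esub> x = \<one>\<^bsub>sign_group\<^esub>"
    by (intro bexI[of _ x]) (auto simp: sign_group_carrier sign_mult sign_one)
qed (auto simp: sign_group_carrier sign_mult sign_one)

lemma sign_inv: "g \<in> carrier sign_group \<Longrightarrow> inv\<^bsub>sign_group\<^esub> g = g"
  by (rule group.inv_equality[OF group_sign_group]) (auto simp: sign_group_carrier sign_mult sign_one)

lemma linear_algebraic_sign_group: "linear_algebraic_group 1 sign_group"
  unfolding linear_algebraic_group_def
proof (intro conjI group_sign_group)
  show "affine_variety 1 (carrier sign_group)"
    unfolding affine_variety_def
  proof (intro exI conjI)
    show "{\<lambda>x. x 0 * x 0 + complex_of_real (-1)} \<subseteq> real_polys 1"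
      by (simp only: insert_subset empty_subsetI simp_thms)
         (intro real_polys_add real_polys_mult real_polys_coord real_polys_const; simp)
    have "x = sign_point 1 \<or> x = sign_point (-1)" if "\<forall>i\<ge>1. x i = 0" "x 0 * x 0 = 1" for x
    proof -
      have "x 0 = 1 \<or> x 0 = -1" using that(2) square_eq_1_iff by blast
      moreover have "x = sign_point (x 0)" using that(1) by (auto simp: sign_point_def fun_eq_iff)
      ultimately show ?thesis by metis
    qed
    then show "carrier sign_group = {x \<in> affine_space 1. \<forall>p\<in>{\<lambda>x. x 0 * x 0 + complex_of_real (-1)}. p x = 0}"
      by (auto simp: sign_group_carrier affine_space_def) (auto simp: sign_point_def)
  qed
  show "regular_map2 1 (carrier sign_group) 1 (carrier sign_group) 1 (carrier sign_group) (\<lambda>g h. g \<otimes>\<^bsub>sign_group\<^esub> h)"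
    unfolding regular_map2_def
  proof (intro conjI allI impI)
    show "\<forall>x\<in>carrier sign_group. \<forall>y\<in>carrier sign_group. x \<otimes>\<^bsub>sign_group\<^esub> y \<in> carrier sign_group"
      by (auto simp: sign_group_carrier sign_mult)
    fix i :: nat assume "i < 1"
    have "(\<lambda>z. (\<lambda>(y, x). y 0) z * (\<lambda>(y, x). x 0) z) \<in> real_polys2 1 1"
      unfolding real_polys2_def by (intro real_subalgebra.mult real_subalgebra.gen) auto
    then show "\<exists>p\<in>real_polys2 1 1. \<forall>x\<in>carrier sign_group. \<forall>y\<in>carrier sign_group. (x \<otimes>\<^bsub>sign_group\<^esub> y) i = p (x, y)"
      by (rule bexI[rotated]) (use \<open>i < 1\<close> in \<open>auto simp: sign_group_def\<close>)
  qed
  show "regular_map 1 (carrier sign_group) 1 (carrier sign_group) (\<lambda>g. inv\<^bsub>sign_group\<^esub> g)"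
    unfolding regular_map_def using real_polys_coord[of 0 1] by (auto simp: sign_inv)
  show "\<one>\<^bsub>sign_group\<^esub> \<in> real_points (carrier sign_group)"
    by (auto simp: real_points_def sign_group_carrier sign_one) (simp add: sign_point_def)
qed

lemma real_points_sign_group: "real_points (carrier sign_group) = carrier sign_group"
  by (auto simp: real_points_def sign_group_carrier) (auto simp: sign_point_def)

lemma flip_apply: "z \<in> parabolas \<Longrightarrow> flip g z = z(1 := g 0 * z 1)"
  by (simp add: flip_def)

lemma flip_closed: "g \<in> carrier sign_group \<Longrightarrow> z \<in> parabolas \<Longrightarrow> flip g z \<in> parabolas"
  by (auto simp: flip_apply sign_group_carrier parabolas_def affine_space_def sign_point_def)

lemma flip_flip:
  assumes "g \<in> carrier sign_group" "h \<in> carrier sign_group" "z \<in> parabolas"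
  shows "flip g (flip h z) = flip (g \<otimes>\<^bsub>sign_group\<^esub> h) z"
  using assms flip_closed[of h z] by (auto simp: flip_apply sign_group_def)

lemma flip_involution: "g \<in> carrier sign_group \<Longrightarrow> z \<in> parabolas \<Longrightarrow> flip g (flip g z) = z"
  by (subst flip_flip) (auto simp: flip_apply sign_group_def sign_point_def)

lemma affine_G_variety_parabolas: "affine_G_variety 1 sign_group 2 parabolas flip"
  unfolding affine_G_variety_def
proof (intro conjI)
  show "affine_variety 2 parabolas"
    unfolding affine_variety_def
  proof (intro exI conjI)
    show "{\<lambda>x. x 1 * x 1 + complex_of_real (-1) * (x 0 * x 0 * x 0 * x 0)} \<subseteq> real_polys 2"
      by (simp only: insert_subset empty_subsetI simp_thms)
         (intro real_polys_add real_polys_mult real_polys_coord real_polys_const; simp)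
    show "parabolas = {x \<in> affine_space 2. \<forall>p\<in>{\<lambda>x. x 1 * x 1 + complex_of_real (-1) * (x 0 * x 0 * x 0 * x 0)}. p x = 0}"
      by (auto simp: parabolas_def)
  qed
  show "group_action sign_group parabolas flip"
  proof (intro group_action.intro group_hom.intro group_hom_axioms.intro group_sign_group group_BijGroup)
    have Bij: "flip g \<in> Bij parabolas" if "g \<in> carrier sign_group" for g
    proof -
      have "bij_betw (flip g) parabolas parabolas"
        using that by (intro bij_betw_byWitness[where f' = "flip g"]) (auto simp: flip_involution flip_closed)
      then show ?thesis by (auto simp: Bij_def flip_def)
    qed
    show "flip \<in> hom sign_group (BijGroup parabolas)"
    proof (rule homI)
      fix g h assume gh: "g \<in> carrier sign_group" "h \<in> carrier sign_group"
      have "flip (g \<otimes>\<^bsub>sign_group\<^esub> h) = compose parabolas (flip g) (flip h)"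
        using gh by (intro extensionalityI[of _ parabolas]) (auto simp: flip_flip compose_def, simp add: flip_def)
      then show "flip (g \<otimes>\<^bsub>sign_group\<^esub> h) = flip g \<otimes>\<^bsub>BijGroup parabolas\<^esub> flip h"
        using Bij gh by (simp add: BijGroup_def)
    qed (use Bij in \<open>simp add: BijGroup_def\<close>)
  qed
  show "regular_map2 1 (carrier sign_group) 2 parabolas 2 parabolas flip"
    unfolding regular_map2_def
  proof (intro conjI allI impI)
    show "\<forall>x\<in>carrier sign_group. \<forall>y\<in>parabolas. flip x y \<in> parabolas" by (auto simp: flip_closed)
    fix i :: nat assume "i < 2"
    have 0: "(\<lambda>(y, x). x 0) \<in> real_polys2 1 2"
      unfolding real_polys2_def by (intro real_subalgebra.gen) auto
    have 1: "(\<lambda>z. (\<lambda>(y, x). y 0) z * (\<lambda>(y, x). x 1) z) \<in> real_polys2 1 2"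
      unfolding real_polys2_def by (intro real_subalgebra.mult real_subalgebra.gen) auto
    show "\<exists>p\<in>real_polys2 1 2. \<forall>x\<in>carrier sign_group. \<forall>y\<in>parabolas. flip x y i = p (x, y)"
    proof (cases "i = 0")
      case True
      then show ?thesis by (intro bexI[OF _ 0]) (simp add: flip_apply)
    next
      case False
      then have "i = 1" using \<open>i < 2\<close> by simp
      then show ?thesis by (intro bexI[OF _ 1]) (simp add: flip_apply)
    qed
  qed
qed

interpretation flip: compact_algebraic_action 1 sign_group 2 parabolas flip
proof
  show "linear_algebraic_group 1 sign_group" by (rule linear_algebraic_sign_group)
  show "compact (real_points (carrier sign_group))"
    unfolding real_points_sign_group by (intro finite_imp_compact) (simp add: sign_group_def)
qed (rule affine_G_variety_parabolas)

definition real_parabolas :: "(nat \<Rightarrow> complex) set" where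
  "real_parabolas = real_points parabolas"

lemma flip_real: "invariant_set sign_group flip real_parabolas"
  unfolding invariant_set_def real_points_sign_group
proof (intro ballI image_subsetI)
  fix g z assume g: "g \<in> carrier sign_group" and z: "z \<in> real_parabolas"
  then have "g 0 \<in> \<real>" "z \<in> parabolas" "\<And>i. z i \<in> \<real>"
    by (auto simp: sign_group_carrier sign_point_def real_parabolas_def real_points_def)
  then show "flip g z \<in> real_parabolas"
    using flip_closed[OF g] by (auto simp: real_parabolas_def real_points_def flip_apply)
qed

lemma moment_setting_parabolas:
  "moment_setting 1 sign_group 2 parabolas flip real_parabolas (flip.nonneg_invariants real_parabolas)"
  unfolding moment_setting_def
proof (intro conjI flip.linear flip.compact flip.action flip_real)
  show "real_points_dense 1 (carrier sign_group)"
    by (simp add: real_points_dense_def real_points_sign_group)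
  show "basic_closed 2 parabolas real_parabolas"
    unfolding basic_closed_def real_parabolas_def by (rule exI[of _ "{}"]) simp
  show "quadratic_module (invariant_algebra sign_group 2 parabolas flip) (flip.nonneg_invariants real_parabolas)"
    by (rule flip.quadratic_module_nonneg_invariants) (simp add: real_parabolas_def)
qed

text \<open>The value of an invariant functional at \<open>f\<close> is half its value at the sum of \<open>f\<close> and its reflection,
which is invariant, and nonnegative on \<open>K\<close> if \<open>f\<close> is.  So Haviland's theorem applies, and averaging makes the
measure invariant.\<close>

lemma solves_invariant_parabolas:
  "solves_invariant_moment_problem sign_group 2 parabolas flip real_parabolas (flip.nonneg_invariants real_parabolas)"
  unfolding solves_invariant_moment_problem_def
proof (intro conjI allI impI)
  have K: "real_parabolas \<subseteq> real_points parabolas" by (simp add: real_parabolas_def)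
  have KV: "x \<in> parabolas" if "x \<in> real_parabolas" for x
    using that by (simp add: real_parabolas_def real_points_def)
  show "quadratic_module (invariant_algebra sign_group 2 parabolas flip) (flip.nonneg_invariants real_parabolas)"
    by (rule flip.quadratic_module_nonneg_invariants[OF K])
  fix L assume L: "invariant_functional sign_group 2 parabolas flip L"
  show "has_invariant_measure sign_group 2 parabolas flip real_parabolas L \<longleftrightarrow>
      (\<forall>f\<in>flip.nonneg_invariants real_parabolas. 0 \<le> L f)"
  proof
    assume "has_invariant_measure sign_group 2 parabolas flip real_parabolas L"
    then obtain \<mu> where \<mu>: "measure_on 2 parabolas real_parabolas \<mu>" "represents 2 parabolas \<mu> L"
      unfolding has_invariant_measure_def by blast
    show "\<forall>f\<in>flip.nonneg_invariants real_parabolas. 0 \<le> L f"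
    proof
      fix f assume f: "f \<in> flip.nonneg_invariants real_parabolas"
      then have "f \<in> carrier (coord_algebra 2 parabolas)"
        by (simp add: flip.nonneg_invariants_def invariant_algebra_simps)
      then have "L f = (\<integral>x. Re (f x) \<partial>\<mu>)" using \<mu>(2) by (simp add: represents_def)
      also have "0 \<le> \<dots>"
        using f \<mu>(1) by (intro integral_nonneg_AE AE_I2) (auto simp: flip.nonneg_invariants_def measure_on_def)
      finally show "0 \<le> L f" .
    qed
  next
    assume pos: "\<forall>f\<in>flip.nonneg_invariants real_parabolas. 0 \<le> L f"
    have lin: "linear_functional (coord_algebra 2 parabolas) L"
      using L by (simp add: invariant_functional_def)
    let ?s = "sign_point (-1)"
    have s: "?s \<in> real_points (carrier sign_group)" by (simp add: real_points_sign_group sign_group_carrier)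
    have "\<exists>\<mu>. measure_on 2 parabolas real_parabolas \<mu> \<and> represents 2 parabolas \<mu> L"
    proof (rule haviland_variety[OF K _ _ lin])
      show "closed real_parabolas"
        unfolding real_parabolas_def using flip.action
        by (intro closed_real_points closed_affine_variety[of 2]) (simp add: affine_G_variety_def)
      show "parabolas \<subseteq> affine_space 2" by (auto simp: parabolas_def)
      fix f assume f: "f \<in> carrier (coord_algebra 2 parabolas)" and f0: "\<And>x. x \<in> real_parabolas \<Longrightarrow> 0 \<le> Re (f x)"
      define f' where "f' = compose parabolas f (flip ?s)"
      define h where "h = (\<lambda>x\<in>parabolas. f x + f' x)"
      have f': "f' \<in> carrier (coord_algebra 2 parabolas)"
        unfolding f'_def by (rule flip.compose_action_in_coord_algebra[OF s f])
      have h_coord: "h \<in> carrier (coord_algebra 2 parabolas)"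
        unfolding h_def by (rule coord_algebra_add[OF f f'])
      have sC: "?s \<in> carrier sign_group" "sign_point 1 \<in> carrier sign_group" by (simp_all add: sign_group_carrier)
      have f'_eq: "f' x = f (flip ?s x)" if "x \<in> parabolas" for x using that by (simp add: f'_def compose_def)
      have one: "flip (sign_point 1) x = x" if "x \<in> parabolas" for x
        using that by (simp add: flip_apply sign_point_def)
      have "compose parabolas h (flip g) = h" if "g \<in> carrier sign_group" for g
      proof -
        have "h (flip g x) = h x" if "x \<in> parabolas" for x
          using \<open>g \<in> carrier sign_group\<close> that flip_closed[OF sC(1) that] flip_involution[OF sC(1) that]
          by (auto simp: sign_group_carrier one h_def f'_eq)
        then show ?thesis unfolding compose_def by (intro ext) (simp add: h_def)
      qed
      then have "h \<in> carrier (invariant_algebra sign_group 2 parabolas flip)"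
        using h_coord by (simp add: invariant_algebra_simps(1) real_points_sign_group)
      moreover have "0 \<le> Re (h x)" if x: "x \<in> real_parabolas" for x
      proof -
        have "flip ?s x \<in> real_parabolas" using flip_real s x by (auto simp: invariant_set_def)
        then show ?thesis using f0[OF x] f0[of "flip ?s x"] KV[OF x] by (simp add: h_def f'_eq)
      qed
      ultimately have "0 \<le> L h" using pos by (simp add: flip.nonneg_invariants_def)
      also have "L h = L f + L f'"
        using lin f f' by (simp add: h_def linear_functional_def coord_algebra_simps)
      also have "L f' = L f" using L f s by (simp add: f'_def invariant_functional_def)
      finally show "0 \<le> L f" by simp
    qed
    then show "has_invariant_measure sign_group 2 parabolas flip real_parabolas L"
      using flip.ex_invariant_representing_measure[OF K flip_real L] by blast
  qed
qed

text \<open>The real point above \<open>x\<close> on the parabola \<open>y = e x\<^sup>2\<close>, where \<open>e\<close> is \<open>1\<close> or \<open>-1\<close>.\<close>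

definition branch_point :: "real \<Rightarrow> real \<Rightarrow> nat \<Rightarrow> complex" where
  "branch_point e x = (\<lambda>i. if i = 0 then complex_of_real x else if i = 1 then complex_of_real (e * x\<^sup>2) else 0)"

lemma branch_point_in: "e\<^sup>2 = 1 \<Longrightarrow> branch_point e x \<in> real_parabolas"
  by (auto simp: branch_point_def real_parabolas_def real_points_def parabolas_def affine_space_def
      of_real_mult[symmetric] power2_eq_square algebra_simps simp del: of_real_mult) 

text \<open>The function is \<open>u(x) + v(x) y\<close>.  The values at real points suffice to determine \<open>u\<close> and \<open>v\<close>.\<close>

definition normal_form :: "((nat \<Rightarrow> complex) \<Rightarrow> complex) \<Rightarrow> real poly \<Rightarrow> real poly \<Rightarrow> bool" where
  "normal_form f u v \<longleftrightarrow>
     (\<forall>e x. e\<^sup>2 = 1 \<longrightarrow> f (branch_point e x) = complex_of_real (poly u x + e * x\<^sup>2 * poly v x))"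

lemma normal_form_unique:
  assumes "normal_form f u v" "normal_form f u' v'"
  shows "u = u' \<and> v = v'"
proof -
  have eq: "poly u x + e * x\<^sup>2 * poly v x = poly u' x + e * x\<^sup>2 * poly v' x" if "e\<^sup>2 = 1" for e x
    using assms that unfolding normal_form_def by (metis of_real_eq_iff)
  have "poly u x = poly u' x" for x using eq[of 1 x] eq[of "-1" x] by simp
  then have u: "u = u'" by (simp add: poly_eq_poly_eq_iff[symmetric] fun_eq_iff)
  have "poly (monom 1 2 * v) x = poly (monom 1 2 * v') x" for x
    using eq[of 1 x] u by (simp add: poly_monom)
  then have "monom 1 2 * v = monom 1 2 * v'" by (simp add: poly_eq_poly_eq_iff[symmetric] fun_eq_iff)
  then show ?thesis using u by (simp add: monom_eq_0_iff)
qed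

lemma normal_form_add:
  "normal_form f u v \<Longrightarrow> normal_form g u' v' \<Longrightarrow> normal_form (\<lambda>x. f x + g x) (u + u') (v + v')"
  by (simp add: normal_form_def algebra_simps)

lemma normal_form_mult:
  assumes "normal_form f u v" "normal_form g u' v'"
  shows "normal_form (\<lambda>x. f x * g x) (u * u' + monom 1 4 * (v * v')) (u * v' + v * u')"
  unfolding normal_form_def
proof (intro allI impI)
  fix e x :: real assume e: "e\<^sup>2 = 1"
  have "(poly u x + e * x\<^sup>2 * poly v x) * (poly u' x + e * x\<^sup>2 * poly v' x)
      = poly u x * poly u' x + e\<^sup>2 * x ^ 4 * (poly v x * poly v' x)
        + e * x\<^sup>2 * (poly u x * poly v' x + poly v x * poly u' x)"
    by (simp add: algebra_simps power2_eq_square power4_eq_xxxx)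
  also have "\<dots> = poly (u * u' + monom 1 4 * (v * v')) x + e * x\<^sup>2 * poly (u * v' + v * u') x"
    by (simp add: e poly_monom)
  finally have "complex_of_real (poly u x + e * x\<^sup>2 * poly v x) * complex_of_real (poly u' x + e * x\<^sup>2 * poly v' x)
      = complex_of_real (poly (u * u' + monom 1 4 * (v * v')) x + e * x\<^sup>2 * poly (u * v' + v * u') x)"
    by (simp only: of_real_mult[symmetric])
  then show "f (branch_point e x) * g (branch_point e x)
      = complex_of_real (poly (u * u' + monom 1 4 * (v * v')) x + e * x\<^sup>2 * poly (u * v' + v * u') x)"
    using assms e unfolding normal_form_def by simp
qed

lemma normal_form_const: "normal_form (\<lambda>_. complex_of_real c) [:c:] 0"
  by (simp add: normal_form_def)

lemma ex_normal_form_poly: "p \<in> real_polys 2 \<Longrightarrow> \<exists>u v. normal_form p u v"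
  unfolding real_polys_def
proof (induction rule: real_subalgebra.induct)
  case (gen f)
  then obtain i where i: "i < 2" "f = (\<lambda>x. x i)" by auto
  have "normal_form (\<lambda>x. x 0) [:0, 1:] 0" "normal_form (\<lambda>x. x 1) 0 1"
    by (simp_all add: normal_form_def branch_point_def)
  moreover have "i = 0 \<or> i = 1" using i by auto
  ultimately show ?case using i by blast
qed (use normal_form_const normal_form_add normal_form_mult in blast)+

lemma normal_form_restrict: "normal_form (restrict f parabolas) u v \<longleftrightarrow> normal_form f u v"
proof -
  have "branch_point e x \<in> parabolas" if "e\<^sup>2 = 1" for e x
    using branch_point_in[OF that] by (simp add: real_parabolas_def real_points_def)
  then show ?thesis by (simp add: normal_form_def)
qed

lemma ex_normal_form:
  "f \<in> carrier (coord_algebra 2 parabolas) \<Longrightarrow> \<exists>u v. normal_form f u v"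
  using ex_normal_form_poly by (auto simp: normal_form_restrict elim!: coord_algebra_carrierE)

definition singular_functional :: "((nat \<Rightarrow> complex) \<Rightarrow> complex) \<Rightarrow> real" where
  "singular_functional f = (THE r. \<exists>u v. normal_form f u v \<and> r = curve_functional u v)"

lemma singular_functional_eq:
  "normal_form f u v \<Longrightarrow> singular_functional f = curve_functional u v"
  unfolding singular_functional_def using normal_form_unique[of f] by (intro the_equality) blast+

lemma curve_functional_add:
  "curve_functional (u + u') (v + v') = curve_functional u v + curve_functional u' v'"
  by (simp add: curve_functional_def moments_add)

lemma linear_singular_functional: "linear_functional (coord_algebra 2 parabolas) singular_functional"
  unfolding linear_functional_def coord_algebra_simps
proof (intro conjI ballI allI)
  fix f g assume "f \<in> carrier (coord_algebra 2 parabolas)" "g \<in> carrier (coord_algebra 2 parabolas)"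
  then obtain u v u' v' where nf: "normal_form f u v" "normal_form g u' v'" using ex_normal_form by metis
  have "normal_form (\<lambda>x\<in>parabolas. f x + g x) (u + u') (v + v')"
    unfolding normal_form_restrict by (rule normal_form_add[OF nf])
  then show "singular_functional (\<lambda>x\<in>parabolas. f x + g x) = singular_functional f + singular_functional g"
    using nf by (simp add: singular_functional_eq curve_functional_add)
next
  fix c f assume "f \<in> carrier (coord_algebra 2 parabolas)"
  then obtain u v where nf: "normal_form f u v" using ex_normal_form by metis
  have "normal_form (\<lambda>x\<in>parabolas. complex_of_real c * f x) (Polynomial.smult c u) (Polynomial.smult c v)"
    unfolding normal_form_restrict using normal_form_mult[OF normal_form_const nf] by simp
  then show "singular_functional (\<lambda>x\<in>parabolas. complex_of_real c * f x) = c * singular_functional f"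
    using nf by (simp add: singular_functional_eq curve_functional_def moments_smult algebra_simps)
qed

text \<open>A nonnegative invariant is a polynomial \<open>w(x) = r\<^sup>2 + s\<^sup>2\<close>, so \<open>a\<^sup>2 w = (a r)\<^sup>2 + (a s)\<^sup>2\<close>.\<close>

lemma singular_functional_nonneg_invariant:
  assumes a: "a \<in> carrier (coord_algebra 2 parabolas)" and f: "f \<in> flip.nonneg_invariants real_parabolas"
  shows "0 \<le> singular_functional (\<lambda>x\<in>parabolas. a x * a x * f x)"
proof -
  let ?s = "sign_point (-1)"
  have fc: "f \<in> carrier (coord_algebra 2 parabolas)" and inv: "compose parabolas f (flip ?s) = f"
    using f by (auto simp: flip.nonneg_invariants_def invariant_algebra_simps(1) real_points_sign_group sign_group_carrier)
  obtain w v0 where nf: "normal_form f w v0" using ex_normal_form[OF fc] by blast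
  have in_par: "branch_point e x \<in> parabolas" if "e\<^sup>2 = 1" for e x
    using branch_point_in[OF that] by (simp add: real_parabolas_def real_points_def)
  have sym: "f (branch_point (- e) x) = f (branch_point e x)" if "e\<^sup>2 = 1" for e x
  proof -
    have "flip ?s (branch_point e x) = branch_point (- e) x"
      using in_par[OF that] by (auto simp: flip_apply branch_point_def sign_point_def)
    then show ?thesis using fun_cong[OF inv, of "branch_point e x"] in_par[OF that] by (simp add: compose_def)
  qed
  have val: "f (branch_point e x) = complex_of_real (poly w x)" if "e\<^sup>2 = 1" for e x
  proof -
    have "complex_of_real (poly w x + (- e) * x\<^sup>2 * poly v0 x) = complex_of_real (poly w x + e * x\<^sup>2 * poly v0 x)"
      using sym[OF that] nf that unfolding normal_form_def by (metis power2_minus)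
    then have "e * x\<^sup>2 * poly v0 x = 0" by (simp only: of_real_eq_iff)
    then show ?thesis using nf that by (simp add: normal_form_def)
  qed
  then have nf0: "normal_form f w 0" by (simp add: normal_form_def)
  have "0 \<le> poly w x" for x
    using f branch_point_in[of 1 x] val[of 1 x] by (auto simp: flip.nonneg_invariants_def)
  then obtain r s where w: "w = r * r + s * s" using nonneg_poly_sum_two_squares by blast
  obtain u v where nfa: "normal_form a u v" using ex_normal_form[OF a] by blast
  let ?sq = "\<lambda>t. curve_functional ((u * t) * (u * t) + monom 1 4 * ((v * t) * (v * t))) (2 * ((u * t) * (v * t)))"
  have "normal_form (\<lambda>x\<in>parabolas. a x * a x * f x)
      ((u * u + monom 1 4 * (v * v)) * w + monom 1 4 * ((u * v + v * u) * 0))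
      ((u * u + monom 1 4 * (v * v)) * 0 + (u * v + v * u) * w)"
    unfolding normal_form_restrict by (intro normal_form_mult nfa nf0)
  then have "singular_functional (\<lambda>x\<in>parabolas. a x * a x * f x)
      = curve_functional ((u * u + monom 1 4 * (v * v)) * w) ((u * v + v * u) * w)"
    by (simp add: singular_functional_eq)
  also have "\<dots> = ?sq r + ?sq s"
  proof -
    have 1: "(u * u + monom 1 4 * (v * v)) * w
        = ((u * r) * (u * r) + monom 1 4 * ((v * r) * (v * r))) + ((u * s) * (u * s) + monom 1 4 * ((v * s) * (v * s)))"
      unfolding w by (simp only: algebra_simps)
    have 2: "(u * v + v * u) * w = 2 * ((u * r) * (v * r)) + 2 * ((u * s) * (v * s))"
      unfolding w by (simp only: mult_2 algebra_simps)
    show ?thesis unfolding 1 2 by (rule curve_functional_add)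
  qed
  finally show ?thesis using curve_functional_square[of "u * r" "v * r"] curve_functional_square[of "u * s" "v * s"] by simp
qed

text \<open>The functions whose products with squares have nonnegative value form a quadratic module; it contains all
nonnegative invariants, hence \<open>M\<close>.  A representing measure cannot exist, because \<open>x\<^sup>2 + y \<ge> 0\<close> at all
real points while the functional is negative at this function.\<close>

lemma not_solves_moment_parabolas:
  "\<not> solves_moment_problem 2 parabolas real_parabolas
      (quadratic_module_generated (coord_algebra 2 parabolas) (flip.nonneg_invariants real_parabolas))"
proof
  let ?A = "coord_algebra 2 parabolas" and ?N = "flip.nonneg_invariants real_parabolas"
  let ?M = "quadratic_module_generated ?A ?N"
  assume smp: "solves_moment_problem 2 parabolas real_parabolas ?M"
  have N: "?N \<subseteq> carrier ?A" by (auto simp: flip.nonneg_invariants_def invariant_algebra_simps(1))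
  define Q where "Q = {f \<in> carrier ?A. \<forall>a\<in>carrier ?A. 0 \<le> singular_functional (\<lambda>x\<in>parabolas. a x * a x * f x)}"
  have one: "(\<lambda>x\<in>parabolas. 1) \<in> ?N"
    using flip.quadratic_module_nonneg_invariants[of real_parabolas]
    by (simp add: quadratic_module_def invariant_algebra_simps real_parabolas_def)
  have "quadratic_module ?A Q"
    unfolding quadratic_module_def coord_algebra_simps
  proof (intro conjI ballI)
    show "Q \<subseteq> carrier ?A" by (auto simp: Q_def)
    show "(\<lambda>x\<in>parabolas. 1) \<in> Q"
      using one N singular_functional_nonneg_invariant[OF _ one] by (auto simp: Q_def)
    fix p q assume pq: "p \<in> Q" "q \<in> Q"
    have "0 \<le> singular_functional (\<lambda>x\<in>parabolas. a x * a x * (\<lambda>x\<in>parabolas. p x + q x) x)" if a: "a \<in> carrier ?A" for a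
    proof -
      let ?m = "\<lambda>p. \<lambda>x\<in>parabolas. (\<lambda>x\<in>parabolas. a x * a x) x * p x"
      have m: "?m p = (\<lambda>x\<in>parabolas. a x * a x * p x)" for p by (auto simp: fun_eq_iff)
      have sum: "(\<lambda>x\<in>parabolas. a x * a x * (\<lambda>x\<in>parabolas. p x + q x) x) = (\<lambda>x\<in>parabolas. ?m p x + ?m q x)"
        by (auto simp: fun_eq_iff algebra_simps)
      have split: "singular_functional (\<lambda>x\<in>parabolas. ?m p x + ?m q x)
          = singular_functional (?m p) + singular_functional (?m q)"
      proof -
        have "?m p \<in> carrier ?A" "?m q \<in> carrier ?A"
          using pq by (auto simp: Q_def simp del: restrict_apply intro: coord_algebra_mult[OF coord_algebra_mult[OF a a]])
        then show ?thesis
          using linear_singular_functional unfolding linear_functional_def coord_algebra_simps by blast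
      qed
      have "0 \<le> singular_functional (?m r)" if "r \<in> Q" for r
        unfolding m using that a unfolding Q_def by blast
      then show ?thesis unfolding sum split using pq by (intro add_nonneg_nonneg)
    qed
    then show "(\<lambda>x\<in>parabolas. p x + q x) \<in> Q" using pq by (auto simp: Q_def intro: coord_algebra_add)
  next
    fix b p assume b: "b \<in> carrier ?A" and p: "p \<in> Q"
    have "0 \<le> singular_functional (\<lambda>x\<in>parabolas. a x * a x * (\<lambda>x\<in>parabolas. (\<lambda>x\<in>parabolas. b x * b x) x * p x) x)"
      if a: "a \<in> carrier ?A" for a
    proof -
      have ab: "(\<lambda>x\<in>parabolas. a x * b x) \<in> carrier ?A" using a b by (rule coord_algebra_mult)
      have eq: "(\<lambda>x\<in>parabolas. a x * a x * (\<lambda>x\<in>parabolas. (\<lambda>x\<in>parabolas. b x * b x) x * p x) x)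
          = (\<lambda>x\<in>parabolas. (\<lambda>x\<in>parabolas. a x * b x) x * (\<lambda>x\<in>parabolas. a x * b x) x * p x)"
        by (auto simp: fun_eq_iff)
      show ?thesis unfolding eq using p ab unfolding Q_def by blast
    qed
    then show "(\<lambda>x\<in>parabolas. (\<lambda>x\<in>parabolas. b x * b x) x * p x) \<in> Q"
      using b p unfolding Q_def by (intro CollectI conjI coord_algebra_mult) auto
  qed
  moreover have "?N \<subseteq> Q" using N singular_functional_nonneg_invariant by (auto simp: Q_def)
  ultimately have MQ: "?M \<subseteq> Q" by (rule quadratic_module_generated_least)
  have "0 \<le> singular_functional f" if f: "f \<in> ?M" for f
  proof -
    have fc: "f \<in> carrier ?A" using f MQ by (auto simp: Q_def)
    have "0 \<le> singular_functional (\<lambda>x\<in>parabolas. (\<lambda>x\<in>parabolas. 1) x * (\<lambda>x\<in>parabolas. 1) x * f x)"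
      using f MQ one N unfolding Q_def by blast
    also have "(\<lambda>x\<in>parabolas. (\<lambda>x\<in>parabolas. 1) x * (\<lambda>x\<in>parabolas. 1) x * f x) = f"
      using fc by (auto simp: fun_eq_iff elim!: coord_algebra_carrierE)
    finally show ?thesis .
  qed
  then obtain \<mu> where \<mu>: "measure_on 2 parabolas real_parabolas \<mu>" "represents 2 parabolas \<mu> singular_functional"
    using smp linear_singular_functional unfolding solves_moment_problem_def by blast
  define p :: "(nat \<Rightarrow> complex) \<Rightarrow> complex" where "p = (\<lambda>x. x 0 * x 0 + x 1)"
  have pp: "p \<in> real_polys 2" unfolding p_def
    by (intro real_polys_add real_polys_mult real_polys_coord) auto
  have "normal_form p (monom 1 2) 1"
    by (simp add: normal_form_def p_def branch_point_def poly_monom power2_eq_square)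
  then have val: "singular_functional (restrict p parabolas) = 16 - 64"
    by (simp add: singular_functional_eq normal_form_restrict curve_functional_def moments_monom moment_def)
  have integral: "singular_functional (restrict p parabolas) = (\<integral>x. Re (restrict p parabolas x) \<partial>\<mu>)"
    using \<mu>(2) coord_algebra_carrierI[OF pp] by (simp add: represents_def)
  have "0 \<le> (\<integral>x. Re (restrict p parabolas x) \<partial>\<mu>)"
  proof (rule integral_nonneg_AE[OF AE_I2])
    fix z assume "z \<in> space \<mu>"
    then have "z \<in> real_parabolas" using \<mu>(1) by (simp add: measure_on_def)
    then have z: "z \<in> parabolas" "z 0 \<in> \<real>" "z 1 \<in> \<real>" "z 1 * z 1 = z 0 * z 0 * z 0 * z 0"
      by (auto simp: real_parabolas_def real_points_def parabolas_def)
    obtain x y where xy: "z 0 = complex_of_real x" "z 1 = complex_of_real y" using z(2,3) by (auto elim!: Reals_cases)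
    have "y\<^sup>2 = (x\<^sup>2)\<^sup>2"
      using z(4) unfolding xy of_real_mult[symmetric] of_real_eq_iff by (simp add: power2_eq_square mult.assoc)
    then have "y = x\<^sup>2 \<or> y = - x\<^sup>2" by (simp only: power2_eq_iff)
    then have "0 \<le> x * x + y" by (auto simp: power2_eq_square)
    then show "0 \<le> Re (restrict p parabolas z)" using z(1) xy by (simp add: p_def)
  qed
  then show False using val integral by linarith
qed

theorem corollary6p19:
  shows "(\<forall>m G n V \<phi> K N M.
            moment_setting m G n V \<phi> K N \<and>
            M = quadratic_module_generated (coord_algebra n V) N \<longrightarrow>
              (solves_moment_problem n V K M \<longrightarrow>
                 solves_averaged_moment_problem G n V \<phi> K M) \<and>
              (solves_invariant_moment_problem G n V \<phi> K N \<longrightarrow>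
                 solves_averaged_moment_problem G n V \<phi> K M))
       \<and> (\<exists>m G n V \<phi> K N M.
            moment_setting m G n V \<phi> K N \<and>
            M = quadratic_module_generated (coord_algebra n V) N \<and>
            solves_invariant_moment_problem G n V \<phi> K N \<and>
            \<not> solves_moment_problem n V K M)
       \<and> (\<exists>m G n V \<phi> K N M.
            moment_setting m G n V \<phi> K N \<and>
            M = quadratic_module_generated (coord_algebra n V) N \<and>
            solves_averaged_moment_problem G n V \<phi> K M \<and>
            \<not> solves_moment_problem n V K M)"
proof -
  have implications: "(solves_moment_problem n V K M \<longrightarrow> solves_averaged_moment_problem G n V \<phi> K M) \<and>
      (solves_invariant_moment_problem G n V \<phi> K N \<longrightarrow> solves_averaged_moment_problem G n V \<phi> K M)"
    if set: "moment_setting m G n V \<phi> K N" and M: "M = quadratic_module_generated (coord_algebra n V) N"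
    for m G n V \<phi> K N M
  proof -
    have act: "compact_algebraic_action m G n V \<phi>"
      using set by (simp add: moment_setting_def compact_algebraic_action_def)
    have K: "K \<subseteq> real_points V" and inv: "invariant_set G \<phi> K"
      using set by (auto simp: moment_setting_def basic_closed_def)
    show ?thesis
      using solves_moment_imp_averaged[OF act K inv]
        compact_algebraic_action.solves_invariant_imp_averaged[OF act K inv _ M] by blast
  qed
  let ?N = "flip.nonneg_invariants real_parabolas"
  let ?M = "quadratic_module_generated (coord_algebra 2 parabolas) ?N"
  have averaged: "solves_averaged_moment_problem sign_group 2 parabolas flip real_parabolas ?M"
    using implications[OF moment_setting_parabolas refl] solves_invariant_parabolas by blast
  show ?thesis
  proof (intro conjI)
    show "\<exists>m G n V \<phi> K N M. moment_setting m G n V \<phi> K N \<and>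
        M = quadratic_module_generated (coord_algebra n V) N \<and>
        solves_invariant_moment_problem G n V \<phi> K N \<and> \<not> solves_moment_problem n V K M"
      by (intro exI conjI, rule moment_setting_parabolas, rule refl,
          rule solves_invariant_parabolas, rule not_solves_moment_parabolas)
    show "\<exists>m G n V \<phi> K N M. moment_setting m G n V \<phi> K N \<and>
        M = quadratic_module_generated (coord_algebra n V) N \<and>
        solves_averaged_moment_problem G n V \<phi> K M \<and> \<not> solves_moment_problem n V K M"
      by (intro exI conjI, rule moment_setting_parabolas, rule refl,
          rule averaged, rule not_solves_moment_parabolas)
  qed (use implications in blast)
qed

end
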